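(* Let $A$ generate a $C_0$-semigroup on the complex Hilbert space $H$, let $B\in\mathcal{L}(U,(\mathrm{dom}\,A^* )')$, and assume that for every $T>0$ the map $u\mapsto Lu$, $(Lu)(t)=\int_0^t e^{\mathcal{A}(t-s)}Bu(s)\,ds$, is linear and continuous from $L^2(0,T;U)$ into $L^2(0,T;H)$. Suppose that the semigroup $e^{At}$ is eventually compact. Consider the system $\dot y=\mathcal{A}y+Bu$, $y(0)=y_0\in H$. If $s(A)\le 0$, then the system is null controllable if and only if it is NCVE. If $s(A)>0$, then the system is not NCVE.
   Context: Setting. $H$ is a complex Hilbert space with inner product $\langle\cdot,\cdot\rangle$ and norm $|\cdot|$; $A$ generates a $C_0$-semigroup $e^{At}$ on $H$; $A^*$ is its Hilbert space adjoint. The space $\mathrm{dom}\,A^*$ with the graph norm is a Hilbert space, not identified with its dual; $H$ is identified with its dual, so $\mathrm{dom}\,A^*\subset H=H'\subset(\mathrm{dom}\,A^* )'$ with continuous dense injections. $\mathcal{A}$ denotes the extension of $A$ to $(\mathrm{dom}\,A^* )'$ (the dual of $A^*\in\mathcal{L}(\mathrm{dom}\,A^*,H)$); its domain is $H$ and it generates a $C_0$-semigroup $e^{\mathcal{A}t}$ on $(\mathrm{dom}\,A^* )'$ extending $e^{At}$. $U$ is a Hilbert space. The solution of the system with initial state $y_0\in H$ and control $u\in L^2_{\rm loc}(0,+\infty;U)$ is $y^{y_0,u}(t)=e^{At}y_0+\int_0^t e^{\mathcal{A}(t-s)}Bu(s)\,ds$, which belongs to $L^2_{\rm loc}(0,+\infty;H)$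 under the assumption on $L$. Definitions. $y_0\in H$ can be steered to the rest in time (at most) $T$ if there is a control $u\in L^2_{\rm loc}(0,+\infty;U)$ with support in $[0,T]$ such that $y^{y_0,u}$ has support in $[0,T]$ too. The system is null controllable if every $y_0\in H$ can be steered to the rest in a suitable time $T_{y_0}$ at most. An element $y_0$ that can be steered to the rest is NCVE if for every $\epsilon>0$ there are a time $T_\epsilon$ and a control $u_\epsilon$ with support in $[0,T_\epsilon]$ steering $y_0$ to the rest in time at most $T_\epsilon$ with $\int_0^{+\infty}|u_\epsilon(s)|^2ds\le\epsilon^2$. The system is NCVE (null controllable with vanishing energy) if every element of $H$ is NCVE. The semigroup $e^{At}$ is eventually compact if there is $t_0>0$ such that $e^{At}$ is a compact operator for every $t\ge t_0$. The spectral bound is $s(A)=\sup\{\mathrm{Re}\,\lambda:\lambda\in\sigma(A)\}$, with $s(A)=-\infty$ if $\sigma(A)=\emptyset$. *)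

theory Defs
  imports "HOL-Analysis.Analysis"
begin

section \<open>Complex Hilbert spaces and bounded operators\<close>

class complex_vector = real_vector +
  fixes scaleC :: "complex \<Rightarrow> 'a \<Rightarrow> 'a" (infixr "*\<^sub>C" 75)
  assumes scaleC_add_right: "c *\<^sub>C (x + y) = c *\<^sub>C x + c *\<^sub>C y"
    and scaleC_add_left: "(c + d) *\<^sub>C x = c *\<^sub>C x + d *\<^sub>C x"
    and scaleC_scaleC: "c *\<^sub>C d *\<^sub>C x = (c * d) *\<^sub>C x"
    and scaleC_of_real: "of_real r *\<^sub>C x = r *\<^sub>R x"

(* The complex inner product is linear in its first argument. Its real part is the inner product
   of the underlying real Hilbert space, so norm x = sqrt (cinner x x) is inherited. *)
class complex_hilbert = complex_vector + real_inner + banach +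
  fixes cinner :: "'a \<Rightarrow> 'a \<Rightarrow> complex"
  assumes cinner_commute: "cinner x y = cnj (cinner y x)"
    and cinner_add_left: "cinner (x + y) z = cinner x z + cinner y z"
    and cinner_scaleC_left: "cinner (c *\<^sub>C x) y = c * cinner x y"
    and Re_cinner: "Re (cinner x y) = inner x y"

instantiation complex :: complex_hilbert
begin
definition scaleC_complex :: "complex \<Rightarrow> complex \<Rightarrow> complex" where "scaleC_complex c x = c * x"
definition cinner_complex :: "complex \<Rightarrow> complex \<Rightarrow> complex" where "cinner_complex x y = x * cnj y"
instance
  by standard
    (auto simp: scaleC_complex_def cinner_complex_def algebra_simps inner_complex_def scaleR_conv_of_real)
end

definition bounded_clinear ::
  "('a::{real_normed_vector, complex_vector} \<Rightarrow> 'b::{real_normed_vector, complex_vector}) \<Rightarrow> bool" where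
  "bounded_clinear f \<longleftrightarrow> bounded_linear f \<and> (\<forall>c x. f (c *\<^sub>C x) = c *\<^sub>C f x)"

definition compact_operator ::
  "('a::{real_normed_vector, complex_vector} \<Rightarrow> 'b::{real_normed_vector, complex_vector}) \<Rightarrow> bool" where
  "compact_operator f \<longleftrightarrow> bounded_clinear f \<and> (\<forall>X. bounded X \<longrightarrow> compact (closure (f ` X)))"

section \<open>Semigroups, spectrum, adjoint\<close>

(* An unbounded operator is a pair of its domain and a total function whose values outside the
   domain are irrelevant; a semigroup is a family S t of which only the members with t \<ge> 0 matter. *)

definition C0_semigroup :: "(real \<Rightarrow> 'a::complex_hilbert \<Rightarrow> 'a) \<Rightarrow> bool" where
  "C0_semigroup S \<longleftrightarrow>
     (\<forall>t\<ge>0. bounded_clinear (S t)) \<and> S 0 = id \<and>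
     (\<forall>s\<ge>0. \<forall>t\<ge>0. S (s + t) = S s \<circ> S t) \<and>
     (\<forall>x. ((\<lambda>t. S t x) \<longlongrightarrow> x) (at_right 0))"

definition generates_C0_semigroup ::
  "'a::complex_hilbert set \<Rightarrow> ('a \<Rightarrow> 'a) \<Rightarrow> (real \<Rightarrow> 'a \<Rightarrow> 'a) \<Rightarrow> bool" where
  "generates_C0_semigroup D A S \<longleftrightarrow> C0_semigroup S \<and>
     (\<forall>x y. x \<in> D \<and> A x = y \<longleftrightarrow> ((\<lambda>t. (S t x - x) /\<^sub>R t) \<longlongrightarrow> y) (at_right 0))"

definition eventually_compact :: "(real \<Rightarrow> 'a::complex_hilbert \<Rightarrow> 'a) \<Rightarrow> bool" where
  "eventually_compact S \<longleftrightarrow> (\<exists>t0>0. \<forall>t\<ge>t0. compact_operator (S t))"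

definition resolvent_set :: "'a::complex_hilbert set \<Rightarrow> ('a \<Rightarrow> 'a) \<Rightarrow> complex set" where
  "resolvent_set D A = {l. bij_betw (\<lambda>x. l *\<^sub>C x - A x) D UNIV \<and>
     (\<exists>K. \<forall>x\<in>D. norm x \<le> K * norm (l *\<^sub>C x - A x))}"

definition spectrum :: "'a::complex_hilbert set \<Rightarrow> ('a \<Rightarrow> 'a) \<Rightarrow> complex set" where
  "spectrum D A = - resolvent_set D A"

definition spectral_bound :: "'a::complex_hilbert set \<Rightarrow> ('a \<Rightarrow> 'a) \<Rightarrow> ereal" where
  "spectral_bound D A = (SUP l\<in>spectrum D A. ereal (Re l))"

definition adjoint_dom :: "'a::complex_hilbert set \<Rightarrow> ('a \<Rightarrow> 'a) \<Rightarrow> 'a set" where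
  "adjoint_dom D A = {z. \<exists>w. \<forall>x\<in>D. cinner (A x) z = cinner x w}"

definition adjoint_op :: "'a::complex_hilbert set \<Rightarrow> ('a \<Rightarrow> 'a) \<Rightarrow> 'a \<Rightarrow> 'a" where
  "adjoint_op D A z = (THE w. \<forall>x\<in>D. cinner (A x) z = cinner x w)"

definition adjoint_graph_norm :: "'a::complex_hilbert set \<Rightarrow> ('a \<Rightarrow> 'a) \<Rightarrow> 'a \<Rightarrow> real" where
  "adjoint_graph_norm D A z = sqrt ((norm z)\<^sup>2 + (norm (adjoint_op D A z))\<^sup>2)"

section \<open>The dual of the domain of the adjoint\<close>

(* Dual elements are taken to be conjugate-linear functionals, so that the identification
   x \<mapsto> cinner x of H with its dual is complex linear. *)
definition bounded_antifunctional ::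
  "'a::complex_hilbert set \<Rightarrow> ('a \<Rightarrow> real) \<Rightarrow> ('a \<Rightarrow> complex) \<Rightarrow> bool" where
  "bounded_antifunctional W N f \<longleftrightarrow>
     (\<forall>x\<in>W. \<forall>y\<in>W. f (x + y) = f x + f y) \<and>
     (\<forall>c. \<forall>x\<in>W. f (c *\<^sub>C x) = cnj c * f x) \<and>
     (\<exists>K. \<forall>x\<in>W. cmod (f x) \<le> K * N x)"

(* A type cannot depend on the domain of the adjoint, so the dual of the subspace W with norm N is
   represented by a type 'v together with a duality pairing which makes 'v, linearly and
   isometrically, the space of all bounded functionals on W. *)
definition is_dual_of ::
  "('v::complex_hilbert \<Rightarrow> 'a::complex_hilbert \<Rightarrow> complex) \<Rightarrow> 'a set \<Rightarrow> ('a \<Rightarrow> real) \<Rightarrow> bool" where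
  "is_dual_of pair W N \<longleftrightarrow>
     (\<forall>v. bounded_antifunctional W N (pair v)) \<and>
     (\<forall>f. bounded_antifunctional W N f \<longrightarrow> (\<exists>!v. \<forall>x\<in>W. pair v x = f x)) \<and>
     (\<forall>v w. \<forall>x\<in>W. pair (v + w) x = pair v x + pair w x) \<and>
     (\<forall>c v. \<forall>x\<in>W. pair (c *\<^sub>C v) x = c * pair v x) \<and>
     (\<forall>v. norm v = (SUP x\<in>{x\<in>W. N x \<le> 1}. cmod (pair v x)))"

definition dual_embedding ::
  "'a::complex_hilbert set \<Rightarrow> ('v::complex_hilbert \<Rightarrow> 'a \<Rightarrow> complex) \<Rightarrow> 'a \<Rightarrow> 'v" where
  "dual_embedding W pair x = (THE v. \<forall>\<phi>\<in>W. pair v \<phi> = cinner x \<phi>)"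

(* The dual of the bounded operator from dom A* (graph norm) to H given by A*; it sends the image of
   x under the embedding to the functional \<phi> \<mapsto> cinner x (A* \<phi>). *)
definition extended_op ::
  "'a::complex_hilbert set \<Rightarrow> ('a \<Rightarrow> 'a) \<Rightarrow> ('v::complex_hilbert \<Rightarrow> 'a \<Rightarrow> complex) \<Rightarrow> 'v \<Rightarrow> 'v" where
  "extended_op D A pair v =
     (THE w. \<exists>x. v = dual_embedding (adjoint_dom D A) pair x \<and>
        (\<forall>\<phi>\<in>adjoint_dom D A. pair w \<phi> = cinner x (adjoint_op D A \<phi>)))"

section \<open>Bochner integral and \<open>L\<^sup>2\<close> without separability\<close>

(* The library's Bochner integral requires a second countable range type. These are the same notions
   with Borel measurability replaced by strong measurability. *)

definition strongly_measurable :: "'a measure \<Rightarrow> ('a \<Rightarrow> 'b::real_normed_vector) \<Rightarrow> bool" where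
  "strongly_measurable M f \<longleftrightarrow>
     (\<exists>s. (\<forall>i. simple_function M (s i)) \<and> (AE x in M. (\<lambda>i. s i x) \<longlonglongrightarrow> f x))"

definition has_strong_integral :: "'a measure \<Rightarrow> ('a \<Rightarrow> 'b::real_normed_vector) \<Rightarrow> 'b \<Rightarrow> bool" where
  "has_strong_integral M f I \<longleftrightarrow> strongly_measurable M f \<and>
     (\<exists>s. (\<forall>i. Bochner_Integration.simple_bochner_integrable M (s i)) \<and>
          (\<lambda>i. \<integral>\<^sup>+x. ennreal (norm (f x - s i x)) \<partial>M) \<longlonglongrightarrow> 0 \<and>
          (\<lambda>i. Bochner_Integration.simple_bochner_integral M (s i)) \<longlonglongrightarrow> I)"

definition strong_integral :: "'a measure \<Rightarrow> ('a \<Rightarrow> 'b::real_normed_vector) \<Rightarrow> 'b" where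
  "strong_integral M f = (THE I. has_strong_integral M f I)"

definition L2_on :: "real set \<Rightarrow> (real \<Rightarrow> 'b::real_normed_vector) \<Rightarrow> bool" where
  "L2_on X f \<longleftrightarrow>
     strongly_measurable (lebesgue_on X) f \<and> integrable (lebesgue_on X) (\<lambda>s. (norm (f s))\<^sup>2)"

definition L2_norm_on :: "real set \<Rightarrow> (real \<Rightarrow> 'b::real_normed_vector) \<Rightarrow> real" where
  "L2_norm_on X f = sqrt (\<integral>s. (norm (f s))\<^sup>2 \<partial>lebesgue_on X)"

definition L2_loc :: "(real \<Rightarrow> 'b::real_normed_vector) \<Rightarrow> bool" where
  "L2_loc f \<longleftrightarrow> (\<forall>T>0. L2_on {0..T} f)"

(* Support of (the class of) a function on [0, \<infinity>). *)
definition supported_upto :: "real \<Rightarrow> (real \<Rightarrow> 'b::real_normed_vector) \<Rightarrow> bool" where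
  "supported_upto T f \<longleftrightarrow> (AE t in lebesgue_on {0..}. t > T \<longrightarrow> f t = 0)"

section \<open>The control system\<close>

(* Throughout, emb is the embedding of H into the dual V of dom A*, S and SV are the semigroups on H
   and on V, and B maps U into V. *)

definition input_map ::
  "(real \<Rightarrow> 'v::complex_hilbert \<Rightarrow> 'v) \<Rightarrow> ('u::complex_hilbert \<Rightarrow> 'v) \<Rightarrow> (real \<Rightarrow> 'u) \<Rightarrow> real \<Rightarrow> 'v" where
  "input_map SV B u t = strong_integral (lebesgue_on {0..t}) (\<lambda>s. SV (t - s) (B (u s)))"

(* The values of the input map lie in V; the condition says that almost all of them lie in H and
   that the resulting map into L^2(0,T;H), linear by linearity of the integral, is bounded. *)
definition L2_continuous_input_map ::
  "('h::complex_hilbert \<Rightarrow> 'v::complex_hilbert) \<Rightarrow> (real \<Rightarrow> 'v \<Rightarrow> 'v) \<Rightarrow>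
    ('u::complex_hilbert \<Rightarrow> 'v) \<Rightarrow> real \<Rightarrow> bool" where
  "L2_continuous_input_map emb SV B T \<longleftrightarrow>
     (\<exists>K. \<forall>u. L2_on {0..T} u \<longrightarrow>
        (\<exists>z. L2_on {0..T} z \<and> (AE t in lebesgue_on {0..T}. emb (z t) = input_map SV B u t) \<and>
             L2_norm_on {0..T} z \<le> K * L2_norm_on {0..T} u))"

definition solution ::
  "('h::complex_hilbert \<Rightarrow> 'v::complex_hilbert) \<Rightarrow> (real \<Rightarrow> 'h \<Rightarrow> 'h) \<Rightarrow> (real \<Rightarrow> 'v \<Rightarrow> 'v) \<Rightarrow>
    ('u::complex_hilbert \<Rightarrow> 'v) \<Rightarrow> 'h \<Rightarrow> (real \<Rightarrow> 'u) \<Rightarrow> real \<Rightarrow> 'v" where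
  "solution emb S SV B y0 u t = emb (S t y0) + input_map SV B u t"

definition steers_to_rest ::
  "('h::complex_hilbert \<Rightarrow> 'v::complex_hilbert) \<Rightarrow> (real \<Rightarrow> 'h \<Rightarrow> 'h) \<Rightarrow> (real \<Rightarrow> 'v \<Rightarrow> 'v) \<Rightarrow>
    ('u::complex_hilbert \<Rightarrow> 'v) \<Rightarrow> 'h \<Rightarrow> (real \<Rightarrow> 'u) \<Rightarrow> real \<Rightarrow> bool" where
  "steers_to_rest emb S SV B y0 u T \<longleftrightarrow>
     T \<ge> 0 \<and> L2_loc u \<and> supported_upto T u \<and> supported_upto T (solution emb S SV B y0 u)"

definition can_be_steered ::
  "('h::complex_hilbert \<Rightarrow> 'v::complex_hilbert) \<Rightarrow> (real \<Rightarrow> 'h \<Rightarrow> 'h) \<Rightarrow> (real \<Rightarrow> 'v \<Rightarrow> 'v) \<Rightarrow>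
    ('u::complex_hilbert \<Rightarrow> 'v) \<Rightarrow> 'h \<Rightarrow> bool" where
  "can_be_steered emb S SV B y0 \<longleftrightarrow> (\<exists>T u. steers_to_rest emb S SV B y0 u T)"

definition null_controllable ::
  "('h::complex_hilbert \<Rightarrow> 'v::complex_hilbert) \<Rightarrow> (real \<Rightarrow> 'h \<Rightarrow> 'h) \<Rightarrow> (real \<Rightarrow> 'v \<Rightarrow> 'v) \<Rightarrow>
    ('u::complex_hilbert \<Rightarrow> 'v) \<Rightarrow> bool" where
  "null_controllable emb S SV B \<longleftrightarrow> (\<forall>y0. can_be_steered emb S SV B y0)"

definition NCVE_element ::
  "('h::complex_hilbert \<Rightarrow> 'v::complex_hilbert) \<Rightarrow> (real \<Rightarrow> 'h \<Rightarrow> 'h) \<Rightarrow> (real \<Rightarrow> 'v \<Rightarrow> 'v) \<Rightarrow>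
    ('u::complex_hilbert \<Rightarrow> 'v) \<Rightarrow> 'h \<Rightarrow> bool" where
  "NCVE_element emb S SV B y0 \<longleftrightarrow> can_be_steered emb S SV B y0 \<and>
     (\<forall>\<epsilon>>0. \<exists>T u. steers_to_rest emb S SV B y0 u T \<and>
        (\<integral>s. (norm (u s))\<^sup>2 \<partial>lebesgue_on {0..}) \<le> \<epsilon>\<^sup>2)"

definition NCVE ::
  "('h::complex_hilbert \<Rightarrow> 'v::complex_hilbert) \<Rightarrow> (real \<Rightarrow> 'h \<Rightarrow> 'h) \<Rightarrow> (real \<Rightarrow> 'v \<Rightarrow> 'v) \<Rightarrow>
    ('u::complex_hilbert \<Rightarrow> 'v) \<Rightarrow> bool" where
  "NCVE emb S SV B \<longleftrightarrow> (\<forall>y0. NCVE_element emb S SV B y0)"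

end

theory Submission
  imports Defs "HOL-Complex_Analysis.Cauchy_Integral_Formula"
begin

text \<open>
  Let \<open>p y\<close> be the infimum of the energies \<open>\<integral> |u|\<^sup>2\<close> of the controls \<open>u\<close> steering \<open>y\<close> to rest and
  \<open>K = S r\<close> a compact member of the semigroup. If the system is null controllable, then by Baire's
  theorem \<open>p y \<le> c |y|\<^sup>2\<close>. If \<open>u\<close> steers \<open>y\<close> to rest before time \<open>t\<close> and \<open>v\<close> steers the free state \<open>S t y\<close>
  to rest, then \<open>\<epsilon>u + (1 - \<epsilon>)v\<close>, with \<open>v\<close> delayed by \<open>t\<close>, steers \<open>y\<close> to rest at cost
  \<open>\<epsilon>\<^sup>2 |u|\<^sup>2 + (1 - \<epsilon>)\<^sup>2 |v|\<^sup>2\<close>. Hence \<open>p y = 0\<close> as soon as \<open>p\<close> is bounded along the free orbit of \<open>y\<close>. The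
  null space \<open>N\<close> of \<open>p\<close> is invariant under \<open>K\<close>. When the spectrum lies in the closed left half plane, \<open>K\<close>
  has no eigenvalues outside the closed unit disc, so an eigenvector of \<open>K\<close> modulo \<open>N\<close> would have
  \<open>p\<close> bounded along its orbit and lie in \<open>N\<close>. The operator induced by \<open>K\<close> on the orthogonal complement of \<open>N\<close> is
  therefore compact without eigenvalues, its resolvent is entire, its orbits are bounded, and \<open>p\<close>
  vanishes identically.

  If the spectrum meets the open right half plane, Fredholm's alternative for \<open>K\<close> gives a nonzero
  functional \<open>f\<close> with \<open>f \<circ> K = m f\<close> and \<open>|m| > 1\<close>; such an \<open>f\<close> is dominated by the energy of any control
  steering to rest, so the energy cannot be made arbitrarily small.
\<close>

section \<open>Complex Hilbert spaces\<close>

text \<open>Two obstacles shape the argument. First, the input map takes values in the large space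
  \<open>'v\<close>; its values lie in \<open>H\<close> only for almost every time, with a bound in
  the mean over time. A restart therefore needs a suitably chosen time, which is in general no
  multiple of \<open>r\<close>, and what is learnt there has to be carried back to \<open>r\<close>.
  This makes the invariance of the null space delicate: waiting gives
  \<open>steering_cost y \<le> steering_cost (S t y)\<close>, which is the wrong direction, and the
  other one comes from the boundedness of the input map. Second, spectrum on the imaginary axis
  admits Jordan blocks of \<open>K\<close>, so free orbits may grow polynomially and the cost along
  them has no evident bound. Modulo the null space a single eigenvector is harmless, which is why
  the null space is divided out instead of splitting \<open>H\<close> by spectral projections.
  Eigenvalues of \<open>K\<close> and spectrum of \<open>A\<close> are linked in one direction by
  the integrated semigroup, in the other by a resolvent acting on an eigenspace of
  \<open>K\<close>.\<close>

lemma cinner_scaleC_right: "cinner x (c *\<^sub>C y) = cnj c * cinner x (y::'a::complex_hilbert)"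
  by (metis cinner_commute cinner_scaleC_left complex_cnj_mult)

lemma cinner_add_right: "cinner x (y + z) = cinner x y + cinner x (z::'a::complex_hilbert)"
  by (metis cinner_commute cinner_add_left complex_cnj_add)

lemma scaleC_minus1: "(-1) *\<^sub>C x = - (x::'a::complex_vector)"
  using scaleC_of_real[of "-1" x] by simp

lemma scaleC_one [simp]: "1 *\<^sub>C x = (x::'a::complex_vector)"
  using scaleC_of_real[of 1 x] by simp

lemma scaleC_zero_left [simp]: "0 *\<^sub>C x = (0::'a::complex_vector)"
  using scaleC_of_real[of 0 x] by simp

lemma scaleC_zero_right [simp]: "c *\<^sub>C 0 = (0::'a::complex_vector)"
  using scaleC_add_right[of c 0 0] by simp

lemma scaleC_minus_right: "c *\<^sub>C (- x) = - (c *\<^sub>C (x::'a::complex_vector))"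
  using scaleC_add_right[of c x "-x"] by (simp add: eq_neg_iff_add_eq_0 add.commute)

lemma scaleC_diff_right: "c *\<^sub>C (x - y) = c *\<^sub>C x - c *\<^sub>C (y::'a::complex_vector)"
  using scaleC_add_right[of c x "-y"] scaleC_minus_right[of c y] by simp

lemma scaleC_minus_left: "(- c) *\<^sub>C x = - (c *\<^sub>C (x::'a::complex_vector))"
  using scaleC_add_left[of c "-c" x] by (simp add: eq_neg_iff_add_eq_0 add.commute)

lemma scaleC_diff_left: "(c - d) *\<^sub>C x = c *\<^sub>C x - d *\<^sub>C (x::'a::complex_vector)"
  using scaleC_add_left[of c "-d" x] scaleC_minus_left[of d x] by simp

lemma scaleR_scaleC: "r *\<^sub>R x = of_real r *\<^sub>C (x::'a::complex_vector)"
  by (simp add: scaleC_of_real)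

lemma scaleC_scaleR: "c *\<^sub>C (r *\<^sub>R x) = r *\<^sub>R (c *\<^sub>C (x::'a::complex_vector))"
  by (simp add: scaleR_scaleC scaleC_scaleC mult.commute)

lemma cinner_self: "cinner x x = of_real ((norm (x::'a::complex_hilbert))\<^sup>2)"
proof -
  have "Im (cinner x x) = Im (cnj (cinner x x))" using cinner_commute[of x x] by simp
  then have "Im (cinner x x) = 0" by simp
  then show ?thesis by (simp add: complex_eq_iff Re_cinner power2_norm_eq_inner)
qed

lemma norm_scaleC: "norm (c *\<^sub>C x) = cmod c * norm (x::'a::complex_hilbert)"
proof -
  have "of_real ((norm (c *\<^sub>C x))\<^sup>2) = c * cnj c * cinner x x"
    unfolding cinner_self[symmetric] by (simp add: cinner_scaleC_left cinner_scaleC_right)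
  also have "\<dots> = of_real ((cmod c * norm x)\<^sup>2)"
    by (simp add: cinner_self complex_mult_cnj cmod_power2 power_mult_distrib)
  finally have "(norm (c *\<^sub>C x))\<^sup>2 = (cmod c * norm x)\<^sup>2" by (simp only: of_real_eq_iff)
  then show ?thesis by (simp add: power2_eq_iff_nonneg)
qed

lemma scaleC_eq_0_iff: "c *\<^sub>C x = 0 \<longleftrightarrow> c = 0 \<or> x = (0::'a::complex_hilbert)"
  by (metis mult_eq_0_iff norm_eq_zero norm_scaleC)

text \<open>Since \<open>cinner\<close> is determined by \<open>inner\<close> and multiplication by
  \<i>, real orthogonality to a set stable under \<i> becomes complex orthogonality.\<close>

lemma Im_cinner: "Im (cinner x y) = inner x (\<i> *\<^sub>C (y::'a::complex_hilbert))"
  unfolding Re_cinner[symmetric] by (simp add: cinner_scaleC_right)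

lemma norm_cinner_le: "cmod (cinner x y) \<le> norm x * norm (y::'a::complex_hilbert)"
proof (cases "cinner x y = 0")
  case False
  \<comment> \<open>The phase \<open>c\<close> rotates \<open>x\<close> until the inner product
    equals its modulus; then the real Cauchy-Schwarz inequality applies.\<close>
  define c where "c = cnj (cinner x y) / cmod (cinner x y)"
  have c: "cmod c = 1" using False by (simp add: c_def norm_divide)
  have "cinner (c *\<^sub>C x) y = cmod (cinner x y)"
    using False complex_norm_square[of "cinner x y"]
    by (simp add: c_def cinner_scaleC_left power2_eq_square field_simps)
  then have "cmod (cinner x y) = inner (c *\<^sub>C x) y" by (metis Re_cinner Re_complex_of_real)
  also have "\<dots> \<le> norm (c *\<^sub>C x) * norm y" by (rule norm_cauchy_schwarz)
  finally show ?thesis by (simp add: norm_scaleC c)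
qed simp

lemma bounded_linear_cinner_left: "bounded_linear (\<lambda>x. cinner x (y::'a::complex_hilbert))"
proof (rule bounded_linear_intro[of _ "norm y"])
  show "cinner (r *\<^sub>R x) y = r *\<^sub>R cinner x y" for r x
    by (simp add: scaleR_conv_of_real scaleR_scaleC[of r x] cinner_scaleC_left)
qed (auto simp: cinner_add_left norm_cinner_le)

lemma bounded_linear_scaleC: "bounded_linear (\<lambda>x::'a::complex_hilbert. c *\<^sub>C x)"
  by (rule bounded_linear_intro[of _ "cmod c"])
    (auto simp: scaleC_add_right scaleC_scaleR norm_scaleC)

lemma tendsto_scaleC:
  fixes f :: "'b \<Rightarrow> 'a::complex_hilbert"
  assumes "(c \<longlongrightarrow> a) F" "(f \<longlongrightarrow> x) F"
  shows "((\<lambda>t. c t *\<^sub>C f t) \<longlongrightarrow> a *\<^sub>C x) F"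
proof -
  interpret bounded_bilinear "\<lambda>c x. c *\<^sub>C (x::'a)"
    by standard (auto simp: scaleC_add_left scaleC_add_right scaleC_scaleC scaleC_of_real[symmetric] scaleC_complex_def
        scaleR_conv_of_real norm_scaleC mult.commute intro!: exI[of _ 1])
  show ?thesis using assms by (rule tendsto)
qed

lemma bounded_clinear_bl: "bounded_clinear f \<Longrightarrow> bounded_linear f"
  by (simp add: bounded_clinear_def)

lemma bounded_clinear_scaleC: "bounded_clinear f \<Longrightarrow> f (c *\<^sub>C x) = c *\<^sub>C f x"
  by (simp add: bounded_clinear_def)

lemma bounded_clinear_compose:
  "bounded_clinear f \<Longrightarrow> bounded_clinear g \<Longrightarrow> bounded_clinear (\<lambda>x. f (g x))"
  by (simp add: bounded_clinear_def bounded_linear_compose)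

section \<open>Orthogonal projections\<close>

definition csubspace :: "'a::complex_vector set \<Rightarrow> bool" where
  "csubspace M \<longleftrightarrow> subspace M \<and> (\<forall>c. \<forall>x\<in>M. c *\<^sub>C x \<in> M)"

text \<open>A minimizing sequence for the distance from \<open>x\<close> to \<open>M\<close> is
  Cauchy by the parallelogram law, as midpoints stay in \<open>M\<close>; varying its limit inside
  \<open>M\<close> gives orthogonality. Only the real inner product is involved, so that the product
  space containing the graph of \<open>A\<close> is covered too.\<close>

lemma exists_orthogonal_decomposition:
  fixes M :: "'a::{real_inner,banach} set"
  assumes "closed M" and M: "subspace M"
  shows "\<exists>m\<in>M. \<forall>y\<in>M. inner (x - m) y = 0"
proof -
  define q where "q y = (norm (x - y))\<^sup>2" for y
  define d where "d = (INF y\<in>M. q y)"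
  have bdd: "bdd_below (q ` M)" by (auto simp: q_def intro: bdd_belowI2[of _ 0])
  have d_le: "d \<le> q y" if "y \<in> M" for y unfolding d_def by (rule cINF_lower[OF bdd that])
  have "\<exists>y\<in>M. q y < d + 1 / Suc n" for n
    using cINF_less_iff[OF _ bdd, of "d + 1 / Suc n"] subspace_0[OF M] by (auto simp: d_def)
  then obtain m where m: "\<And>n. m n \<in> M" "\<And>n. q (m n) < d + 1 / Suc n" by metis
  have par: "(norm (u - v))\<^sup>2 = 2 * q u + 2 * q v - 4 * q ((1/2) *\<^sub>R (u + v))" for u v
    unfolding q_def power2_norm_eq_inner
    by (simp add: inner_diff_left inner_diff_right inner_add_left inner_add_right inner_commute field_simps)
  have close: "(norm (m j - m k))\<^sup>2 < 4 / Suc n" if "j \<ge> n" "k \<ge> n" for j k n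
  proof -
    have "d \<le> q ((1/2) *\<^sub>R (m j + m k))"
      by (intro d_le subspace_scale[OF M] subspace_add[OF M] m)
    moreover have "1 / Suc j \<le> 1 / Suc n" "1 / Suc k \<le> 1 / Suc n"
      using that by (auto intro!: frac_le)
    ultimately show ?thesis using par[of "m j" "m k"] m(2)[of j] m(2)[of k] by linarith
  qed
  have "Cauchy m"
  proof (rule CauchyI)
    fix e :: real assume e: "0 < e"
    obtain n where n: "4 / e\<^sup>2 < Suc n" using reals_Archimedean2 less_SucI by (metis of_nat_less_iff order_less_trans lessI)
    have "norm (m j - m k) < e" if "j \<ge> n" "k \<ge> n" for j k
    proof -
      have "4 / Suc n < e\<^sup>2" using n e by (simp add: field_simps)
      then have "(norm (m j - m k))\<^sup>2 < e\<^sup>2" using close[OF that] by linarith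
      then show ?thesis using e power2_less_imp_less by fastforce
    qed
    then show "\<exists>M. \<forall>j\<ge>M. \<forall>k\<ge>M. norm (m j - m k) < e" by blast
  qed
  then obtain l where l: "m \<longlonglongrightarrow> l" by (auto simp: Cauchy_convergent_iff convergent_def)
  have lM: "l \<in> M" using closed_sequentially[OF \<open>closed M\<close> _ l] m by auto
  have "(\<lambda>n. q (m n)) \<longlonglongrightarrow> q l" unfolding q_def by (intro tendsto_intros l)
  moreover have "(\<lambda>n. d + 1 / Suc n) \<longlonglongrightarrow> d + 0"
    by (intro tendsto_intros LIMSEQ_Suc[OF lim_1_over_n])
  ultimately have "q l \<le> d"
    using m(2) by (intro LIMSEQ_le[of "\<lambda>n. q (m n)" "q l" "\<lambda>n. d + 1 / Suc n" d]) (auto intro: less_imp_le)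
  have "inner (x - l) y = 0" if y: "y \<in> M" for y
  proof (cases "y = 0")
    case False
    \<comment> \<open>\<open>r\<close> minimizes the quadratic polynomial
      \<open>q (l + r *\<^sub>R y)\<close>, whose minimum is
      \<open>q l - i\<^sup>2 / a\<close>.\<close>
    define a i r where "a = inner y y" and "i = inner (x - l) y" and "r = i / a"
    have a: "a > 0" using False by (simp add: a_def)
    have "q l \<le> q (l + r *\<^sub>R y)"
      using \<open>q l \<le> d\<close> d_le[of "l + r *\<^sub>R y"] lM y M by (auto simp: subspace_add subspace_scale)
    also have "x - (l + r *\<^sub>R y) = (x - l) - r *\<^sub>R y" by simp
    then have "q (l + r *\<^sub>R y) = q l - 2 * r * i + r\<^sup>2 * a"
      unfolding q_def power2_norm_eq_inner a_def i_def
      by (simp add: inner_diff_left inner_diff_right inner_commute power2_eq_square algebra_simps)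
    also have "\<dots> = q l - i\<^sup>2 / a" using a by (simp add: r_def field_simps power2_eq_square)
    finally have "i\<^sup>2 \<le> 0" using a by (simp add: field_simps)
    then show ?thesis by (simp add: i_def)
  qed simp
  with lM show ?thesis by blast
qed

definition orth_proj :: "'a::real_inner set \<Rightarrow> 'a \<Rightarrow> 'a" where
  "orth_proj M x = (SOME m. m \<in> M \<and> (\<forall>y\<in>M. inner (x - m) y = 0))"

context
  fixes M :: "'a::{real_inner,banach} set"
  assumes clM: "closed M" and sM: "subspace M"
begin

lemma orth_proj_in: "orth_proj M x \<in> M"
  and orth_proj_orth: "y \<in> M \<Longrightarrow> inner (x - orth_proj M x) y = 0"
proof -
  have "\<exists>m. m \<in> M \<and> (\<forall>y\<in>M. inner (x - m) y = 0)"
    using exists_orthogonal_decomposition[OF clM sM] by blast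
  from someI_ex[OF this] show "orth_proj M x \<in> M" "y \<in> M \<Longrightarrow> inner (x - orth_proj M x) y = 0"
    unfolding orth_proj_def by auto
qed

lemma orth_proj_eqI:
  assumes "m \<in> M" "\<And>y. y \<in> M \<Longrightarrow> inner (x - m) y = 0"
  shows "orth_proj M x = m"
proof -
  let ?d = "orth_proj M x - m"
  have dM: "?d \<in> M" by (intro subspace_diff[OF sM] orth_proj_in assms)
  have "?d = (x - m) - (x - orth_proj M x)" by simp
  then have "inner ?d ?d = inner (x - m) ?d - inner (x - orth_proj M x) ?d"
    by (metis inner_diff_left)
  then show ?thesis using assms(2)[OF dM] orth_proj_orth[OF dM, of x] by simp
qed

lemma orth_proj_id: "x \<in> M \<Longrightarrow> orth_proj M x = x"
  by (rule orth_proj_eqI) auto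

lemma bounded_linear_orth_proj: "bounded_linear (orth_proj M)"
proof (rule bounded_linear_intro[of _ 1])
  show "orth_proj M (x + y) = orth_proj M x + orth_proj M y" for x y
  proof (rule orth_proj_eqI)
    fix z assume "z \<in> M"
    then show "inner (x + y - (orth_proj M x + orth_proj M y)) z = 0"
      using orth_proj_orth[of z x] orth_proj_orth[of z y] by (simp add: inner_diff_left inner_add_left)
  qed (intro subspace_add[OF sM] orth_proj_in)
  show "orth_proj M (r *\<^sub>R x) = r *\<^sub>R orth_proj M x" for r x
  proof (rule orth_proj_eqI)
    fix z assume "z \<in> M"
    then show "inner (r *\<^sub>R x - r *\<^sub>R orth_proj M x) z = 0"
      using orth_proj_orth[of z x] by (simp add: inner_diff_left)
  qed (intro subspace_scale[OF sM] orth_proj_in)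
  show "norm (orth_proj M x) \<le> norm x * 1" for x
  proof -
    have "(norm (orth_proj M x))\<^sup>2 = inner x (orth_proj M x)"
      using orth_proj_orth[OF orth_proj_in, of x x] by (simp add: inner_diff_left power2_norm_eq_inner)
    also have "\<dots> \<le> norm x * norm (orth_proj M x)" by (rule norm_cauchy_schwarz)
    finally show ?thesis
      by (cases "orth_proj M x = 0") (auto simp: power2_eq_square)
  qed
qed

end

text \<open>Testing with \<open>y\<close> controls the real part, and testing with
  \<open>\<i> *\<^sub>C y\<close>, which also lies in \<open>M\<close>, the imaginary part.\<close>

lemma cinner_orth_proj:
  fixes M :: "'a::complex_hilbert set"
  assumes "closed M" "csubspace M" "y \<in> M"
  shows "cinner (x - orth_proj M x) y = 0"
  using assms orth_proj_orth[of M y x] orth_proj_orth[of M "\<i> *\<^sub>C y" x]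
  by (auto simp: complex_eq_iff Re_cinner Im_cinner csubspace_def)

lemma bounded_clinear_orth_proj:
  fixes M :: "'a::complex_hilbert set"
  assumes "closed M" "csubspace M"
  shows "bounded_clinear (orth_proj M)"
proof -
  have sM: "subspace M" using assms by (simp add: csubspace_def)
  have "orth_proj M (c *\<^sub>C x) = c *\<^sub>C orth_proj M x" for c x
  proof (rule orth_proj_eqI[OF assms(1) sM])
    show "c *\<^sub>C orth_proj M x \<in> M" using assms orth_proj_in[OF assms(1) sM] by (simp add: csubspace_def)
    show "inner (c *\<^sub>C x - c *\<^sub>C orth_proj M x) y = 0" if "y \<in> M" for y
      using cinner_orth_proj[OF assms that, of x]
      by (simp flip: scaleC_diff_right Re_cinner add: cinner_scaleC_left)
  qed
  then show ?thesis by (simp add: bounded_clinear_def bounded_linear_orth_proj[OF assms(1) sM])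
qed

section \<open>Compact operators\<close>

text \<open>The subsequence form in which compactness is used below; it is stable under composition
  with bounded operators on either side.\<close>

definition sequentially_compact_operator :: "('a::complex_hilbert \<Rightarrow> 'b::complex_hilbert) \<Rightarrow> bool" where
  "sequentially_compact_operator T \<longleftrightarrow> bounded_clinear T \<and>
     (\<forall>x::nat \<Rightarrow> 'a. bounded (range x) \<longrightarrow> (\<exists>l r. strict_mono r \<and> (\<lambda>n. T (x (r n))) \<longlonglongrightarrow> l))"

lemma sequentially_compact_operatorE:
  fixes x :: "nat \<Rightarrow> 'a::complex_hilbert"
  assumes "sequentially_compact_operator T" "\<And>n. norm (x n) \<le> b"
  obtains l r where "strict_mono r" "(\<lambda>n. T (x (r n))) \<longlonglongrightarrow> l"
  using assms unfolding sequentially_compact_operator_def by (metis bounded_iff rangeE)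

lemma compact_operator_imp_sequentially_compact:
  assumes "compact_operator T"
  shows "sequentially_compact_operator T"
  unfolding sequentially_compact_operator_def
proof (intro conjI allI impI)
  show "bounded_clinear T" using assms by (simp add: compact_operator_def)
  fix x :: "nat \<Rightarrow> 'a" assume "bounded (range x)"
  then have "compact (closure (T ` range x))" using assms by (simp add: compact_operator_def)
  moreover have "T (x n) \<in> closure (T ` range x)" for n
    by (rule subsetD[OF closure_subset]) simp
  ultimately obtain l r where "strict_mono r" "((\<lambda>n. T (x n)) \<circ> r) \<longlonglongrightarrow> l"
    unfolding compact_def by (metis (no_types, lifting))
  then show "\<exists>l r. strict_mono r \<and> (\<lambda>n. T (x (r n))) \<longlonglongrightarrow> l"
    by (auto simp: o_def)
qed

lemma sequentially_compact_compose_left: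
  assumes "sequentially_compact_operator T" "bounded_clinear f"
  shows "sequentially_compact_operator (\<lambda>x. f (T x))"
  unfolding sequentially_compact_operator_def
proof (intro conjI allI impI)
  show "bounded_clinear (\<lambda>x. f (T x))"
    using assms by (simp add: sequentially_compact_operator_def bounded_clinear_compose)
  fix x :: "nat \<Rightarrow> 'a" assume "bounded (range x)"
  with assms(1) obtain l r where "strict_mono r" "(\<lambda>n. T (x (r n))) \<longlonglongrightarrow> l"
    unfolding sequentially_compact_operator_def by blast
  then show "\<exists>l r. strict_mono r \<and> (\<lambda>n. f (T (x (r n)))) \<longlonglongrightarrow> l"
    using bounded_linear.tendsto[OF bounded_clinear_bl[OF assms(2)]] by blast
qed

lemma sequentially_compact_compose_right:
  assumes "sequentially_compact_operator T" "bounded_clinear f"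
  shows "sequentially_compact_operator (\<lambda>x. T (f x))"
  unfolding sequentially_compact_operator_def
proof (intro conjI allI impI)
  show "bounded_clinear (\<lambda>x. T (f x))"
    using assms by (simp add: sequentially_compact_operator_def bounded_clinear_compose)
  fix x :: "nat \<Rightarrow> 'c" assume "bounded (range x)"
  then have "bounded (f ` range x)" using bounded_linear_image bounded_clinear_bl[OF assms(2)] by blast
  then have "bounded (range (\<lambda>n. f (x n)))" by (simp add: image_image)
  with assms(1) show "\<exists>l r. strict_mono r \<and> (\<lambda>n. T (f (x (r n)))) \<longlonglongrightarrow> l"
    unfolding sequentially_compact_operator_def by blast
qed

lemma bounded_clinear_scaleC_op: "bounded_clinear (\<lambda>x::'a::complex_hilbert. c *\<^sub>C x)"
  by (simp add: bounded_clinear_def bounded_linear_scaleC scaleC_scaleC mult.commute)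

lemma sequentially_compact_scaleC:
  "sequentially_compact_operator T \<Longrightarrow> sequentially_compact_operator (\<lambda>x. c *\<^sub>C T x)"
  by (rule sequentially_compact_compose_left[OF _ bounded_clinear_scaleC_op])

text \<open>Otherwise there are unit vectors of \<open>M\<close> with \<open>v - T v\<close> tending
  to 0. Compactness makes \<open>T v\<close>, hence \<open>v\<close>, converge along a subsequence,
  and the limit is a unit vector of \<open>M\<close> fixed by \<open>T\<close>.\<close>

lemma sequentially_compact_bounded_below:
  fixes T :: "'a::complex_hilbert \<Rightarrow> 'a"
  assumes T: "sequentially_compact_operator T" and "closed M" and M: "subspace M"
    and inj: "\<And>x. x \<in> M \<Longrightarrow> T x = x \<Longrightarrow> x = 0"
  shows "\<exists>c>0. \<forall>x\<in>M. norm x \<le> c * norm (x - T x)"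
proof (rule ccontr)
  interpret T: bounded_linear T
    using T by (simp add: sequentially_compact_operator_def bounded_clinear_def)
  assume neg: "\<not> ?thesis"
  have "\<exists>x\<in>M. norm x > Suc n * norm (x - T x)" for n
    using neg by (meson not_le of_nat_0_less_iff zero_less_Suc)
  then obtain x where xM: "\<And>n. x n \<in> M" and x: "\<And>n. norm (x n) > Suc n * norm (x n - T (x n))"
    by metis
  have nz: "norm (x n) > 0" for n
    using x[of n] by (rule order_le_less_trans[rotated]) simp
  define v where "v n = x n /\<^sub>R norm (x n)" for n
  have vM: "v n \<in> M" for n using xM M by (simp add: v_def subspace_scale)
  have v1: "norm (v n) = 1" for n using nz[of n] by (simp add: v_def)
  have "v n - T (v n) = (x n - T (x n)) /\<^sub>R norm (x n)" for n
    by (simp add: v_def T.scaleR scaleR_diff_right)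
  then have "norm (v n - T (v n)) = norm (x n - T (x n)) / norm (x n)" for n
    by (simp add: divide_inverse)
  then have small: "norm (v n - T (v n)) \<le> 1 / Suc n" for n
    using x[of n] nz[of n] by (simp add: field_simps)
  obtain l r where r: "strict_mono r" and l: "(\<lambda>n. T (v (r n))) \<longlonglongrightarrow> l"
    by (rule sequentially_compact_operatorE[OF T, of v 1]) (auto simp: v1)
  have "(\<lambda>n. v n - T (v n)) \<longlonglongrightarrow> 0"
    by (rule Lim_null_comparison[OF _ LIMSEQ_Suc[OF lim_1_over_n]]) (use small in auto)
  then have "(\<lambda>n. v (r n) - T (v (r n))) \<longlonglongrightarrow> 0"
    using LIMSEQ_subseq_LIMSEQ[OF _ r, of "\<lambda>n. v n - T (v n)" 0] by (simp add: o_def)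
  from tendsto_add[OF this l] have vl: "(\<lambda>n. v (r n)) \<longlonglongrightarrow> l" by simp
  have "l \<in> M" using closed_sequentially[OF \<open>closed M\<close> _ vl] vM by auto
  moreover have "T l = l" using LIMSEQ_unique[OF T.tendsto[OF vl] l] .
  moreover have "norm l = 1" using LIMSEQ_unique[OF tendsto_norm[OF vl]] v1 by simp
  ultimately show False using inj by force
qed

text \<open>The common contradiction of both halves of the Fredholm alternative: a strictly monotone
  chain of closed subspaces would produce such a sequence.\<close>

lemma sequentially_compact_no_separated:
  fixes T :: "'a::complex_hilbert \<Rightarrow> 'a" and x :: "nat \<Rightarrow> 'a"
  assumes T: "sequentially_compact_operator T" and "\<And>n. norm (x n) = 1"
    and sep: "\<And>m n. m < n \<Longrightarrow> norm (T (x m) - T (x n)) \<ge> 1"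
  shows False
proof -
  obtain l r where r: "strict_mono r" and l: "(\<lambda>n. T (x (r n))) \<longlonglongrightarrow> l"
    by (rule sequentially_compact_operatorE[OF T, of x 1]) (auto simp: assms)
  have "Cauchy (\<lambda>n. T (x (r n)))" using l by (auto intro: LIMSEQ_imp_Cauchy)
  then obtain N where "\<forall>m\<ge>N. \<forall>n\<ge>N. norm (T (x (r m)) - T (x (r n))) < 1"
    unfolding Cauchy_iff by (metis zero_less_one)
  then have "norm (T (x (r N)) - T (x (r (Suc N)))) < 1" by simp
  moreover have "r N < r (Suc N)" using r by (simp add: strict_mono_def)
  ultimately show False using sep by (meson not_le)
qed

text \<open>Riesz's lemma with constant 1: the normalized component of \<open>z\<close> orthogonal
  to \<open>N\<close> replaces an almost orthogonal vector.\<close>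

lemma exists_unit_orthogonal:
  fixes M N :: "'a::{real_inner,banach} set"
  assumes "closed N" "subspace N" "subspace M" "N \<subseteq> M" "z \<in> M" "z \<notin> N"
  shows "\<exists>e\<in>M. norm e = 1 \<and> (\<forall>y\<in>N. inner e y = 0)"
proof -
  define e where "e = z - orth_proj N z"
  have pN: "orth_proj N z \<in> N" by (rule orth_proj_in[OF assms(1,2)])
  have "e \<noteq> 0" using pN assms by (auto simp: e_def)
  moreover have "e \<in> M" unfolding e_def using pN assms by (intro subspace_diff) auto
  moreover have "inner e y = 0" if "y \<in> N" for y
    using orth_proj_orth[OF assms(1,2) that] by (simp add: e_def)
  ultimately show ?thesis using assms
    by (intro bexI[of _ "e /\<^sub>R norm e"]) (auto simp: subspace_scale)
qed

lemma norm_ge_1_orthogonal: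
  fixes e :: "'a::real_inner"
  assumes "norm e = 1" "inner e y = 0"
  shows "norm (e - y) \<ge> 1"
proof -
  have "1 = inner e (e - y)" using assms by (simp add: inner_diff_right flip: power2_norm_eq_inner)
  also have "\<dots> \<le> norm e * norm (e - y)" by (rule norm_cauchy_schwarz)
  finally show ?thesis using assms by simp
qed

section \<open>The Fredholm alternative for one minus a compact operator\<close>

context
  fixes T :: "'a::complex_hilbert \<Rightarrow> 'a" and f :: "'a \<Rightarrow> 'a"
  assumes T: "sequentially_compact_operator T"
  defines "f \<equiv> \<lambda>x. x - T x"
begin

lemma bounded_linear_f: "bounded_linear f"
  using T unfolding f_def sequentially_compact_operator_def bounded_clinear_def
  by (intro bounded_linear_sub bounded_linear_ident) auto

lemma bounded_linear_f_pow: "bounded_linear (f ^^ n)"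
proof (induction n)
  case (Suc n) then show ?case using bounded_linear_compose[OF bounded_linear_f] by (simp add: o_def)
qed (simp add: id_def bounded_linear_ident)

text \<open>If \<open>f\<close> missed \<open>y\<close>, the closed ranges of the powers of
  \<open>f\<close> would decrease strictly, because injectivity of \<open>f ^^ n\<close> keeps
  \<open>(f ^^ n) y\<close> out of the next range. Unit vectors in each range orthogonal to the next
  one have images under \<open>T\<close> at mutual distance at least 1.\<close>

lemma fredholm_injective_imp_surjective:
  assumes inj: "\<And>x. T x = x \<Longrightarrow> x = 0"
  shows "surj f"
proof (rule ccontr)
  obtain c where c: "c > 0" "\<And>x. norm x \<le> c * norm (f x)"
    using sequentially_compact_bounded_below[OF T closed_UNIV subspace_UNIV] inj by (auto simp: f_def)
  have cn: "norm x \<le> c ^ n * norm ((f ^^ n) x)" for x n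
  proof (induction n arbitrary: x)
    case (Suc n)
    have "norm x \<le> c * norm (f x)" by (rule c)
    also have "\<dots> \<le> c * (c ^ n * norm ((f ^^ n) (f x)))" using Suc[of "f x"] c(1) by simp
    finally show ?case by (simp add: funpow_swap1)
  qed simp
  define R where "R n = range (f ^^ n)" for n
  have Rs: "subspace (R n)" for n
    unfolding R_def by (intro linear_subspace_image bounded_linear.linear bounded_linear_f_pow subspace_UNIV)
  have Rc: "closed (R n)" for n
  proof -
    have "complete ((f ^^ n) ` UNIV)"
      by (rule complete_isometric_image[of "1 / c ^ n"])
        (use c cn[of _ n] in \<open>auto simp: field_simps bounded_linear_f_pow complete_UNIV\<close>)
    then show ?thesis by (simp add: R_def complete_eq_closed)
  qed
  have R_Suc: "R (Suc n) \<subseteq> R n" for n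
    unfolding R_def by (auto simp: funpow_swap1 simp del: funpow.simps(2)) (metis funpow_Suc_right comp_apply rangeI)
  then have R_mono: "m \<le> n \<Longrightarrow> R n \<subseteq> R m" for m n by (rule lift_Suc_antimono_le)
  have fR: "f x \<in> R (Suc n)" if "x \<in> R n" for x n using that by (auto simp: R_def)
  assume "\<not> surj f"
  then obtain y where y: "\<And>z. f z \<noteq> y" unfolding surj_def by metis
  have "(f ^^ n) y \<notin> R (Suc n)" for n
  proof
    assume "(f ^^ n) y \<in> R (Suc n)"
    then obtain z where z: "(f ^^ n) y = (f ^^ n) (f z)" by (auto simp: R_def funpow_swap1)
    interpret fn: bounded_linear "f ^^ n" by (rule bounded_linear_f_pow)
    have "(f ^^ n) (y - f z) = 0" by (simp add: fn.diff z)
    then show False using cn[of "y - f z" n] y[of z] by simp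
  qed
  then have "\<exists>e\<in>R n. norm e = 1 \<and> (\<forall>y\<in>R (Suc n). inner e y = 0)" for n
    using exists_unit_orthogonal[OF Rc Rs Rs R_Suc, of "(f ^^ n) y" n] by (auto simp: R_def)
  then obtain e where e: "\<And>n. e n \<in> R n" "\<And>n. norm (e n) = 1"
    "\<And>n y. y \<in> R (Suc n) \<Longrightarrow> inner (e n) y = 0" by metis
  show False
  proof (rule sequentially_compact_no_separated[OF T, of e])
    fix m n :: nat assume "m < n"
    \<comment> \<open>Everything subtracted from \<open>e m\<close> lies in
      \<open>R (Suc m)\<close>, to which \<open>e m\<close> is orthogonal.\<close>
    have "T (e m) - T (e n) = e m - (f (e m) + (e n - f (e n)))" by (simp add: f_def)
    moreover have "e n \<in> R (Suc m)" "f (e n) \<in> R (Suc m)"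
      using R_mono[of "Suc m" n] R_mono[of "Suc m" "Suc n"] e(1)[of n] fR[of "e n" n] \<open>m < n\<close> by auto
    then have "f (e m) + (e n - f (e n)) \<in> R (Suc m)"
      using fR[OF e(1)] Rs by (intro subspace_add subspace_diff) auto
    ultimately show "norm (T (e m) - T (e n)) \<ge> 1"
      using norm_ge_1_orthogonal e by metis
  qed (rule e)
qed

text \<open>The mirror image with ascending kernels: by surjectivity a nonzero \<open>x\<close> with
  \<open>f x = 0\<close> has a preimage under every \<open>f ^^ n\<close>, which lies in the kernel
  of \<open>f ^^ Suc n\<close> but not in that of \<open>f ^^ n\<close>.\<close>

lemma fredholm_surjective_imp_injective:
  assumes "surj f" "T x = x"
  shows "x = 0"
proof (rule ccontr)
  assume "x \<noteq> 0"
  define N where "N n = {y. (f ^^ n) y = 0}" for n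
  interpret fn: bounded_linear "f ^^ n" for n by (rule bounded_linear_f_pow)
  have Ns: "subspace (N n)" for n by (auto simp: N_def subspace_def fn.add fn.scaleR fn.zero)
  have Nc: "closed (N n)" for n
    unfolding N_def using continuous_closed_vimage[of "{0}" "f ^^ n"]
    by (simp add: vimage_def fn.isCont linear_continuous_at bounded_linear_f_pow)
  have f0: "f 0 = 0" using fn.zero[of 1] by simp
  have N_Suc: "N n \<subseteq> N (Suc n)" for n by (auto simp: N_def f0)
  then have N_mono: "m \<le> n \<Longrightarrow> N m \<subseteq> N n" for m n by (rule lift_Suc_mono_le)
  have fN: "f x \<in> N n" if "x \<in> N (Suc n)" for x n using that by (simp add: N_def funpow_swap1)
  have "\<exists>v. (f ^^ n) v = x" for n
    using surjD[OF surj_fn[OF assms(1)], of x n] by auto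
  then obtain v where v: "\<And>n. (f ^^ n) (v n) = x" by metis
  have "f x = 0" using assms by (simp add: f_def)
  then have "v n \<in> N (Suc n)" "v n \<notin> N n" for n using v \<open>x \<noteq> 0\<close> by (auto simp: N_def)
  then have "\<exists>e\<in>N (Suc n). norm e = 1 \<and> (\<forall>y\<in>N n. inner e y = 0)" for n
    using exists_unit_orthogonal[OF Nc Ns Ns N_Suc, of "v n" n] by blast
  then obtain e where e: "\<And>n. e n \<in> N (Suc n)" "\<And>n. norm (e n) = 1"
    "\<And>n y. y \<in> N n \<Longrightarrow> inner (e n) y = 0" by metis
  show False
  proof (rule sequentially_compact_no_separated[OF T, of e])
    fix m n :: nat assume "m < n"
    have "T (e n) - T (e m) = e n - (f (e n) + (e m - f (e m)))" by (simp add: f_def)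
    moreover have "e m \<in> N n" "f (e m) \<in> N n"
      using N_mono[of "Suc m" n] N_mono[of m n] e(1)[of m] fN[of "e m" m] \<open>m < n\<close> by auto
    then have "f (e n) + (e m - f (e m)) \<in> N n"
      using fN[OF e(1)] Ns by (intro subspace_add subspace_diff) auto
    ultimately show "norm (T (e m) - T (e n)) \<ge> 1"
      using norm_ge_1_orthogonal e norm_minus_commute by metis
  qed (rule e)
qed

text \<open>On the orthogonal complement \<open>M\<close> of the kernel, \<open>f\<close> is
  injective and hence bounded below, so the image of \<open>M\<close> is complete; projecting off
  the kernel shows that this image is the whole range.\<close>

lemma fredholm_closed_range: "closed (range f)"
proof -
  interpret f: bounded_linear f by (rule bounded_linear_f)
  define N where "N = {y. f y = 0}"
  define M where "M = {x. \<forall>y\<in>N. inner x y = 0}"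
  have Ns: "subspace N" by (auto simp: N_def subspace_def f.add f.scaleR f.zero)
  have Nc: "closed N"
    unfolding N_def using continuous_closed_vimage[of "{0}" f] by (simp add: vimage_def f.isCont)
  have Ms: "subspace M" by (auto simp: M_def subspace_def inner_add_left)
  have Mc: "closed M"
  proof -
    have "M = (\<Inter>y\<in>N. {x. inner x y = 0})" by (auto simp: M_def)
    then show ?thesis by (auto intro!: closed_INT closed_Collect_eq continuous_intros)
  qed
  have "x = 0" if "x \<in> M" "T x = x" for x
  proof -
    have "x \<in> N" using that by (simp add: N_def f_def)
    then have "inner x x = 0" using that by (auto simp: M_def)
    then show ?thesis by simp
  qed
  then obtain c where c: "c > 0" "\<And>x. x \<in> M \<Longrightarrow> norm x \<le> c * norm (f x)"
    using sequentially_compact_bounded_below[OF T Mc Ms] by (auto simp: f_def)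
  have "complete (f ` M)"
    by (rule complete_isometric_image[of "1 / c"])
      (use c Ms Mc in \<open>auto simp: field_simps bounded_linear_f complete_eq_closed\<close>)
  moreover have "f x \<in> f ` M" for x
  proof
    show "f x = f (x - orth_proj N x)" using orth_proj_in[OF Nc Ns, of x] by (simp add: f.diff N_def)
    show "x - orth_proj N x \<in> M" using orth_proj_orth[OF Nc Ns] by (simp add: M_def)
  qed
  then have "range f = f ` M" by auto
  ultimately show ?thesis by (simp add: complete_eq_closed)
qed

text \<open>The range of \<open>f\<close> is closed and proper, so a vector outside it has a nonzero
  component orthogonal to it. This component is an eigenvector of the adjoint of \<open>T\<close>,
  obtained without forming the adjoint.\<close>

lemma fredholm_orthogonal:
  assumes "T x = x" "x \<noteq> 0"
  shows "\<exists>w. w \<noteq> 0 \<and> (\<forall>x. cinner (f x) w = 0)"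
proof -
  interpret f: bounded_linear f by (rule bounded_linear_f)
  have fC: "f (c *\<^sub>C x) = c *\<^sub>C f x" for c x
    using T by (simp add: f_def sequentially_compact_operator_def bounded_clinear_def scaleC_diff_right)
  have Rs: "csubspace (range f)" unfolding csubspace_def
    by (auto simp: fC[symmetric] intro: linear_subspace_image[OF f.linear subspace_UNIV])
  obtain z where z: "z \<notin> range f" using fredholm_surjective_imp_injective assms by blast
  define w where "w = z - orth_proj (range f) z"
  have "w \<noteq> 0" using z orth_proj_in[OF fredholm_closed_range, of z] Rs by (auto simp: w_def csubspace_def)
  moreover have "cinner w (f x) = 0" for x
    unfolding w_def by (rule cinner_orth_proj[OF fredholm_closed_range Rs]) simp
  ultimately show ?thesis by (metis cinner_commute complex_cnj_zero)
qed

end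

section \<open>Entire resolvents and bounded powers\<close>

text \<open>Used at \<open>z = 0\<close>, where only the last summand survives: multiplication by
  the variable shifts the Taylor coefficients by one.\<close>

lemma higher_deriv_times_id:
  assumes "g holomorphic_on UNIV"
  shows "(deriv ^^ Suc m) (\<lambda>z. a + z * g z) z = z * (deriv ^^ Suc m) g z + of_nat (Suc m) * (deriv ^^ m) g z"
proof (induction m arbitrary: z)
  have hol: "(deriv ^^ k) g field_differentiable at w" for k w
    using holomorphic_higher_deriv[OF assms open_UNIV, of k] by (simp add: holomorphic_on_def field_differentiable_def)
  {
    case 0
    have "((\<lambda>z. a + z * g z) has_field_derivative z * deriv g z + 1 * g z) (at z)"
      using hol[of 0 z] by (auto intro!: derivative_eq_intros simp: field_differentiable_derivI)
    then show ?case by (simp add: DERIV_imp_deriv)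
  next
    case (Suc m)
    have *: "((deriv ^^ k) g has_field_derivative (deriv ^^ Suc k) g w) (at w)" for k w
      using hol[of k w] by (simp add: field_differentiable_derivI)
    have "((\<lambda>z. z * (deriv ^^ Suc m) g z + of_nat (Suc m) * (deriv ^^ m) g z) has_field_derivative
       (z * (deriv ^^ Suc (Suc m)) g z + (deriv ^^ Suc m) g z) + of_nat (Suc m) * (deriv ^^ Suc m) g z) (at z)"
      by (rule derivative_eq_intros *  refl | simp)+
    moreover have "(deriv ^^ Suc m) (\<lambda>z. a + z * g z) = (\<lambda>z. z * (deriv ^^ Suc m) g z + of_nat (Suc m) * (deriv ^^ m) g z)"
      using Suc by blast
    ultimately show ?case by (subst funpow.simps(2)) (simp add: DERIV_imp_deriv algebra_simps)
  }
qed

text \<open>Fredholm's alternative makes \<open>\<zeta> \<mapsto> (1 - \<zeta>T)\<^sup>-\<^sup>1 x\<close> entire; Cauchy's estimates on the unit disc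
  bound its Taylor coefficients \<open>T\<^sup>n x\<close>.\<close>

lemma power_bounded_if_no_eigenvalue:
  fixes T :: "'a::complex_hilbert \<Rightarrow> 'a"
  assumes T: "sequentially_compact_operator T"
    and noev: "\<And>\<zeta> x. \<zeta> *\<^sub>C T x = x \<Longrightarrow> x = 0"
  shows "\<exists>B. \<forall>n. norm ((T ^^ n) x) \<le> B"
proof -
  have Tc: "bounded_clinear T" using T by (simp add: sequentially_compact_operator_def)
  interpret T: bounded_linear T by (rule bounded_clinear_bl[OF Tc])
  note TC = bounded_clinear_scaleC[OF Tc]
  have "surj (\<lambda>x. x - \<zeta> *\<^sub>C T x)" for \<zeta>
    using fredholm_injective_imp_surjective[OF sequentially_compact_scaleC[OF T]] noev by blast
  then have "\<exists>y. y - \<zeta> *\<^sub>C T y = w" for \<zeta> w using surjD[of "\<lambda>x. x - \<zeta> *\<^sub>C T x" w] by metis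
  \<comment> \<open>\<open>G \<zeta>\<close> is the inverse of \<open>1 - \<zeta> T\<close>, which
    exists because \<open>\<zeta> T\<close> never has the eigenvalue 1.\<close>
  then obtain G where G: "\<And>\<zeta> w. G \<zeta> w - \<zeta> *\<^sub>C T (G \<zeta> w) = w" by metis
  have G_eqI: "G \<zeta> w = y" if "y - \<zeta> *\<^sub>C T y = w" for \<zeta> w y
  proof -
    have "(G \<zeta> w - y) - \<zeta> *\<^sub>C T (G \<zeta> w - y) = (G \<zeta> w - \<zeta> *\<^sub>C T (G \<zeta> w)) - (y - \<zeta> *\<^sub>C T y)"
      by (simp add: T.diff scaleC_diff_right)
    also have "\<dots> = 0" by (simp add: G that)
    finally have "\<zeta> *\<^sub>C T (G \<zeta> w - y) = G \<zeta> w - y" by simp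
    then show ?thesis using noev by fastforce
  qed
  have Gb: "\<exists>c>0. \<forall>w. norm (G \<zeta> w) \<le> c * norm w" for \<zeta>
    using sequentially_compact_bounded_below[OF sequentially_compact_scaleC[OF T] closed_UNIV subspace_UNIV, of \<zeta>]
      noev G by (metis UNIV_I)
  have Glin: "bounded_linear (G \<zeta>)" for \<zeta>
  proof -
    obtain c where "\<forall>w. norm (G \<zeta> w) \<le> c * norm w" using Gb by blast
    then show ?thesis
      by (intro bounded_linear_intro[of _ c] G_eqI)
        (simp_all add: T.add T.scaleR scaleC_add_right scaleC_scaleR G mult.commute
          add_diff_add flip: scaleR_diff_right)
  qed
  \<comment> \<open>The resolvent identity yields first the continuity of \<open>G\<close> and then,
    with its help, the complex derivative.\<close>
  have resolvent: "G \<zeta> w - G \<xi> w = (\<zeta> - \<xi>) *\<^sub>C G \<xi> (T (G \<zeta> w))" for \<zeta> \<xi> w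
  proof -
    have "G \<xi> w = G \<zeta> w - (\<zeta> - \<xi>) *\<^sub>C G \<xi> (T (G \<zeta> w))"
    proof (rule G_eqI)
      let ?y = "G \<zeta> w" and ?v = "G \<xi> (T (G \<zeta> w))"
      have "(?y - (\<zeta> - \<xi>) *\<^sub>C ?v) - \<xi> *\<^sub>C T (?y - (\<zeta> - \<xi>) *\<^sub>C ?v)
        = (?y - \<zeta> *\<^sub>C T ?y) + (\<zeta> - \<xi>) *\<^sub>C T ?y - (\<zeta> - \<xi>) *\<^sub>C (?v - \<xi> *\<^sub>C T ?v)"
        by (simp add: T.diff TC scaleC_diff_right scaleC_diff_left scaleC_scaleC T.add scaleC_add_right algebra_simps)
      then show "(?y - (\<zeta> - \<xi>) *\<^sub>C ?v) - \<xi> *\<^sub>C T (?y - (\<zeta> - \<xi>) *\<^sub>C ?v) = w" by (simp add: G)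
    qed
    then show ?thesis by simp
  qed
  have cont: "((\<lambda>\<zeta>. G \<zeta> w) \<longlongrightarrow> G \<xi> w) (at \<xi>)" for w \<xi>
  proof -
    obtain c where c: "c > 0" "\<And>w. norm (G \<xi> w) \<le> c * norm w" using Gb by blast
    obtain k where k: "k > 0" "\<And>w. norm (T w) \<le> norm w * k" using T.pos_bounded by blast
    have est: "norm (G \<zeta> w - G \<xi> w) \<le> cmod (\<zeta> - \<xi>) * (c * k) * norm (G \<zeta> w)" for \<zeta>
    proof -
      have "norm (G \<zeta> w - G \<xi> w) \<le> cmod (\<zeta> - \<xi>) * (c * norm (T (G \<zeta> w)))"
        unfolding resolvent norm_scaleC by (intro mult_left_mono c) simp
      also have "\<dots> \<le> cmod (\<zeta> - \<xi>) * (c * (norm (G \<zeta> w) * k))"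
        using c k by (intro mult_left_mono) auto
      finally show ?thesis by (simp add: mult_ac)
    qed
    have lim0: "((\<lambda>\<zeta>. cmod (\<zeta> - \<xi>) * (c * k) * (2 * norm (G \<xi> w))) \<longlongrightarrow> cmod (\<xi> - \<xi>) * (c * k) * (2 * norm (G \<xi> w))) (at \<xi>)"
      by (intro tendsto_intros)
    have "((\<lambda>\<zeta>. cmod (\<zeta> - \<xi>) * (c * k)) \<longlongrightarrow> cmod (\<xi> - \<xi>) * (c * k)) (at \<xi>)"
      by (intro tendsto_intros)
    then have "\<forall>\<^sub>F \<zeta> in at \<xi>. cmod (\<zeta> - \<xi>) * (c * k) < 1/2"
      by (rule order_tendstoD) simp
    \<comment> \<open>Near \<xi> the estimate absorbs half of \<open>norm (G \<zeta> w)\<close>,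
      which bounds it by twice its value at \<xi>. So a bound at \<xi> alone is enough for
      continuity.\<close>
    then have "\<forall>\<^sub>F \<zeta> in at \<xi>. norm (G \<zeta> w - G \<xi> w) \<le> cmod (\<zeta> - \<xi>) * (c * k) * (2 * norm (G \<xi> w))"
    proof eventually_elim
      case (elim \<zeta>)
      have "norm (G \<zeta> w - G \<xi> w) \<le> 1/2 * norm (G \<zeta> w)"
        using est[of \<zeta>] elim mult_right_mono[of "cmod (\<zeta> - \<xi>) * (c * k)" "1/2" "norm (G \<zeta> w)"] by simp
      then have "norm (G \<zeta> w) \<le> 2 * norm (G \<xi> w)" using norm_triangle_sub[of "G \<zeta> w" "G \<xi> w"] by simp
      then show ?case using est[of \<zeta>] c k
        by (meson mult_left_mono mult_nonneg_nonneg norm_ge_zero order_trans less_imp_le)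
    qed
    then have "((\<lambda>\<zeta>. G \<zeta> w - G \<xi> w) \<longlongrightarrow> 0) (at \<xi>)"
      by (rule Lim_null_comparison) (use lim0 in simp)
    then show ?thesis by (simp add: LIM_zero_iff)
  qed
  have "continuous_on UNIV (\<lambda>\<zeta>. G \<zeta> x)" using cont by (simp add: continuous_on_def)
  then have "compact ((\<lambda>\<zeta>. G \<zeta> x) ` cball 0 1)"
    by (intro compact_continuous_image compact_cball) (auto intro: continuous_on_subset)
  then obtain B where B: "\<And>\<zeta>. cmod \<zeta> \<le> 1 \<Longrightarrow> norm (G \<zeta> x) \<le> B"
    using compact_imp_bounded by (force simp: bounded_iff)
  have hol: "(\<lambda>\<zeta>. cinner (G \<zeta> w) z) holomorphic_on UNIV" for w z
  proof -
    interpret c: bounded_linear "\<lambda>x. cinner x z" by (rule bounded_linear_cinner_left)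
    have "((\<lambda>\<zeta>. cinner (G \<zeta> w) z) has_field_derivative cinner (G \<xi> (T (G \<xi> w))) z) (at \<xi>)" for \<xi>
    proof -
      interpret G: bounded_linear "G \<xi>" by (rule Glin)
      have "((\<lambda>\<zeta>. cinner (G \<xi> (T (G \<zeta> w))) z) \<longlongrightarrow> cinner (G \<xi> (T (G \<xi> w))) z) (at \<xi>)"
        by (intro c.tendsto G.tendsto T.tendsto cont)
      moreover have "\<forall>\<^sub>F \<zeta> in at \<xi>. cinner (G \<xi> (T (G \<zeta> w))) z = (cinner (G \<zeta> w) z - cinner (G \<xi> w) z) / (\<zeta> - \<xi>)"
        using eventually_neq_at_within[of \<xi> \<xi> UNIV]
      proof eventually_elim
        case (elim \<zeta>)
        have "cinner (G \<zeta> w) z - cinner (G \<xi> w) z = cinner ((\<zeta> - \<xi>) *\<^sub>C G \<xi> (T (G \<zeta> w))) z"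
          by (simp flip: resolvent add: c.diff)
        then show ?case using elim by (simp add: cinner_scaleC_left)
      qed
      ultimately show ?thesis
        unfolding has_field_derivative_iff by (rule Lim_transform_eventually)
    qed
    then show ?thesis by (auto simp: holomorphic_on_def field_differentiable_def)
  qed
  have coeff: "(deriv ^^ m) (\<lambda>\<zeta>. cinner (G \<zeta> w) z) 0 = fact m * cinner ((T ^^ m) w) z" for m w z
  proof (induction m arbitrary: w)
    case 0
    have "G 0 w = w" by (rule G_eqI) simp
    then show ?case by simp
  next
    case (Suc m)
    \<comment> \<open>Commutation turns the defining equation into
      \<open>G \<zeta> w = w + \<zeta> G \<zeta> (T w)\<close>: the coefficients for
      \<open>w\<close> are those for \<open>T w\<close> moved up by one.\<close>
    have "T (G \<zeta> w) = G \<zeta> (T w)" for \<zeta>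
    proof (rule G_eqI[symmetric])
      have "T (G \<zeta> w) - \<zeta> *\<^sub>C T (T (G \<zeta> w)) = T (G \<zeta> w - \<zeta> *\<^sub>C T (G \<zeta> w))"
        by (simp only: T.diff TC)
      then show "T (G \<zeta> w) - \<zeta> *\<^sub>C T (T (G \<zeta> w)) = T w" by (simp only: G)
    qed
    then have "G \<zeta> w = w + \<zeta> *\<^sub>C G \<zeta> (T w)" for \<zeta> using G[of \<zeta> w] by (simp add: algebra_simps)
    then have "cinner (G \<zeta> w) z = cinner w z + \<zeta> * cinner (G \<zeta> (T w)) z" for \<zeta>
      by (metis cinner_add_left cinner_scaleC_left)
    then have "(deriv ^^ Suc m) (\<lambda>\<zeta>. cinner (G \<zeta> w) z) 0
      = (deriv ^^ Suc m) (\<lambda>\<zeta>. cinner w z + \<zeta> * cinner (G \<zeta> (T w)) z) 0" by presburger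
    also have "\<dots> = of_nat (Suc m) * (fact m * cinner ((T ^^ m) (T w)) z)"
      unfolding higher_deriv_times_id[OF hol] Suc.IH by simp
    finally show ?case by (simp add: funpow_swap1)
  qed
  have "norm ((T ^^ n) x) \<le> B" for n
  proof -
    \<comment> \<open>Testing against the vector to be bounded turns Cauchy's estimate for the
      coefficient into a bound for its norm.\<close>
    define z where "z = (T ^^ n) x"
    have "norm ((deriv ^^ n) (\<lambda>\<zeta>. cinner (G \<zeta> x) z) 0) \<le> fact n * (B * norm z) / 1 ^ n"
    proof (rule Cauchy_inequality)
      show "(\<lambda>\<zeta>. cinner (G \<zeta> x) z) holomorphic_on ball 0 1" using hol by (rule holomorphic_on_subset) simp
      show "continuous_on (cball 0 1) (\<lambda>\<zeta>. cinner (G \<zeta> x) z)"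
        using holomorphic_on_imp_continuous_on[OF hol] by (rule continuous_on_subset) simp
      fix \<zeta> :: complex assume "cmod (0 - \<zeta>) = 1"
      then have "norm (G \<zeta> x) \<le> B" by (intro B) simp
      then show "cmod (cinner (G \<zeta> x) z) \<le> B * norm z"
        using norm_cinner_le[of "G \<zeta> x" z] by (meson mult_right_mono norm_ge_zero order_trans)
    qed simp
    then have "norm z * norm z \<le> B * norm z"
      by (simp add: coeff norm_mult z_def[symmetric] cinner_self norm_power power2_eq_square)
    then show ?thesis using B[of 0] norm_ge_zero[of "G 0 x"]
      by (cases "z = 0") (auto simp: z_def[symmetric] simp del: norm_ge_zero)
  qed
  then show ?thesis by blast
qed

section \<open>Baire category and uniform boundedness\<close>

lemma baire_closed_union:
  fixes F :: "nat \<Rightarrow> 'a::banach set"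
  assumes "\<And>n. closed (F n)" "(\<Union>n. F n) = UNIV"
  shows "\<exists>n. interior (F n) \<noteq> {}"
proof (rule ccontr)
  assume neg: "\<not> ?thesis"
  have "completely_metrizable_space (euclidean :: 'a topology)"
    using Met_TC.completely_metrizable_space_mtopology[where 'a='a]
    by (simp add: complete_UNIV)
  then have "(euclidean :: 'a topology) interior_of \<Union>(range F) = {}"
    using neg assms by (intro Baire_category_alt) auto
  then show False using assms by simp
qed

text \<open>Some \<open>F k\<close> contains a ball about a point \<open>a\<close>; linearity moves
  the ball to the origin at the price of a factor 2.\<close>

lemma uniform_boundedness:
  fixes f :: "nat \<Rightarrow> 'a::banach \<Rightarrow> 'b::real_normed_vector"
  assumes f: "\<And>n. bounded_linear (f n)" and bdd: "\<And>x. \<exists>b. \<forall>n. norm (f n x) \<le> b"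
  shows "\<exists>M. \<forall>n x. norm (f n x) \<le> M * norm x"
proof -
  define F where "F k = {x. \<forall>n. norm (f n x) \<le> real k}" for k
  have "F k = (\<Inter>n. {x. norm (f n x) \<le> real k})" for k by (auto simp: F_def)
  then have "closed (F k)" for k
    using linear_continuous_on[OF f] by (auto intro!: closed_INT closed_Collect_le continuous_intros)
  moreover have "(\<Union>k. F k) = UNIV"
  proof (safe)
    fix x
    obtain b where "\<And>n. norm (f n x) \<le> b" using bdd by blast
    moreover obtain k :: nat where "b \<le> k" using real_arch_simple by blast
    ultimately have "x \<in> F k" unfolding F_def by (auto intro: order_trans)
    then show "x \<in> (\<Union>k. F k)" by blast
  qed simp
  ultimately obtain k where "interior (F k) \<noteq> {}" using baire_closed_union by blast
  then obtain a e where e: "e > 0" "cball a e \<subseteq> F k" by (metis ex_in_conv mem_interior_cball)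
  have "norm (f n x) \<le> (2 * k / e) * norm x" for n x
  proof (cases "x = 0")
    case False
    interpret bounded_linear "f n" by (rule f)
    define y where "y = (e / norm x) *\<^sub>R x"
    have "norm y = e" using False e by (simp add: y_def)
    then have "a + y \<in> F k" "a \<in> F k" using e by (auto simp: dist_norm subset_eq)
    then have "norm (f n (a + y)) \<le> k" "norm (f n a) \<le> k" by (auto simp: F_def)
    then have "norm (f n (a + y) - f n a) \<le> 2 * k" using norm_triangle_ineq4[of "f n (a + y)" "f n a"] by linarith
    then have "norm (f n y) \<le> 2 * k" by (simp add: add)
    then show ?thesis using False e by (simp add: y_def scaleR field_simps)
  qed (simp add: linear_0[OF bounded_linear.linear[OF f]])
  then show ?thesis by blast
qed

section \<open>Strongly continuous semigroups\<close>

lemma eventually_at_right_pos: "\<forall>\<^sub>F t in at_right (0::real). t > 0"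
  by (rule eventually_at_right_less)

locale c0_semigroup =
  fixes S :: "real \<Rightarrow> 'a::complex_hilbert \<Rightarrow> 'a"
  assumes C0: "C0_semigroup S"
begin

lemma bounded_clinear_S: "t \<ge> 0 \<Longrightarrow> bounded_clinear (S t)"
  using C0 by (simp add: C0_semigroup_def)

lemma bounded_linear_S: "t \<ge> 0 \<Longrightarrow> bounded_linear (S t)"
  using bounded_clinear_S by (rule bounded_clinear_bl)

lemma S_0 [simp]: "S 0 x = x"
  using C0 by (simp add: C0_semigroup_def)

lemma S_plus: "s \<ge> 0 \<Longrightarrow> t \<ge> 0 \<Longrightarrow> S (s + t) x = S s (S t x)"
  using C0 by (simp add: C0_semigroup_def)

lemma S_tendsto_0: "((\<lambda>t. S t x) \<longlongrightarrow> x) (at_right 0)"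
  using C0 by (simp add: C0_semigroup_def)

lemma S_scaleC: "t \<ge> 0 \<Longrightarrow> S t (c *\<^sub>C x) = c *\<^sub>C S t x"
  using bounded_clinear_S bounded_clinear_scaleC by blast

lemma S_scaleR: "t \<ge> 0 \<Longrightarrow> S t (c *\<^sub>R x) = c *\<^sub>R S t x"
  using S_scaleC[of t "of_real c" x] by (simp add: scaleC_of_real)

lemma S_diff: "t \<ge> 0 \<Longrightarrow> S t (x - y) = S t x - S t y"
  by (rule linear_diff[OF bounded_linear.linear[OF bounded_linear_S]])

lemma S_add: "t \<ge> 0 \<Longrightarrow> S t (x + y) = S t x + S t y"
  by (rule linear_add[OF bounded_linear.linear[OF bounded_linear_S]])

lemma S_zero: "t \<ge> 0 \<Longrightarrow> S t 0 = 0"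
  by (rule linear_0[OF bounded_linear.linear[OF bounded_linear_S]])

lemma S_commute: "s \<ge> 0 \<Longrightarrow> t \<ge> 0 \<Longrightarrow> S s (S t x) = S t (S s x)"
  by (metis S_plus add.commute)

text \<open>Failure would give times tending to 0 with unbounded operator norms, although every
  orbit converges along these times, contrary to uniform boundedness.\<close>

lemma S_bounded_near_0: "\<exists>\<delta>>0. \<exists>M. \<forall>t\<in>{0..\<delta>}. \<forall>x. norm (S t x) \<le> M * norm x"
proof (rule ccontr)
  assume neg: "\<not> ?thesis"
  have "\<exists>t. 0 \<le> t \<and> t \<le> 1 / Suc n \<and> (\<exists>x. norm (S t x) > Suc n * norm x)" for n
  proof (rule ccontr)
    assume "\<not> ?thesis"
    then have "\<forall>t\<in>{0..1 / Suc n}. \<forall>x. norm (S t x) \<le> Suc n * norm x" by (auto simp: not_less)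
    then show False using neg zero_less_divide_1_iff of_nat_0_less_iff zero_less_Suc by blast
  qed
  then obtain t where t: "\<And>n. 0 \<le> t n" "\<And>n. t n \<le> 1 / Suc n" "\<And>n. \<exists>x. norm (S (t n) x) > Suc n * norm x"
    by metis
  \<comment> \<open>The filter \<open>at_right 0\<close> does not see the time 0, where the operator
    is the identity and cannot exceed the chosen bound.\<close>
  have t_pos: "t n > 0" for n
  proof (rule ccontr)
    assume "\<not> t n > 0"
    then have "t n = 0" using t(1)[of n] by simp
    then obtain x :: 'a where "norm x > Suc n * norm x" using t(3)[of n] by auto
    moreover have "1 * norm x \<le> Suc n * norm x" by (intro mult_right_mono) auto
    ultimately show False by simp
  qed
  have "t \<longlonglongrightarrow> 0"
    by (rule Lim_null_comparison[OF _ LIMSEQ_Suc[OF lim_1_over_n]]) (use t in auto)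
  then have t0: "filterlim t (at_right 0) sequentially"
    using t_pos by (simp add: filterlim_at_withinI eventually_sequentially)
  have "\<exists>b. \<forall>n. norm (S (t n) x) \<le> b" for x
  proof -
    have "(\<lambda>n. S (t n) x) \<longlonglongrightarrow> x" using filterlim_compose[OF S_tendsto_0 t0] .
    then have "Bseq (\<lambda>n. S (t n) x)" by (metis convergent_imp_Bseq convergent_def)
    then show ?thesis by (auto simp: Bseq_def)
  qed
  then obtain M where M: "\<And>n x. norm (S (t n) x) \<le> M * norm x"
    using uniform_boundedness[of "\<lambda>n. S (t n)"] bounded_linear_S t(1) by blast
  obtain n :: nat where n: "M \<le> n" using real_arch_simple by blast
  obtain x where "norm (S (t n) x) > Suc n * norm x" using t(3) by blast
  moreover have "M * norm x \<le> Suc n * norm x" using n by (intro mult_right_mono) auto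
  ultimately show False using M[of n x] by linarith
qed

lemma S_locally_bounded:
  obtains M where "M \<ge> 1" "\<And>t x. 0 \<le> t \<Longrightarrow> t \<le> T \<Longrightarrow> norm (S t x) \<le> M * norm x"
proof -
  obtain \<delta> M where \<delta>: "\<delta> > 0" and M0: "\<And>t x. 0 \<le> t \<Longrightarrow> t \<le> \<delta> \<Longrightarrow> norm (S t x) \<le> M * norm x"
    using S_bounded_near_0 by (metis atLeastAtMost_iff)
  \<comment> \<open>At least 1, so that its powers increase and one power serves all shorter
    times.\<close>
  define K where "K = max 1 M"
  have K: "norm (S t x) \<le> K * norm x" if "0 \<le> t" "t \<le> \<delta>" for t x
    using M0[OF that, of x] mult_right_mono[of M K "norm x"] by (simp add: K_def)
  have *: "norm (S t x) \<le> K ^ Suc n * norm x" if "0 \<le> t" "t \<le> Suc n * \<delta>" for t n x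
    using that
  proof (induction n arbitrary: t)
    case 0 then show ?case using K[of t x] by simp
  next
    case (Suc n)
    show ?case
    proof (cases "t \<le> Suc n * \<delta>")
      case True
      have "K ^ Suc n * norm x \<le> K ^ Suc (Suc n) * norm x"
        by (intro mult_right_mono power_increasing) (auto simp: K_def)
      then show ?thesis using Suc True by fastforce
    next
      case False
      have "real (Suc n) * \<delta> = \<delta> + n * \<delta>" "0 \<le> n * \<delta>" using \<delta> by (simp_all add: algebra_simps)
      then have "\<delta> \<le> t" using False by linarith
      then have "norm (S (\<delta> + (t - \<delta>)) x) \<le> K * norm (S (t - \<delta>) x)"
        using \<delta> by (subst S_plus) (auto intro!: K)
      also have "\<dots> \<le> K * (K ^ Suc n * norm x)"
        using \<open>\<delta> \<le> t\<close> \<delta> Suc.prems by (intro mult_left_mono Suc.IH) (auto simp: field_simps K_def)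
      finally show ?thesis by simp
    qed
  qed
  obtain n :: nat where n: "T / \<delta> \<le> n" using real_arch_simple by blast
  show ?thesis
  proof (rule that[of "K ^ Suc n"])
    show "1 \<le> K ^ Suc n" by (rule one_le_power) (simp add: K_def)
    show "norm (S t x) \<le> K ^ Suc n * norm x" if "0 \<le> t" "t \<le> T" for t x
    proof (rule *)
      have "T \<le> n * \<delta>" using n \<delta> by (simp add: field_simps)
      then show "t \<le> Suc n * \<delta>" using that \<delta> by (simp add: field_simps)
    qed fact
  qed
qed

text \<open>Strong continuity is given from the right at 0 only. In
  \<open>S b x - S a x = S a (S (b - a) x - x)\<close> the smaller time stands outside, so the local
  bound covers both sides of \<open>t\<close>.\<close>

lemma continuous_on_S: "continuous_on {0..} (\<lambda>t. S t x)"
  unfolding continuous_on_iff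
proof (intro ballI allI impI)
  fix t e :: real assume "t \<in> {0..}" and e: "0 < e"
  then have t: "0 \<le> t" by simp
  obtain M where M: "M \<ge> 1" "\<And>s y. 0 \<le> s \<Longrightarrow> s \<le> t + 1 \<Longrightarrow> norm (S s y) \<le> M * norm y"
    using S_locally_bounded[of "t + 1"] by blast
  have "\<forall>\<^sub>F s in at_right 0. dist (S s x) x < e / M"
    using S_tendsto_0 e M(1) by (intro tendstoD) auto
  then obtain d where d: "d > 0" "\<And>s. 0 < s \<Longrightarrow> s < d \<Longrightarrow> dist (S s x) x < e / M"
    by (auto simp: eventually_at_right_field)
  have "dist (S s x) (S t x) < e" if s: "0 \<le> s" "dist s t < min d 1" for s
  proof -
    have *: "norm (S b x - S a x) < e" if "0 \<le> a" "a < b" "b \<le> t + 1" "b - a < d" for a b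
    proof -
      have "S b x - S a x = S a (S (b - a) x - x)"
        using that S_plus[of a "b - a"] by (simp add: S_diff)
      then have "norm (S b x - S a x) \<le> M * norm (S (b - a) x - x)" using that by (simp add: M(2))
      also have "\<dots> < M * (e / M)"
        using d(2)[of "b - a"] that M(1) by (intro mult_strict_left_mono) (auto simp: dist_norm)
      finally show ?thesis using M(1) by simp
    qed
    consider "s < t" | "s = t" | "t < s" by linarith
    then show ?thesis
      using *[of s t] *[of t s] s t e by cases (auto simp: dist_norm norm_minus_commute)
  qed
  then show "\<exists>d>0. \<forall>s\<in>{0..}. dist s t < d \<longrightarrow> dist (S s x) (S t x) < e"
    using d(1) by (intro exI[of _ "min d 1"]) auto
qed

text \<open>Joint continuity in time and state follows from the local bound on the operators; it
  later carries simple approximations through a convolution.\<close>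

lemma tendsto_S:
  assumes t: "(t \<longlongrightarrow> a) F" "\<forall>\<^sub>F i in F. t i \<ge> 0" "a \<ge> 0" and x: "(x \<longlongrightarrow> y) F"
  shows "((\<lambda>i. S (t i) (x i)) \<longlongrightarrow> S a y) F"
proof -
  obtain M where M: "M \<ge> 1" "\<And>s y. 0 \<le> s \<Longrightarrow> s \<le> a + 1 \<Longrightarrow> norm (S s y) \<le> M * norm y"
    using S_locally_bounded[of "a + 1"] by blast
  have "((\<lambda>i. S (t i) y) \<longlongrightarrow> S a y) F"
  proof (rule continuous_on_tendsto_compose[OF continuous_on_S])
    show "\<forall>\<^sub>F i in F. t i \<in> {0..}" using t(2) by simp
  qed (use t in auto)
  moreover have "((\<lambda>i. S (t i) (x i - y)) \<longlongrightarrow> 0) F"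
  proof (rule Lim_null_comparison)
    have "\<forall>\<^sub>F i in F. t i < a + 1" using t(1) by (rule order_tendstoD) simp
    with t(2) show "\<forall>\<^sub>F i in F. norm (S (t i) (x i - y)) \<le> M * norm (x i - y)"
      by eventually_elim (simp add: M)
    show "((\<lambda>i. M * norm (x i - y)) \<longlongrightarrow> 0) F"
      using tendsto_mult_right_zero[OF tendsto_norm_zero[OF LIM_zero[OF x]]] .
  qed
  ultimately have "((\<lambda>i. S (t i) y + S (t i) (x i - y)) \<longlongrightarrow> S a y + 0) F" by (rule tendsto_add)
  moreover have "\<forall>\<^sub>F i in F. S (t i) y + S (t i) (x i - y) = S (t i) (x i)"
    using t(2) by eventually_elim (simp add: S_diff)
  ultimately show ?thesis using Lim_transform_eventually by fastforce
qed

text \<open>The integrated semigroup. Its values lie in the domain of the generator, which makes it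
  a substitute for a resolvent.\<close>

definition J :: "real \<Rightarrow> 'a \<Rightarrow> 'a" where "J t x = integral {0..t} (\<lambda>s. S s x)"

lemma S_integrable: "0 \<le> a \<Longrightarrow> (\<lambda>s. S s x) integrable_on {a..b}"
  by (intro integrable_continuous_interval continuous_on_subset[OF continuous_on_S]) auto

lemma bounded_linear_J: assumes "t \<ge> 0" shows "bounded_linear (J t)"
proof -
  obtain M where M: "M \<ge> 1" "\<And>s y. 0 \<le> s \<Longrightarrow> s \<le> t \<Longrightarrow> norm (S s y) \<le> M * norm y"
    using S_locally_bounded[of t] by blast
  show ?thesis
  proof (rule bounded_linear_intro[of _ "M * t"])
    show "J t (x + y) = J t x + J t y" for x y
      unfolding J_def by (subst integral_add[symmetric])
        (auto intro!: S_integrable integral_cong simp: S_add)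
    show "J t (r *\<^sub>R x) = r *\<^sub>R J t x" for r x
      unfolding J_def integral_cmul[symmetric] by (intro integral_cong) (simp add: S_scaleR)
    show "norm (J t x) \<le> norm x * (M * t)" for x
    proof -
      have "norm (integral {0..t} (\<lambda>s. S s x)) \<le> M * norm x * (t - 0)"
        by (rule integral_bound) (auto intro: continuous_on_subset[OF continuous_on_S] M assms)
      then show ?thesis by (simp add: J_def mult_ac)
    qed
  qed
qed

lemma S_J: assumes "h \<ge> 0" "t \<ge> 0" shows "S h (J t x) = integral {h..h+t} (\<lambda>s. S s x)"
proof -
  have "S h (J t x) = integral {0..t} (\<lambda>s. S h (S s x))"
    unfolding J_def using integral_linear[OF S_integrable[of 0 x t] bounded_linear_S[OF assms(1)]]
    by (simp add: o_def)
  also have "\<dots> = integral {0..t} (\<lambda>s. S (s + h) x)"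
    using assms by (intro integral_cong) (simp add: add.commute flip: S_plus)
  also have "\<dots> = integral {h..h+t} (\<lambda>s. S s x)"
    using integral_shift_Icc_real[where a = 0 and b = t and c = h and f = "\<lambda>s. S s x"]
    by (simp add: o_def add.commute)
  finally show ?thesis .
qed

lemma J_average:
  assumes "a \<ge> 0"
  shows "((\<lambda>h. integral {a..a+h} (\<lambda>s. S s x) /\<^sub>R h) \<longlongrightarrow> S a x) (at_right 0)"
proof (rule tendstoI)
  fix e :: real assume e: "0 < e"
  obtain d where d: "d > 0" "\<And>s. 0 \<le> s \<Longrightarrow> dist s a < d \<Longrightarrow> dist (S s x) (S a x) < e / 2"
    using continuous_on_S[of x] assms e unfolding continuous_on_iff
    by (metis atLeast_iff half_gt_zero)
  have "dist (integral {a..a+h} (\<lambda>s. S s x) /\<^sub>R h) (S a x) < e" if h: "0 < h" "h < d" for h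
  proof -
    have cont: "continuous_on {a..a+h} (\<lambda>s. S s x)"
      using assms by (intro continuous_on_subset[OF continuous_on_S]) auto
    have "integral {a..a+h} (\<lambda>s. S s x) - h *\<^sub>R S a x = integral {a..a+h} (\<lambda>s. S s x - S a x)"
      using h assms by (subst integral_diff) (auto intro: S_integrable)
    moreover have "norm (integral {a..a+h} (\<lambda>s. S s x - S a x)) \<le> e / 2 * (a + h - a)"
    proof (rule integral_bound)
      show "norm (S s x - S a x) \<le> e / 2" if "s \<in> {a..a+h}" for s
        using d(2)[of s] that h assms by (simp add: dist_norm)
    qed (use h cont in \<open>auto intro!: continuous_intros\<close>)
    ultimately have "norm (integral {a..a+h} (\<lambda>s. S s x) - h *\<^sub>R S a x) / h \<le> e / 2"
      using h by (simp add: pos_divide_le_eq)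
    moreover have "integral {a..a+h} (\<lambda>s. S s x) /\<^sub>R h - S a x
        = (integral {a..a+h} (\<lambda>s. S s x) - h *\<^sub>R S a x) /\<^sub>R h"
      using h by (simp add: scaleR_diff_right)
    then have "dist (integral {a..a+h} (\<lambda>s. S s x) /\<^sub>R h) (S a x)
        = norm (integral {a..a+h} (\<lambda>s. S s x) - h *\<^sub>R S a x) / h"
      using h by (simp only: dist_norm norm_scaleR) (simp add: divide_inverse mult.commute)
    ultimately have "dist (integral {a..a+h} (\<lambda>s. S s x) /\<^sub>R h) (S a x) \<le> e / 2" by simp
    then show ?thesis using e by simp
  qed
  then show "\<forall>\<^sub>F h in at_right 0. dist (integral {a..a+h} (\<lambda>s. S s x) /\<^sub>R h) (S a x) < e"
    using d(1) by (auto simp: eventually_at_right_field)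
qed

end

section \<open>The generator of a semigroup and its domain\<close>

locale c0_generator =
  fixes D :: "'a::complex_hilbert set" and A :: "'a \<Rightarrow> 'a" and S :: "real \<Rightarrow> 'a \<Rightarrow> 'a"
  assumes generates: "generates_C0_semigroup D A S"

sublocale c0_generator \<subseteq> c0_semigroup S
  using generates by unfold_locales (simp add: generates_C0_semigroup_def)

context c0_generator
begin

lemma generator_iff: "x \<in> D \<and> A x = y \<longleftrightarrow> ((\<lambda>t. (S t x - x) /\<^sub>R t) \<longlongrightarrow> y) (at_right 0)"
  using generates by (simp add: generates_C0_semigroup_def)

lemma generator_limit: "x \<in> D \<Longrightarrow> ((\<lambda>t. (S t x - x) /\<^sub>R t) \<longlongrightarrow> A x) (at_right 0)"
  using generator_iff by blast

lemma generatorI: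
  assumes "((\<lambda>t. (S t x - x) /\<^sub>R t) \<longlongrightarrow> y) (at_right 0)"
  shows "x \<in> D" "A x = y"
  using assms generator_iff by blast+

lemma generator_linear:
  assumes "x \<in> D" "y \<in> D"
  shows "x + y \<in> D" "A (x + y) = A x + A y" "c *\<^sub>C x \<in> D" "A (c *\<^sub>C x) = c *\<^sub>C A x"
proof -
  have *: "((\<lambda>t. (S t (c *\<^sub>C x + d *\<^sub>C y) - (c *\<^sub>C x + d *\<^sub>C y)) /\<^sub>R t) \<longlongrightarrow> c *\<^sub>C A x + d *\<^sub>C A y) (at_right 0)" for c d
  proof (rule Lim_transform_eventually)
    show "((\<lambda>t. c *\<^sub>C ((S t x - x) /\<^sub>R t) + d *\<^sub>C ((S t y - y) /\<^sub>R t)) \<longlongrightarrow> c *\<^sub>C A x + d *\<^sub>C A y) (at_right 0)"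
      by (intro tendsto_add tendsto_scaleC tendsto_const generator_limit assms)
    show "\<forall>\<^sub>F t in at_right 0. c *\<^sub>C ((S t x - x) /\<^sub>R t) + d *\<^sub>C ((S t y - y) /\<^sub>R t)
        = (S t (c *\<^sub>C x + d *\<^sub>C y) - (c *\<^sub>C x + d *\<^sub>C y)) /\<^sub>R t"
      using eventually_at_right_pos
      by eventually_elim
        (simp add: S_add S_scaleC scaleC_scaleR scaleC_diff_right algebra_simps)
  qed
  show "x + y \<in> D" "A (x + y) = A x + A y" using generatorI[OF *[of 1 1]] by simp_all
  show "c *\<^sub>C x \<in> D" "A (c *\<^sub>C x) = c *\<^sub>C A x" using generatorI[OF *[of c 0]] by simp_all
qed

lemma zero_in_D: "0 \<in> D" "A 0 = 0"
proof -
  have "((\<lambda>t. (S t 0 - 0) /\<^sub>R t) \<longlongrightarrow> 0) (at_right 0)"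
  proof (rule Lim_transform_eventually[OF tendsto_const])
    show "\<forall>\<^sub>F t in at_right 0. 0 = (S t 0 - 0) /\<^sub>R t"
      using eventually_at_right_pos by eventually_elim (simp add: S_zero)
  qed
  from generatorI[OF this] show "0 \<in> D" "A 0 = 0" by simp_all
qed

lemma generator_diff:
  assumes "x \<in> D" "y \<in> D"
  shows "x - y \<in> D" "A (x - y) = A x - A y"
proof -
  have y: "- y \<in> D" "A (- y) = - A y" using generator_linear(3,4)[OF assms(2,2), of "-1"] by (simp_all add: scaleC_minus1)
  show "x - y \<in> D" "A (x - y) = A x - A y"
    using generator_linear(1,2)[OF assms(1) y(1)] y(2) by simp_all
qed

lemma S_generator:
  assumes "x \<in> D" "t \<ge> 0"
  shows "S t x \<in> D" "A (S t x) = S t (A x)"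
proof -
  have "((\<lambda>h. (S h (S t x) - S t x) /\<^sub>R h) \<longlongrightarrow> S t (A x)) (at_right 0)"
  proof (rule Lim_transform_eventually)
    show "((\<lambda>h. S t ((S h x - x) /\<^sub>R h)) \<longlongrightarrow> S t (A x)) (at_right 0)"
      by (rule bounded_linear.tendsto[OF bounded_linear_S[OF assms(2)] generator_limit[OF assms(1)]])
    show "\<forall>\<^sub>F h in at_right 0. S t ((S h x - x) /\<^sub>R h) = (S h (S t x) - S t x) /\<^sub>R h"
      using eventually_at_right_pos
      by eventually_elim (use assms in \<open>simp add: S_diff S_scaleR S_commute[of _ t]\<close>)
  qed
  from generatorI[OF this] show "S t x \<in> D" "A (S t x) = S t (A x)" by simp_all
qed

text \<open>The window from \<open>h\<close> to \<open>h + t\<close> differs from that from 0 to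
  \<open>t\<close> only at its ends, so the difference quotient is a difference of two short
  averages, one at \<open>t\<close> and one at 0.\<close>

lemma J_generator:
  assumes "t \<ge> 0"
  shows "J t x \<in> D" "A (J t x) = S t x - x"
proof -
  have "((\<lambda>h. (S h (J t x) - J t x) /\<^sub>R h) \<longlongrightarrow> S t x - S 0 x) (at_right 0)"
  proof (rule Lim_transform_eventually)
    show "((\<lambda>h. integral {t..t+h} (\<lambda>s. S s x) /\<^sub>R h - integral {0..0+h} (\<lambda>s. S s x) /\<^sub>R h)
        \<longlongrightarrow> S t x - S 0 x) (at_right 0)"
      by (intro tendsto_diff J_average assms order_refl)
    show "\<forall>\<^sub>F h in at_right 0. integral {t..t+h} (\<lambda>s. S s x) /\<^sub>R h - integral {0..0+h} (\<lambda>s. S s x) /\<^sub>R h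
        = (S h (J t x) - J t x) /\<^sub>R h"
      using eventually_at_right_pos
    proof eventually_elim
      case (elim h)
      have "integral {0..t} (\<lambda>s. S s x) + integral {t..t+h} (\<lambda>s. S s x) = integral {0..t+h} (\<lambda>s. S s x)"
        using elim assms by (intro Henstock_Kurzweil_Integration.integral_combine S_integrable) auto
      moreover have "integral {0..h} (\<lambda>s. S s x) + integral {h..t+h} (\<lambda>s. S s x) = integral {0..t+h} (\<lambda>s. S s x)"
        using elim assms by (intro Henstock_Kurzweil_Integration.integral_combine S_integrable) auto
      ultimately show ?case
        using elim assms by (simp add: S_J add.commute flip: scaleR_diff_right)
          (simp add: J_def algebra_simps)
    qed
  qed
  from generatorI[OF this] show "J t x \<in> D" "A (J t x) = S t x - x" by simp_all
qed

text \<open>\<open>J t\<close> commutes with \<open>S h\<close>, so it maps difference quotients of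
  \<open>x\<close> to those of \<open>J t x\<close>, whose limit is already known.\<close>

lemma J_of_generator:
  assumes "t \<ge> 0" "x \<in> D"
  shows "J t (A x) = S t x - x"
proof -
  interpret J: bounded_linear "J t" by (rule bounded_linear_J[OF assms(1)])
  have "((\<lambda>h. (S h (J t x) - J t x) /\<^sub>R h) \<longlongrightarrow> J t (A x)) (at_right 0)"
  proof (rule Lim_transform_eventually)
    show "((\<lambda>h. J t ((S h x - x) /\<^sub>R h)) \<longlongrightarrow> J t (A x)) (at_right 0)"
      by (rule J.tendsto[OF generator_limit[OF assms(2)]])
    have comm: "J t (S h x) = S h (J t x)" if "h > 0" for h
    proof -
      have "J t (S h x) = integral {0..t} (\<lambda>s. S (s + h) x)"
        unfolding J_def using that by (intro integral_cong) (simp add: S_plus)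
      also have "\<dots> = integral {h..h+t} (\<lambda>s. S s x)"
        using integral_shift_Icc_real[where a = 0 and b = t and c = h and f = "\<lambda>s. S s x"]
    by (simp add: o_def add.commute)
      finally show ?thesis using that assms by (simp add: S_J)
    qed
    show "\<forall>\<^sub>F h in at_right 0. J t ((S h x - x) /\<^sub>R h) = (S h (J t x) - J t x) /\<^sub>R h"
      using eventually_at_right_pos
      by eventually_elim (simp add: J.diff J.scaleR comm)
  qed
  then show ?thesis using J_generator(2)[OF assms(1)] generatorI(2) by metis
qed

lemma domain_dense: "((\<lambda>h. J h x /\<^sub>R h) \<longlongrightarrow> x) (at_right 0)" "\<forall>\<^sub>F h in at_right 0. J h x /\<^sub>R h \<in> D"
proof -
  show "((\<lambda>h. J h x /\<^sub>R h) \<longlongrightarrow> x) (at_right 0)" using J_average[of 0 x] by (simp add: J_def)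
  show "\<forall>\<^sub>F h in at_right 0. J h x /\<^sub>R h \<in> D"
    using eventually_at_right_pos
  proof eventually_elim
    case (elim h)
    then have "J h x \<in> D" by (simp add: J_generator)
    then show ?case using generator_linear(3)[of "J h x" "J h x" "of_real (inverse h)"]
      by (simp add: scaleR_scaleC)
  qed
qed

text \<open>Density of the domain in the form that makes the adjoint single-valued.\<close>

lemma domain_orthogonal:
  assumes "\<And>x. x \<in> D \<Longrightarrow> cinner x w = 0"
  shows "w = 0"
proof -
  have "((\<lambda>h. cinner (J h w /\<^sub>R h) w) \<longlongrightarrow> cinner w w) (at_right 0)"
    by (rule bounded_linear.tendsto[OF bounded_linear_cinner_left domain_dense(1)])
  moreover have "\<forall>\<^sub>F h in at_right 0. cinner (J h w /\<^sub>R h) w = 0"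
    using domain_dense(2)[of w] by eventually_elim (rule assms)
  then have "((\<lambda>h. cinner (J h w /\<^sub>R h) w) \<longlongrightarrow> 0) (at_right 0)"
    by (rule tendsto_eventually)
  ultimately have "cinner w w = 0" by (rule tendsto_unique[rotated]) simp
  then show ?thesis by (simp add: cinner_self)
qed

text \<open>Integration removes the unbounded operator:
  \<open>J t (A (x n)) = S t (x n) - x n\<close> passes to the limit, and dividing by
  \<open>t\<close> recovers the generator there.\<close>

lemma generator_closed:
  assumes xD: "\<And>n. x n \<in> D" and x: "x \<longlonglongrightarrow> a" and y: "(\<lambda>n. A (x n)) \<longlonglongrightarrow> b"
  shows "a \<in> D" "A a = b"
proof -
  have *: "S t a - a = J t b" if "t \<ge> 0" for t
  proof -
    have "(\<lambda>n. J t (A (x n))) \<longlonglongrightarrow> J t b"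
      by (rule bounded_linear.tendsto[OF bounded_linear_J[OF that] y])
    moreover have "(\<lambda>n. S t (x n) - x n) \<longlonglongrightarrow> S t a - a"
      by (intro tendsto_diff x bounded_linear.tendsto[OF bounded_linear_S[OF that] x])
    ultimately show ?thesis using J_of_generator[OF that xD] LIMSEQ_unique by simp
  qed
  have "((\<lambda>t. (S t a - a) /\<^sub>R t) \<longlongrightarrow> b) (at_right 0)"
  proof (rule Lim_transform_eventually[OF domain_dense(1)])
    show "\<forall>\<^sub>F t in at_right 0. J t b /\<^sub>R t = (S t a - a) /\<^sub>R t"
      using eventually_at_right_pos by eventually_elim (simp add: *)
  qed
  from generatorI[OF this] show "a \<in> D" "A a = b" by simp_all
qed

section \<open>Eigenvalues of the semigroup and spectrum of the generator\<close>

text \<open>Reduces questions about the spectral value \<open>l\<close> to questions about the value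
  0.\<close>

lemma rescaled_generator:
  "generates_C0_semigroup D (\<lambda>x. A x - l *\<^sub>C x) (\<lambda>t x. exp (- l * of_real t) *\<^sub>C S t x)"
  unfolding generates_C0_semigroup_def C0_semigroup_def
proof (intro conjI allI impI)
  let ?T = "\<lambda>t x. exp (- l * of_real t) *\<^sub>C S t x"
  have exp0: "((\<lambda>t. exp (- l * of_real t)) \<longlongrightarrow> 1) (at_right (0::real))"
    by (auto intro!: tendsto_eq_intros)
  show "bounded_clinear (?T t)" if "0 \<le> t" for t
    using bounded_clinear_compose[OF bounded_clinear_scaleC_op bounded_clinear_S[OF that]] .
  show "?T 0 = id" by auto
  show "?T (s + t) = ?T s \<circ> ?T t" if "0 \<le> s" "0 \<le> t" for s t
    using that by (auto simp: S_plus S_scaleC scaleC_scaleC algebra_simps simp flip: exp_add)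
  show "((\<lambda>t. ?T t x) \<longlongrightarrow> x) (at_right 0)" for x
    using tendsto_scaleC[OF exp0 S_tendsto_0[of x]] by simp
  have deriv: "((\<lambda>t. (exp (- l * of_real t) - 1) / of_real t) \<longlongrightarrow> - l) (at_right (0::real))"
  proof -
    have "((\<lambda>z. exp (- l * z)) has_field_derivative - l) (at 0)"
      by (auto intro!: derivative_eq_intros)
    then have "((\<lambda>z. (exp (- l * z) - 1) / z) \<longlongrightarrow> - l) (at 0)"
      by (simp add: has_field_derivative_iff)
    moreover have "filterlim (of_real :: real \<Rightarrow> complex) (at 0) (at_right 0)"
      unfolding filterlim_at by (auto intro!: tendsto_eq_intros simp: eventually_at_right_field intro: gt_ex)
    ultimately show ?thesis by (rule filterlim_compose)
  qed
  \<comment> \<open>A product rule for difference quotients. It can be solved for the quotient of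
    \<open>S\<close>, which gives the converse implication.\<close>
  have split: "(?T t x - x) /\<^sub>R t = exp (- l * of_real t) *\<^sub>C ((S t x - x) /\<^sub>R t)
      + ((exp (- l * of_real t) - 1) / of_real t) *\<^sub>C x" for t x
    by (simp add: scaleR_scaleC scaleC_scaleC scaleC_diff_right scaleC_diff_left divide_inverse algebra_simps)
  show "x \<in> D \<and> A x - l *\<^sub>C x = y \<longleftrightarrow> ((\<lambda>t. (?T t x - x) /\<^sub>R t) \<longlongrightarrow> y) (at_right 0)" for x y
  proof
    assume xy: "x \<in> D \<and> A x - l *\<^sub>C x = y"
    have "((\<lambda>t. (?T t x - x) /\<^sub>R t) \<longlongrightarrow> 1 *\<^sub>C A x + (- l) *\<^sub>C x) (at_right 0)"
      unfolding split using xy by (intro tendsto_add tendsto_scaleC deriv exp0 generator_limit tendsto_const) auto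
    then show "((\<lambda>t. (?T t x - x) /\<^sub>R t) \<longlongrightarrow> y) (at_right 0)" using xy by (simp add: scaleC_minus_left)
  next
    assume lim: "((\<lambda>t. (?T t x - x) /\<^sub>R t) \<longlongrightarrow> y) (at_right 0)"
    have "((\<lambda>t. exp (l * of_real t)) \<longlongrightarrow> 1) (at_right (0::real))"
      by (auto intro!: tendsto_eq_intros)
    then have "((\<lambda>t. exp (l * of_real t) *\<^sub>C ((?T t x - x) /\<^sub>R t - ((exp (- l * of_real t) - 1) / of_real t) *\<^sub>C x))
      \<longlongrightarrow> 1 *\<^sub>C (y - (- l) *\<^sub>C x)) (at_right 0)"
      by (intro tendsto_diff tendsto_scaleC deriv lim tendsto_const)
    then have "((\<lambda>t. (S t x - x) /\<^sub>R t) \<longlongrightarrow> y + l *\<^sub>C x) (at_right 0)"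
      unfolding split by (simp add: scaleC_scaleC scaleC_minus_left flip: exp_add)
    from generatorI[OF this] show "x \<in> D \<and> A x - l *\<^sub>C x = y" by simp
  qed
qed

text \<open>The generator of the rescaled semigroup annihilates \<open>x\<close>, so integration
  shows that the rescaled orbit of \<open>x\<close> is constant.\<close>

lemma eigenvector_semigroup:
  assumes "x \<in> D" "A x = l *\<^sub>C x" "t \<ge> 0"
  shows "S t x = exp (l * of_real t) *\<^sub>C x"
proof -
  interpret T: c0_generator D "\<lambda>x. A x - l *\<^sub>C x" "\<lambda>t x. exp (- l * of_real t) *\<^sub>C S t x"
    by unfold_locales (rule rescaled_generator)
  have "T.J t 0 = 0" using linear_0[OF bounded_linear.linear[OF T.bounded_linear_J[OF assms(3)]]] .
  then have "exp (- l * of_real t) *\<^sub>C S t x = x"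
    using T.J_of_generator[of t x] assms by simp
  then have "exp (l * of_real t) *\<^sub>C exp (- l * of_real t) *\<^sub>C S t x = exp (l * of_real t) *\<^sub>C x" by simp
  then show ?thesis by (simp add: scaleC_scaleC flip: exp_add)
qed

text \<open>If there were no such eigenvector, the Fredholm alternative would invert one minus the
  rescaled operator \<open>?K\<close>. The rescaled integrated semigroup factors this difference
  through \<open>l - A\<close>, and so \<open>l - A\<close> would be boundedly invertible as
  well.\<close>

lemma spectrum_imp_eigenvalue:
  assumes "l \<in> spectrum D A" "t \<ge> 0" and K: "sequentially_compact_operator (S t)"
  shows "\<exists>x. x \<noteq> 0 \<and> S t x = exp (l * of_real t) *\<^sub>C x"
proof (rule ccontr)
  assume neg: "\<not> ?thesis"
  interpret T: c0_generator D "\<lambda>x. A x - l *\<^sub>C x" "\<lambda>t x. exp (- l * of_real t) *\<^sub>C S t x"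
    by unfold_locales (rule rescaled_generator)
  let ?K = "\<lambda>x. exp (- l * of_real t) *\<^sub>C S t x"
  have Kc: "sequentially_compact_operator ?K" using K by (rule sequentially_compact_scaleC)
  have inj: "x = 0" if "?K x = x" for x
  proof -
    have "S t x = exp (l * of_real t) *\<^sub>C ?K x" by (simp add: scaleC_scaleC flip: exp_add)
    then show ?thesis using neg that by metis
  qed
  have surj: "surj (\<lambda>x. x - ?K x)" using fredholm_injective_imp_surjective[OF Kc] inj by blast
  obtain c where c: "c > 0" "\<And>x. norm x \<le> c * norm (x - ?K x)"
    using sequentially_compact_bounded_below[OF Kc closed_UNIV subspace_UNIV] inj by blast
  interpret J: bounded_linear "T.J t" by (rule T.bounded_linear_J[OF assms(2)])
  obtain b where b: "b > 0" "\<And>x. norm (T.J t x) \<le> norm x * b" using J.pos_bounded by blast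
  have KJ: "x - ?K x = T.J t (l *\<^sub>C x - A x)" if "x \<in> D" for x
    using T.J_of_generator[OF assms(2) that] J.neg[of "A x - l *\<^sub>C x"] by simp
  have bound: "norm x \<le> c * b * norm (l *\<^sub>C x - A x)" if "x \<in> D" for x
  proof -
    have "norm x \<le> c * norm (T.J t (l *\<^sub>C x - A x))" using c(2)[of x] KJ[OF that] by simp
    also have "\<dots> \<le> c * (norm (l *\<^sub>C x - A x) * b)" using c(1) b by (intro mult_left_mono) auto
    finally show ?thesis by (simp add: mult_ac)
  qed
  have "bij_betw (\<lambda>x. l *\<^sub>C x - A x) D UNIV"
  proof (rule bij_betw_imageI)
    show "inj_on (\<lambda>x. l *\<^sub>C x - A x) D"
    proof (rule inj_onI)
      fix x y assume xy: "x \<in> D" "y \<in> D" "l *\<^sub>C x - A x = l *\<^sub>C y - A y"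
      have "l *\<^sub>C (x - y) - A (x - y) = (l *\<^sub>C x - A x) - (l *\<^sub>C y - A y)"
        using xy(1,2) by (simp add: generator_diff scaleC_diff_right)
      then have "norm (x - y) \<le> 0" using bound[of "x - y"] xy by (simp add: generator_diff)
      then show "x = y" by simp
    qed
    have "y \<in> (\<lambda>x. l *\<^sub>C x - A x) ` D" for y
    proof -
      \<comment> \<open>The rescaled \<open>J t\<close>, applied to a preimage of \<open>y\<close>
        under one minus \<open>?K\<close>, solves the resolvent equation for
        \<open>y\<close>.\<close>
      obtain z where z: "y = z - ?K z" using surjD[OF surj, of y] by auto
      show ?thesis
      proof
        show "T.J t z \<in> D" by (rule T.J_generator[OF assms(2)])
        have "A (T.J t z) - l *\<^sub>C T.J t z = ?K z - z" by (rule T.J_generator[OF assms(2)])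
        then have "- (A (T.J t z) - l *\<^sub>C T.J t z) = - (?K z - z)" by (rule arg_cong)
        then show "y = l *\<^sub>C T.J t z - A (T.J t z)" using z by (simp only: minus_diff_eq)
      qed
    qed
    then show "(\<lambda>x. l *\<^sub>C x - A x) ` D = UNIV" by auto
  qed
  then have "l \<in> resolvent_set D A" using bound unfolding resolvent_set_def by blast
  then show False using assms by (simp add: spectrum_def)
qed

text \<open>On the eigenspace of \<open>S t\<close> a resolvent operator is bounded below, so it cannot be
  quasinilpotent; its eigenvectors are eigenvectors of the generator.\<close>

lemma eigenvalue_imp_spectrum:
  assumes t: "t > 0" and K: "sequentially_compact_operator (S t)"
    and v: "S t v = m *\<^sub>C v" "v \<noteq> 0" and m: "m \<noteq> 0"
    and r: "r \<in> resolvent_set D A"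
  shows "\<exists>l\<in>spectrum D A. exp (l * of_real t) = m"
proof (rule ccontr)
  assume neg: "\<not> ?thesis"
  \<comment> \<open>The resolvent at \<open>r\<close>; it commutes with \<open>S t\<close> and hence
    preserves the eigenspace \<open>W\<close> defined below.\<close>
  define R where "R = the_inv_into D (\<lambda>x. r *\<^sub>C x - A x)"
  have bij: "bij_betw (\<lambda>x. r *\<^sub>C x - A x) D UNIV" using r by (simp add: resolvent_set_def)
  have RD: "R y \<in> D" and R: "r *\<^sub>C R y - A (R y) = y" for y
    using bij unfolding R_def bij_betw_def
    by (auto intro!: the_inv_into_into f_the_inv_into_f)
  have R_eqI: "R y = x" if "x \<in> D" "r *\<^sub>C x - A x = y" for x y
    using bij that the_inv_into_f_f[of "\<lambda>x. r *\<^sub>C x - A x" D x] unfolding R_def bij_betw_def by blast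
  obtain k where k: "\<And>x. x \<in> D \<Longrightarrow> norm x \<le> k * norm (r *\<^sub>C x - A x)"
    using r by (auto simp: resolvent_set_def)
  have Rsc: "R (c *\<^sub>C x) = c *\<^sub>C R x" for c x
  proof (rule R_eqI)
    have "r *\<^sub>C c *\<^sub>C R x - A (c *\<^sub>C R x) = c *\<^sub>C (r *\<^sub>C R x - A (R x))"
      using RD[of x] by (simp add: generator_linear scaleC_diff_right scaleC_scaleC mult.commute)
    then show "r *\<^sub>C c *\<^sub>C R x - A (c *\<^sub>C R x) = c *\<^sub>C x" by (simp only: R)
  qed (rule generator_linear(3)[OF RD RD])
  have Rc: "bounded_clinear R"
    unfolding bounded_clinear_def
  proof (intro conjI allI Rsc bounded_linear_intro[of _ k])
    show "R (x + y) = R x + R y" for x y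
      using RD[of x] RD[of y] R[of x] R[of y] by (intro R_eqI)
        (auto simp: generator_linear scaleC_add_right algebra_simps)
    show "R (a *\<^sub>R x) = a *\<^sub>R R x" for a x using Rsc[of "of_real a" x] by (simp add: scaleC_of_real)
    show "norm (R x) \<le> norm x * k" for x using k[OF RD, of x] R[of x] by (simp add: mult.commute)
  qed
  have RS: "R (S t x) = S t (R x)" for x
  proof (rule R_eqI)
    show "S t (R x) \<in> D" using t by (simp add: S_generator RD)
    show "r *\<^sub>C S t (R x) - A (S t (R x)) = S t x"
      using t RD[of x] R[of x] by (simp add: S_generator flip: S_scaleC S_diff)
  qed
  define W where "W = {x. S t x = m *\<^sub>C x}"
  interpret St: bounded_linear "S t" using t by (intro bounded_linear_S) simp
  have W: "csubspace W"
    using t by (auto simp: W_def csubspace_def subspace_def S_zero S_add S_scaleR S_scaleC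
        scaleC_add_right scaleC_scaleR scaleC_scaleC mult.commute)
  then have Ws: "subspace W" by (simp add: csubspace_def)
  have Wc: "closed W"
    unfolding W_def
    by (intro closed_Collect_eq St.continuous_on bounded_linear.continuous_on[OF bounded_linear_scaleC]
        continuous_on_id)
  let ?P = "orth_proj W"
  have Pc: "bounded_clinear ?P" by (rule bounded_clinear_orth_proj[OF Wc W])
  have PW: "?P x \<in> W" for x by (rule orth_proj_in[OF Wc Ws])
  have RW: "R x \<in> W" if "x \<in> W" for x
    using that by (simp add: W_def flip: RS) (simp add: Rsc)
  have Wsc: "c *\<^sub>C x \<in> W" if "x \<in> W" for c x using that W by (simp add: csubspace_def)
  \<comment> \<open>An eigenvector of \<open>R\<close> in \<open>W\<close> is an eigenvector of
    \<open>A\<close>. Its eigenvalue times \<open>t\<close> is a logarithm of \<open>m\<close>, so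
    \<open>neg\<close> puts that eigenvalue into the resolvent set.\<close>
  have no_eig: "x = 0" if "x \<in> W" "R (a *\<^sub>C x) = x" for a x
  proof (rule ccontr)
    assume "x \<noteq> 0"
    have xD: "x \<in> D" using RD[of "a *\<^sub>C x"] that by simp
    have "r *\<^sub>C x - A x = a *\<^sub>C x" using R[of "a *\<^sub>C x"] that by simp
    then have Ax: "A x = (r - a) *\<^sub>C x" by (simp add: scaleC_diff_left algebra_simps)
    then have "S t x = exp ((r - a) * of_real t) *\<^sub>C x" using eigenvector_semigroup[OF xD] t by simp
    then have "(exp ((r - a) * of_real t) - m) *\<^sub>C x = 0" using that(1) by (simp add: W_def scaleC_diff_left)
    then have "exp ((r - a) * of_real t) = m" using \<open>x \<noteq> 0\<close> by (simp add: scaleC_eq_0_iff)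
    then have "r - a \<in> resolvent_set D A" using neg by (auto simp: spectrum_def)
    then obtain k' where "\<And>x. x \<in> D \<Longrightarrow> norm x \<le> k' * norm ((r - a) *\<^sub>C x - A x)"
      by (auto simp: resolvent_set_def)
    from this[OF xD] Ax \<open>x \<noteq> 0\<close> show False by simp
  qed
  have "bounded_clinear (\<lambda>x. (1/m) *\<^sub>C (x - R x))"
    using Rc unfolding bounded_clinear_def
    by (auto intro!: bounded_linear_compose[OF bounded_linear_scaleC] bounded_linear_sub bounded_linear_ident
        simp: scaleC_scaleC mult.commute simp flip: scaleC_diff_right)
  from sequentially_compact_compose_left[OF K this]
  have "sequentially_compact_operator (\<lambda>x. (1/m) *\<^sub>C (S t x - R (S t x)))" .
  \<comment> \<open>On \<open>W\<close> the compact operator \<open>S t\<close> is the scalar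
    \<open>m\<close>, so there the identity minus \<open>R\<close> agrees with a compact operator,
    and the injective \<open>R\<close> is bounded below.\<close>
  moreover have onW: "(1/m) *\<^sub>C (S t x - R (S t x)) = x - R x" if "x \<in> W" for x
    using that m by (simp add: W_def Rsc scaleC_diff_right scaleC_scaleC)
  moreover have R0: "x = 0" if "R x = 0" for x using R[of x] that zero_in_D by simp
  ultimately obtain c where c: "c > 0" "\<And>x. x \<in> W \<Longrightarrow> norm x \<le> c * norm (R x)"
    using sequentially_compact_bounded_below[OF _ Wc Ws, of "\<lambda>x. (1/m) *\<^sub>C (S t x - R (S t x))"] by force
  \<comment> \<open>Chosen so that \<open>T\<close> below equals \<open>2 * c\<close> times
    \<open>R\<close> on \<open>W\<close> and at least doubles norms there. The factor
    \<open>S t\<close> makes \<open>T\<close> compact on the whole space and the projection brings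
    its range into \<open>W\<close>; the growth of \<open>(T ^^ n) v\<close> then contradicts the
    power bound.\<close>
  define q where "q = of_real (2 * c) / m"
  define T where "T x = q *\<^sub>C R (S t (?P x))" for x
  have Tcomp: "sequentially_compact_operator T"
    unfolding T_def
    by (intro sequentially_compact_scaleC sequentially_compact_compose_left[OF _ Rc]
        sequentially_compact_compose_right[OF K Pc])
  have TW: "T x = (q * m) *\<^sub>C R x" if "x \<in> W" for x
  proof -
    have "?P x = x" "S t x = m *\<^sub>C x" using that orth_proj_id[OF Wc Ws] by (auto simp: W_def)
    then show ?thesis by (simp add: T_def Rsc scaleC_scaleC)
  qed
  have "x = 0" if x: "\<zeta> *\<^sub>C T x = x" for \<zeta> x
  proof -
    have "T x \<in> W" unfolding T_def using PW RW Wsc by (simp add: RS W_def)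
    then have "x \<in> W" using Wsc x by metis
    then show ?thesis using x TW no_eig[of x "\<zeta> * q * m"] by (simp add: Rsc scaleC_scaleC mult.assoc)
  qed
  then obtain B where B: "\<And>n. norm ((T ^^ n) v) \<le> B" using power_bounded_if_no_eigenvalue[OF Tcomp] by metis
  have vW: "v \<in> W" using v by (simp add: W_def)
  have "(T ^^ n) v \<in> W \<and> norm ((T ^^ n) v) \<ge> 2 ^ n * norm v" for n
  proof (induction n)
    case (Suc n)
    let ?y = "(T ^^ n) v"
    have "T ?y \<in> W" using Suc TW RW Wsc by simp
    moreover have "norm (T ?y) = 2 * (c * norm (R ?y))"
      using Suc TW[of ?y] m c(1) by (simp add: norm_scaleC q_def norm_mult)
    then have "norm (T ?y) \<ge> 2 * (2 ^ n * norm v)" using Suc c(2)[of ?y] by linarith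
    ultimately show ?case by simp
  qed (simp add: vW)
  then have "2 ^ n * norm v \<le> B" for n using B by (meson order_trans)
  then have "2 ^ n \<le> B / norm v" for n using v by (simp add: field_simps)
  then show False by (metis not_le one_less_numeral_iff real_arch_pow semiring_norm(76))
qed

end

section \<open>The embedding into the dual of the domain of the adjoint\<close>

lemma cinner_zero_right [simp]: "cinner x (0::'a::complex_hilbert) = 0"
  using cinner_scaleC_right[of x 0 0] by simp

lemma cinner_minus_right: "cinner x (- y) = - cinner x (y::'a::complex_hilbert)"
  using cinner_scaleC_right[of x "-1" y] by (simp add: scaleC_minus1)

lemma cinner_diff_right: "cinner x (y - z) = cinner x y - cinner x (z::'a::complex_hilbert)"
  using cinner_add_right[of x y "-z"] by (simp add: cinner_minus_right)

lemma cinner_diff_left: "cinner (x - y) z = cinner x z - cinner (y::'a::complex_hilbert) z"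
  by (metis cinner_commute cinner_diff_right complex_cnj_diff)

lemma Im_cinner_left: "Im (cinner x y) = - inner (\<i> *\<^sub>C (x::'a::complex_hilbert)) y"
  unfolding Re_cinner[symmetric] by (simp add: cinner_scaleC_left)

lemma (in c0_generator) adjoint_op_eqI:
  assumes "\<And>x. x \<in> D \<Longrightarrow> cinner (A x) z = cinner x w"
  shows "adjoint_op D A z = w"
  unfolding adjoint_op_def
proof (rule the_equality)
  fix w' assume "\<forall>x\<in>D. cinner (A x) z = cinner x w'"
  then have "w' - w = 0" using assms by (intro domain_orthogonal) (simp add: cinner_diff_right)
  then show "w' = w" by simp
qed (use assms in auto)

lemma (in c0_generator) cinner_adjoint_op:
  assumes "z \<in> adjoint_dom D A" "x \<in> D"
  shows "cinner (A x) z = cinner x (adjoint_op D A z)"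
proof -
  obtain w where w: "\<And>x. x \<in> D \<Longrightarrow> cinner (A x) z = cinner x w"
    using assms by (auto simp: adjoint_dom_def)
  then show ?thesis using adjoint_op_eqI assms(2) by metis
qed

text \<open>If \<open>y\<close> is orthogonal to \<open>dom A\<^sup>*\<close>, split \<open>(0, y)\<close> along the closed graph of \<open>A\<close>: the second
  component of the part orthogonal to the graph lies in \<open>dom A\<^sup>*\<close>.\<close>

lemma (in c0_generator) adjoint_dom_orthogonal:
  assumes y: "\<And>z. z \<in> adjoint_dom D A \<Longrightarrow> cinner y z = 0"
  shows "y = 0"
proof -
  define G where "G = (\<lambda>x. (x, A x)) ` D"
  have sc: "r *\<^sub>R x \<in> D" "A (r *\<^sub>R x) = r *\<^sub>R A x" if "x \<in> D" for r x
    using generator_linear(3,4)[OF that that, of "of_real r"] by (simp_all add: scaleC_of_real)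
  have Gs: "subspace G"
    unfolding G_def subspace_def using zero_in_D generator_linear(1,2) sc
    by (auto simp: image_iff zero_prod_def)
  have Gc: "closed G"
    unfolding closed_sequential_limits
  proof (intro allI impI, elim conjE)
    fix p l assume p: "\<forall>n. p n \<in> G" and l: "p \<longlonglongrightarrow> l"
    have pD: "fst (p n) \<in> D" "A (fst (p n)) = snd (p n)" for n
      using p[rule_format, of n] by (auto simp: G_def)
    have "fst l \<in> D" "A (fst l) = snd l"
      using generator_closed[of "\<lambda>n. fst (p n)" "fst l" "snd l"] pD tendsto_fst[OF l] tendsto_snd[OF l] by auto
    then show "l \<in> G" unfolding G_def by (intro image_eqI[of _ _ "fst l"]) auto
  qed
  define p where "p = orth_proj G (0, y)"
  obtain a b where ab: "(0, y) - p = (a, b)" by fastforce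
  have pG: "p \<in> G" unfolding p_def by (rule orth_proj_in[OF Gc Gs])
  have orth: "inner (a, b) q = 0" if "q \<in> G" for q
    using orth_proj_orth[OF Gc Gs that, of "(0, y)"] ab by (simp add: p_def)
  have real: "inner (A x) b = - inner x a" if "x \<in> D" for x
    using orth[of "(x, A x)"] that by (auto simp: G_def inner_commute)
  \<comment> \<open>Orthogonality to the graph is available for the real inner product; replacing
    \<open>x\<close> by \<open>\<i> *\<^sub>C x\<close> supplies the imaginary part.\<close>
  have "cinner (A x) b = cinner x (- a)" if "x \<in> D" for x
    using real[OF that] real[OF generator_linear(3)[OF that that], of \<i>] generator_linear(4)[OF that that]
    by (simp add: complex_eq_iff Re_cinner Im_cinner_left cinner_minus_right)
  then have "b \<in> adjoint_dom D A" by (auto simp: adjoint_dom_def)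
  then have "inner y b = 0" using y[of b] by (metis Re_cinner zero_complex.simps(1))
  moreover have "inner (a, b) (a, b) = inner (a, b) ((0, y) - p)" by (simp only: ab)
  then have "inner (a, b) (a, b) = inner b y" using orth[OF pG] by (simp add: inner_diff_right)
  ultimately have "(a, b) = 0" by (metis inner_commute inner_eq_zero_iff)
  then have "(0, y) \<in> G" using ab pG by simp
  then show ?thesis using zero_in_D by (auto simp: G_def)
qed

locale dual_extension = c0_generator D A S
  for D :: "'h::complex_hilbert set" and A S +
  fixes pair :: "'v::complex_hilbert \<Rightarrow> 'h \<Rightarrow> complex" and emb :: "'h \<Rightarrow> 'v"
  assumes dual: "is_dual_of pair (adjoint_dom D A) (adjoint_graph_norm D A)"
    and emb_def: "emb = dual_embedding (adjoint_dom D A) pair"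
begin

abbreviation "W \<equiv> adjoint_dom D A"

lemma pair_eqI:
  assumes "\<And>z. z \<in> W \<Longrightarrow> pair v z = pair w z"
  shows "v = w"
proof -
  have "bounded_antifunctional W (adjoint_graph_norm D A) (pair w)"
    using dual by (simp add: is_dual_of_def)
  then have "\<exists>!v. \<forall>z\<in>W. pair v z = pair w z" using dual by (simp add: is_dual_of_def)
  then show ?thesis using assms by blast
qed

lemma pair_add: "z \<in> W \<Longrightarrow> pair (v + w) z = pair v z + pair w z"
  and pair_scaleC: "z \<in> W \<Longrightarrow> pair (c *\<^sub>C v) z = c * pair v z"
  using dual by (simp_all add: is_dual_of_def)

text \<open>The graph norm dominates the norm of \<open>H\<close>, so \<open>cinner x\<close> is a
  bounded functional and the description behind \<open>emb\<close> denotes.\<close>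

lemma pair_emb: assumes "z \<in> W" shows "pair (emb x) z = cinner x z"
proof -
  have "norm w \<le> adjoint_graph_norm D A w" for w by (simp add: adjoint_graph_norm_def real_le_rsqrt)
  then have "cmod (cinner x w) \<le> norm x * adjoint_graph_norm D A w" for w
    by (meson mult_left_mono norm_cinner_le norm_ge_zero order_trans)
  then have "bounded_antifunctional W (adjoint_graph_norm D A) (cinner x)"
    by (auto simp: bounded_antifunctional_def cinner_add_right cinner_scaleC_right)
  then have "\<exists>!v. \<forall>z\<in>W. pair v z = cinner x z" using dual by (simp add: is_dual_of_def)
  then have "\<forall>z\<in>W. pair (emb x) z = cinner x z"
    unfolding emb_def dual_embedding_def by (rule theI')
  then show ?thesis using assms by blast
qed

lemma emb_add: "emb (x + y) = emb x + emb y"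
  by (rule pair_eqI) (simp add: pair_emb pair_add cinner_add_left)

lemma emb_scaleC: "emb (c *\<^sub>C x) = c *\<^sub>C emb x"
  by (rule pair_eqI) (simp add: pair_emb pair_scaleC cinner_scaleC_left)

text \<open>Equivalent to density of the domain of the adjoint, which the graph argument has
  supplied.\<close>

lemma emb_inject: "emb x = emb y \<longleftrightarrow> x = y"
proof
  assume "emb x = emb y"
  then have "cinner (x - y) z = 0" if "z \<in> W" for z
    using pair_emb[OF that, of x] pair_emb[OF that, of y] by (simp add: cinner_diff_left)
  then show "x = y" using adjoint_dom_orthogonal[of "x - y"] by simp
qed simp

lemma norm_emb_le: "norm (emb x) \<le> norm x"
proof -
  have "norm (emb x) = (SUP z\<in>{z\<in>W. adjoint_graph_norm D A z \<le> 1}. cmod (pair (emb x) z))"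
    using dual by (simp add: is_dual_of_def)
  also have "\<dots> \<le> norm x"
  proof (rule cSUP_least)
    have "0 \<in> W" by (auto simp: adjoint_dom_def intro: exI[of _ 0])
    moreover have "adjoint_op D A 0 = 0" by (rule adjoint_op_eqI) simp
    ultimately show "{z\<in>W. adjoint_graph_norm D A z \<le> 1} \<noteq> {}"
      by (auto simp: adjoint_graph_norm_def intro!: exI[of _ 0])
    fix z assume z: "z \<in> {z\<in>W. adjoint_graph_norm D A z \<le> 1}"
    have "norm z \<le> adjoint_graph_norm D A z" by (simp add: adjoint_graph_norm_def real_le_rsqrt)
    then have "norm x * norm z \<le> norm x * 1" using z by (intro mult_left_mono) auto
    then show "cmod (pair (emb x) z) \<le> norm x"
      using z norm_cinner_le[of x z] by (simp add: pair_emb)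
  qed
  finally show ?thesis .
qed

lemma bounded_clinear_emb: "bounded_clinear emb"
  unfolding bounded_clinear_def
  by (intro conjI allI emb_scaleC bounded_linear_intro[of _ 1])
    (simp_all add: emb_add norm_emb_le scaleR_scaleC emb_scaleC)

lemma bounded_linear_emb: "bounded_linear emb"
  using bounded_clinear_emb by (rule bounded_clinear_bl)

text \<open>Injectivity of \<open>emb\<close> pins down the witness in the description; the adjoint
  identity then computes its value.\<close>

lemma extended_op_emb: assumes "x \<in> D" shows "extended_op D A pair (emb x) = emb (A x)"
  unfolding extended_op_def emb_def[symmetric]
proof (rule the_equality)
  show "\<exists>x'. emb x = emb x' \<and> (\<forall>z\<in>W. pair (emb (A x)) z = cinner x' (adjoint_op D A z))"
    using assms by (auto simp: pair_emb cinner_adjoint_op)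
  fix w assume "\<exists>x'. emb x = emb x' \<and> (\<forall>z\<in>W. pair w z = cinner x' (adjoint_op D A z))"
  then have "\<forall>z\<in>W. pair w z = cinner x (adjoint_op D A z)" by (auto simp: emb_inject)
  then show "w = emb (A x)" using assms by (intro pair_eqI) (simp add: pair_emb cinner_adjoint_op)
qed

end

section \<open>Compatibility of the two semigroups\<close>

lemma (in c0_semigroup) norm_J_le:
  assumes "t \<ge> 0" "\<And>s. 0 \<le> s \<Longrightarrow> s \<le> t \<Longrightarrow> norm (S s x) \<le> b"
  shows "norm (J t x) \<le> b * t"
proof -
  have "norm (integral {0..t} (\<lambda>s. S s x)) \<le> b * (t - 0)"
    by (rule integral_bound) (auto intro: continuous_on_subset[OF continuous_on_S] assms)
  then show ?thesis by (simp add: J_def)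
qed

locale extended_semigroup = dual_extension D A S pair emb
  for D :: "'h::complex_hilbert set" and A S and pair :: "'v::complex_hilbert \<Rightarrow> 'h \<Rightarrow> complex" and emb +
  fixes SV :: "real \<Rightarrow> 'v \<Rightarrow> 'v"
  assumes genV: "generates_C0_semigroup (range emb) (extended_op D A pair) SV"

sublocale extended_semigroup \<subseteq> V: c0_generator "range emb" "extended_op D A pair" SV
  using genV by unfold_locales

context extended_semigroup
begin

text \<open>Both averages over a shrinking window tend to \<open>emb z\<close>, so their difference
  is small even before the semigroups are known to agree. Here \<open>a q\<close> is the left end
  and \<open>d q\<close> the length of the interval between \<open>q\<close> and \<open>r\<close>,
  so the base point moves with \<open>q\<close>; a bound of \<open>F\<close> that is linear in
  \<open>z\<close> covers this motion.\<close>

lemma averages_difference_small: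
  assumes r: "r \<ge> 0"
  defines "d \<equiv> \<lambda>q. \<bar>q - r\<bar>" and "a \<equiv> \<lambda>q. min q r"
  shows "((\<lambda>q. (V.J (d q) (emb (S (a q) y)) - emb (J (d q) (S (a q) y))) /\<^sub>R d q) \<longlongrightarrow> 0) (at r within {0..})"
proof -
  interpret e: bounded_linear emb by (rule bounded_linear_emb)
  define F where "F \<delta> z = V.J \<delta> (emb z) - emb (J \<delta> z)" for \<delta> z
  have Fdiff: "F \<delta> (x - z) = F \<delta> x - F \<delta> z" if "\<delta> \<ge> 0" for \<delta> x z
  proof -
    interpret J: bounded_linear "J \<delta>" by (rule bounded_linear_J[OF that])
    interpret VJ: bounded_linear "V.J \<delta>" by (rule V.bounded_linear_J[OF that])
    show ?thesis by (simp add: F_def e.diff J.diff VJ.diff)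
  qed
  obtain M where M: "M \<ge> 1" "\<And>s x. 0 \<le> s \<Longrightarrow> s \<le> 1 \<Longrightarrow> norm (S s x) \<le> M * norm x"
    using S_locally_bounded[of 1] by blast
  obtain MV where MV: "MV \<ge> 1" "\<And>s x. 0 \<le> s \<Longrightarrow> s \<le> 1 \<Longrightarrow> norm (SV s x) \<le> MV * norm x"
    using V.S_locally_bounded[of 1] by blast
  have Fb: "norm (F \<delta> z) \<le> (MV + M) * norm z * \<delta>" if "0 \<le> \<delta>" "\<delta> \<le> 1" for \<delta> z
  proof -
    have "norm (V.J \<delta> (emb z)) \<le> (MV * norm (emb z)) * \<delta>"
      using that by (intro V.norm_J_le MV) auto
    also have "\<dots> \<le> (MV * norm z) * \<delta>"
      using that MV(1) norm_emb_le[of z] by (intro mult_right_mono mult_left_mono) auto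
    finally have "norm (V.J \<delta> (emb z)) \<le> (MV * norm z) * \<delta>" .
    moreover have "norm (J \<delta> z) \<le> (M * norm z) * \<delta>"
      using that by (intro norm_J_le M) auto
    then have "norm (emb (J \<delta> z)) \<le> (M * norm z) * \<delta>"
      using norm_emb_le[of "J \<delta> z"] by linarith
    ultimately show ?thesis unfolding F_def
      using norm_triangle_ineq4[of "V.J \<delta> (emb z)" "emb (J \<delta> z)"] by (simp add: algebra_simps)
  qed
  have d0: "(d \<longlongrightarrow> 0) (at r within {0..})"
    unfolding d_def by (auto intro!: tendsto_eq_intros)
  have "\<forall>\<^sub>F q in at r within {0..}. q \<noteq> r" by (simp add: eventually_at_filter)
  then have "\<forall>\<^sub>F q in at r within {0..}. 0 < d q"
    by eventually_elim (simp add: d_def)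
  moreover have "\<forall>\<^sub>F q in at r within {0..}. d q < 1" by (rule order_tendstoD[OF d0]) simp
  ultimately have ev: "\<forall>\<^sub>F q in at r within {0..}. 0 < d q \<and> d q < 1" by eventually_elim simp
  have dlim: "filterlim d (at_right 0) (at r within {0..})"
    using d0 ev by (intro filterlim_at_withinI) (auto elim: eventually_mono)
  have "((\<lambda>\<delta>. V.J \<delta> (emb (S r y)) /\<^sub>R \<delta> - emb (J \<delta> (S r y) /\<^sub>R \<delta>)) \<longlongrightarrow> emb (S r y) - emb (S r y)) (at_right 0)"
    by (intro tendsto_diff e.tendsto V.domain_dense domain_dense)
  then have "((\<lambda>\<delta>. F \<delta> (S r y) /\<^sub>R \<delta>) \<longlongrightarrow> 0) (at_right 0)"
    by (simp add: F_def e.scaleR scaleR_diff_right)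
  from filterlim_compose[OF this dlim]
  have l1: "((\<lambda>q. F (d q) (S r y) /\<^sub>R d q) \<longlongrightarrow> 0) (at r within {0..})" .
  have "(a \<longlongrightarrow> min r r) (at r within {0..})" unfolding a_def by (intro tendsto_intros)
  moreover have "\<forall>\<^sub>F q in at r within {0..}. 0 \<le> a q"
    using r by (auto simp: eventually_at_filter a_def)
  ultimately have "((\<lambda>q. S (a q) y) \<longlongrightarrow> S r y) (at r within {0..})"
    using r by (intro tendsto_S tendsto_const) auto
  then have l2: "((\<lambda>q. (MV + M) * norm (S (a q) y - S r y)) \<longlongrightarrow> 0) (at r within {0..})"
    by (intro tendsto_mult_right_zero tendsto_norm_zero LIM_zero)
  have "((\<lambda>q. F (d q) (S (a q) y - S r y) /\<^sub>R d q) \<longlongrightarrow> 0) (at r within {0..})"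
  proof (rule Lim_null_comparison[OF _ l2])
    show "\<forall>\<^sub>F q in at r within {0..}. norm (F (d q) (S (a q) y - S r y) /\<^sub>R d q)
      \<le> (MV + M) * norm (S (a q) y - S r y)"
      using ev
    proof eventually_elim
      case (elim q)
      then show ?case using Fb[of "d q" "S (a q) y - S r y"] by (simp add: field_simps)
    qed
  qed
  from tendsto_add[OF l1 this]
  have "((\<lambda>q. F (d q) (S r y) /\<^sub>R d q + F (d q) (S (a q) y - S r y) /\<^sub>R d q) \<longlongrightarrow> 0) (at r within {0..})"
    by simp
  moreover have "\<forall>\<^sub>F q in at r within {0..}.
    F (d q) (S r y) /\<^sub>R d q + F (d q) (S (a q) y - S r y) /\<^sub>R d q = F (d q) (S (a q) y) /\<^sub>R d q"
    using ev by eventually_elim (simp add: Fdiff scaleR_diff_right)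
  ultimately show ?thesis unfolding F_def by (rule Lim_transform_eventually)
qed

text \<open>For \<open>x\<close> in the domain, \<open>s \<mapsto> SV (t - s) (emb (S s x))\<close> has derivative zero on \<open>[0, t]\<close>.\<close>

lemma SV_emb_domain:
  assumes x: "x \<in> D" and t: "t \<ge> 0"
  shows "SV t (emb x) = emb (S t x)"
proof -
  interpret e: bounded_linear emb by (rule bounded_linear_emb)
  define g where "g s = SV (t - s) (emb (S s x))" for s
  define F where "F \<delta> z = V.J \<delta> (emb z) - emb (J \<delta> z)" for \<delta> z
  obtain MV where MV: "MV \<ge> 1" "\<And>s x. 0 \<le> s \<Longrightarrow> s \<le> t \<Longrightarrow> norm (SV s x) \<le> MV * norm x"
    using V.S_locally_bounded[of t] by blast
  \<comment> \<open>In both spaces the integrated semigroup maps the generator to the increment of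
    the orbit. Subtraction cancels the starting point and leaves the mismatch \<open>F\<close> of
    the two integrals.\<close>
  have step: "SV \<delta> (emb (S b x)) - emb (S (\<delta> + b) x) = F \<delta> (S b (A x))" if "b \<ge> 0" "\<delta> \<ge> 0" for b \<delta>
  proof -
    have Sb: "S b x \<in> D" "A (S b x) = S b (A x)" using S_generator[OF x that(1)] .
    have "V.J \<delta> (emb (S b (A x))) = SV \<delta> (emb (S b x)) - emb (S b x)"
      using V.J_of_generator[OF that(2), of "emb (S b x)"] extended_op_emb[OF Sb(1)] Sb(2) by simp
    moreover have "J \<delta> (S b (A x)) = S (\<delta> + b) x - S b x"
      using J_of_generator[OF that(2) Sb(1)] Sb(2) that by (simp add: S_plus)
    ultimately show ?thesis by (simp add: F_def e.diff)
  qed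
  \<comment> \<open>The increment of \<open>g\<close> is one such mismatch moved by a bounded
    operator, hence of smaller order than the length of the interval.\<close>
  have bound: "norm (g q - g r) \<le> MV * norm (F (q - r) (S r (A x)))"
    if "0 \<le> r" "r \<le> q" "q \<le> t" for r q
  proof -
    have "SV (t - r) (emb (S r x)) = SV (t - q) (SV (q - r) (emb (S r x)))"
      using V.S_plus[of "t - q" "q - r"] that by simp
    then have "g r - g q = SV (t - q) (SV (q - r) (emb (S r x)) - emb (S (q - r + r) x))"
      using that unfolding g_def by (simp add: V.S_diff)
    also have "\<dots> = SV (t - q) (F (q - r) (S r (A x)))" using that by (subst step) auto
    finally show ?thesis using MV(2)[of "t - q" "F (q - r) (S r (A x))"] that
      by (subst norm_minus_commute) simp
  qed
  have "(g has_derivative (\<lambda>h. 0)) (at r within {0..t})" if r: "r \<in> {0..t}" for r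
    unfolding has_derivative_iff_norm
  proof
    have "((\<lambda>q. F \<bar>q - r\<bar> (S (min q r) (A x)) /\<^sub>R \<bar>q - r\<bar>) \<longlongrightarrow> 0) (at r within {0..t})"
      unfolding F_def using averages_difference_small[of r "A x"] r
      by (intro tendsto_within_subset[where S = "{0..}" and T = "{0..t}"]) auto
    then have lim: "((\<lambda>q. MV * norm (F \<bar>q - r\<bar> (S (min q r) (A x)) /\<^sub>R \<bar>q - r\<bar>)) \<longlongrightarrow> 0) (at r within {0..t})"
      by (intro tendsto_mult_right_zero tendsto_norm_zero)
    show "((\<lambda>q. norm (g q - g r - 0) / norm (q - r)) \<longlongrightarrow> 0) (at r within {0..t})"
    proof (rule Lim_null_comparison[OF _ lim])
      show "\<forall>\<^sub>F q in at r within {0..t}. norm (norm (g q - g r - 0) / norm (q - r))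
        \<le> MV * norm (F \<bar>q - r\<bar> (S (min q r) (A x)) /\<^sub>R \<bar>q - r\<bar>)"
        unfolding eventually_at_filter
      proof (intro always_eventually allI impI)
        fix q assume q: "q \<noteq> r" "q \<in> {0..t}"
        have "norm (g q - g r) \<le> MV * norm (F \<bar>q - r\<bar> (S (min q r) (A x)))"
          using bound[of r q] bound[of q r] q r by (cases "q \<le> r") (auto simp: norm_minus_commute)
        then show "norm (norm (g q - g r - 0) / norm (q - r))
            \<le> MV * norm (F \<bar>q - r\<bar> (S (min q r) (A x)) /\<^sub>R \<bar>q - r\<bar>)"
          using q by (simp add: field_simps)
      qed
    qed
  qed simp
  then obtain c where "\<And>s. s \<in> {0..t} \<Longrightarrow> g s = c"
    using has_derivative_zero_constant[of "{0..t}" g] by auto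
  then have "g 0 = g t" using t by simp
  then show ?thesis using t by (simp add: g_def)
qed

lemma SV_emb:
  assumes t: "t \<ge> 0"
  shows "SV t (emb x) = emb (S t x)"
proof (rule tendsto_unique)
  let ?x = "\<lambda>h. J h x /\<^sub>R h"
  note e = bounded_linear.tendsto[OF bounded_linear_emb]
  show "((\<lambda>h. SV t (emb (?x h))) \<longlongrightarrow> SV t (emb x)) (at_right 0)"
    by (rule bounded_linear.tendsto[OF V.bounded_linear_S[OF t] e[OF domain_dense(1)]])
  have "((\<lambda>h. emb (S t (?x h))) \<longlongrightarrow> emb (S t x)) (at_right 0)"
    by (rule e[OF bounded_linear.tendsto[OF bounded_linear_S[OF t] domain_dense(1)]])
  moreover have "\<forall>\<^sub>F h in at_right 0. emb (S t (?x h)) = SV t (emb (?x h))"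
    using domain_dense(2)[of x] by eventually_elim (simp only: SV_emb_domain[OF _ t])
  ultimately show "((\<lambda>h. SV t (emb (?x h))) \<longlongrightarrow> emb (S t x)) (at_right 0)"
    by (rule Lim_transform_eventually)
qed simp

end

section \<open>Strong measurability and the strong integral\<close>

text \<open>Completeness absorbs the exceptional null set, which arises because strong measurability
  asks for limits almost everywhere.\<close>

lemma (in complete_measure) borel_measurable_cong_AE:
  fixes f g :: "'a \<Rightarrow> 'b::topological_space"
  assumes f: "f \<in> borel_measurable M" and ae: "AE x in M. f x = g x"
  shows "g \<in> borel_measurable M"
proof (rule measurableI)
  fix A :: "'b set" assume A: "A \<in> sets borel"
  show "g -` A \<inter> space M \<in> sets M"
  proof (rule in_sets_AE)
    show "f -` A \<inter> space M \<in> sets M" using f A by (rule measurable_sets)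
    show "AE x in M. (x \<in> f -` A \<inter> space M) = (x \<in> g -` A \<inter> space M)"
      using ae by eventually_elim simp
  qed simp
qed simp

lemma strongly_measurable_simple: "simple_function M f \<Longrightarrow> strongly_measurable M f"
  unfolding strongly_measurable_def by (intro exI[of _ "\<lambda>_. f"]) auto

lemma strongly_measurable_cong_AE:
  assumes "strongly_measurable M f" "AE x in M. f x = g x"
  shows "strongly_measurable M g"
proof -
  obtain s where s: "\<And>i. simple_function M (s i)" "AE x in M. (\<lambda>i. s i x) \<longlonglongrightarrow> f x"
    using assms(1) by (auto simp: strongly_measurable_def)
  have "AE x in M. (\<lambda>i. s i x) \<longlonglongrightarrow> g x" using s(2) assms(2) by eventually_elim simp
  then show ?thesis using s(1) by (auto simp: strongly_measurable_def)
qed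

lemma strongly_measurable_compose2:
  assumes f: "strongly_measurable M f" and g: "strongly_measurable M g"
    and h: "\<And>x y. isCont (\<lambda>p. h (fst p) (snd p)) (x, y)"
  shows "strongly_measurable M (\<lambda>x. h (f x) (g x))"
proof -
  obtain s where s: "\<And>i. simple_function M (s i)" "AE x in M. (\<lambda>i. s i x) \<longlonglongrightarrow> f x"
    using f by (auto simp: strongly_measurable_def)
  obtain r where r: "\<And>i. simple_function M (r i)" "AE x in M. (\<lambda>i. r i x) \<longlonglongrightarrow> g x"
    using g by (auto simp: strongly_measurable_def)
  have "AE x in M. (\<lambda>i. h (s i x) (r i x)) \<longlonglongrightarrow> h (f x) (g x)"
    using s(2) r(2)
  proof eventually_elim
    case (elim x)
    from isCont_tendsto_compose[OF h tendsto_Pair[OF elim]] show ?case by simp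
  qed
  then show ?thesis unfolding strongly_measurable_def
    using simple_function_compose2[OF s(1) r(1)] by (intro exI[of _ "\<lambda>i x. h (s i x) (r i x)"]) auto
qed

lemma strongly_measurable_compose1:
  assumes "strongly_measurable M f" "\<And>x. isCont h x"
  shows "strongly_measurable M (\<lambda>x. h (f x))"
  using strongly_measurable_compose2[OF assms(1,1), of "\<lambda>x _. h x"]
  by (simp add: isCont_o2[OF isCont_fst[OF continuous_ident]] assms(2))

lemma strongly_measurable_add:
  "strongly_measurable M f \<Longrightarrow> strongly_measurable M g \<Longrightarrow> strongly_measurable M (\<lambda>x. f x + g x)"
  by (rule strongly_measurable_compose2) (auto intro!: continuous_intros)

lemma strongly_measurable_diff:
  "strongly_measurable M f \<Longrightarrow> strongly_measurable M g \<Longrightarrow> strongly_measurable M (\<lambda>x. f x - g x)"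
  by (rule strongly_measurable_compose2) (auto intro!: continuous_intros)

lemma strongly_measurable_bounded_linear:
  "strongly_measurable M f \<Longrightarrow> bounded_linear h \<Longrightarrow> strongly_measurable M (\<lambda>x. h (f x))"
  by (rule strongly_measurable_compose1) (auto intro: linear_continuous_at)

lemma (in complete_measure) strongly_measurable_imp_borel:
  fixes h :: "'b::real_normed_vector \<Rightarrow> real"
  assumes f: "strongly_measurable M f" and h: "\<And>x. isCont h x"
  shows "(\<lambda>x. h (f x)) \<in> borel_measurable M"
proof -
  obtain s where s: "\<And>i. simple_function M (s i)" "AE x in M. (\<lambda>i. s i x) \<longlonglongrightarrow> f x"
    using f by (auto simp: strongly_measurable_def)
  have m: "(\<lambda>x. h (s i x)) \<in> borel_measurable M" for i
    by (rule borel_measurable_simple_function[OF simple_function_compose1[OF s(1)]])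
  show ?thesis
  proof (rule borel_measurable_cong_AE)
    show "(\<lambda>x. lim (\<lambda>i. h (s i x))) \<in> borel_measurable M"
      by (rule borel_measurable_lim_metric) (rule m)
    show "AE x in M. lim (\<lambda>i. h (s i x)) = h (f x)"
      using s(2)
    proof eventually_elim
      case (elim x)
      show ?case by (rule limI[OF isCont_tendsto_compose[OF h elim]])
    qed
  qed
qed

text \<open>Pointwise approximating simple functions need not converge in the mean. Replacing them
  by 0 where they exceed twice the norm of \<open>f\<close> keeps the limit and gives the errors the
  majorant \<open>3 * norm (f x)\<close>.\<close>

lemma (in complete_measure) strongly_measurable_approx:
  fixes f :: "'a \<Rightarrow> 'b::real_normed_vector"
  assumes f: "strongly_measurable M f" and int: "integrable M (\<lambda>x. norm (f x))"
  shows "\<exists>s. (\<forall>i. Bochner_Integration.simple_bochner_integrable M (s i)) \<and>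
    (\<lambda>i. \<integral>\<^sup>+x. ennreal (norm (f x - s i x)) \<partial>M) \<longlonglongrightarrow> 0"
proof -
  obtain s where s: "\<And>i. simple_function M (s i)" "AE x in M. (\<lambda>i. s i x) \<longlonglongrightarrow> f x"
    using f by (auto simp: strongly_measurable_def)
  define r where "r i x = (if norm (s i x) \<le> 2 * norm (f x) then s i x else 0)" for i x
  have nf [measurable]: "(\<lambda>x. norm (f x)) \<in> borel_measurable M" using int by simp
  have ns [measurable]: "(\<lambda>x. norm (s i x)) \<in> borel_measurable M" for i
    by (rule borel_measurable_simple_function[OF simple_function_compose1[OF s(1)]])
  have r: "simple_function M (r i)" for i
    unfolding r_def by (intro simple_function_If s) auto
  have rb: "norm (r i x) \<le> 2 * norm (f x)" for i x by (simp add: r_def)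
  have rl: "AE x in M. (\<lambda>i. r i x) \<longlonglongrightarrow> f x"
    using s(2)
  proof eventually_elim
    case (elim x)
    show ?case
    proof (cases "f x = 0")
      case True
      then have "r i x = 0" for i by (simp add: r_def)
      then show ?thesis using True by simp
    next
      case False
      then have "\<forall>\<^sub>F i in sequentially. norm (s i x) < 2 * norm (f x)"
        by (intro order_tendstoD[OF tendsto_norm[OF elim]]) simp
      then have "\<forall>\<^sub>F i in sequentially. s i x = r i x" by eventually_elim (simp add: r_def)
      then show ?thesis by (rule Lim_transform_eventually[OF elim])
    qed
  qed
  have "Bochner_Integration.simple_bochner_integrable M (r i)" for i
  proof (rule Bochner_Integration.simple_bochner_integrableI_bounded[OF r])
    have "(\<integral>\<^sup>+x. norm (r i x) \<partial>M) \<le> (\<integral>\<^sup>+x. 2 * norm (f x) \<partial>M)"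
      by (intro nn_integral_mono ennreal_leI rb)
    also have "\<dots> < \<infinity>" using int by (simp add: nn_integral_eq_integral)
    finally show "(\<integral>\<^sup>+x. norm (r i x) \<partial>M) < \<infinity>" .
  qed
  moreover have m: "(\<lambda>x. norm (f x - r i x)) \<in> borel_measurable M" for i
    by (intro strongly_measurable_imp_borel[where h = norm] strongly_measurable_diff f
        strongly_measurable_simple r) (auto intro!: continuous_intros)
  have b3: "norm (f x - r i x) \<le> 3 * norm (f x)" for i x
    using rb[of i x] norm_triangle_ineq4[of "f x" "r i x"] by linarith
  have wi: "integrable M (\<lambda>x. norm (f x - r i x))" for i
    by (rule Bochner_Integration.integrable_bound[of M "\<lambda>x. 3 * norm (f x)"]) (use int m b3 in auto)
  have "(\<lambda>i. \<integral>x. norm (f x - r i x) \<partial>M) \<longlonglongrightarrow> (\<integral>x. 0 \<partial>M)"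
  proof (rule integral_dominated_convergence[where w = "\<lambda>x. 3 * norm (f x)"])
    show "AE x in M. (\<lambda>i. norm (f x - r i x)) \<longlonglongrightarrow> 0"
      using rl
    proof eventually_elim
      case (elim x)
      have "(\<lambda>i. f x - r i x) \<longlonglongrightarrow> f x - f x" by (intro tendsto_intros elim)
      then show ?case by (intro tendsto_norm_zero) simp
    qed
  qed (use int m b3 in auto)
  then have "(\<lambda>i. ennreal (\<integral>x. norm (f x - r i x) \<partial>M)) \<longlonglongrightarrow> ennreal 0"
    by (intro tendsto_ennrealI) simp
  then have "(\<lambda>i. \<integral>\<^sup>+x. ennreal (norm (f x - r i x)) \<partial>M) \<longlonglongrightarrow> 0"
    by (simp add: nn_integral_eq_integral[OF wi])
  ultimately show ?thesis by blast
qed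

text \<open>The device by which strong integrals are computed: real functionals turn them into
  ordinary integrals, so identities of vectors reduce to scalar ones.\<close>

lemma (in complete_measure) has_strong_integral_bounded_linear:
  fixes h :: "'b::real_normed_vector \<Rightarrow> real"
  assumes f: "has_strong_integral M f I" and h: "bounded_linear h"
  shows "has_bochner_integral M (\<lambda>x. h (f x)) (h I)"
proof -
  interpret h: bounded_linear h by (rule h)
  obtain s where s: "\<And>i. Bochner_Integration.simple_bochner_integrable M (s i)"
    "(\<lambda>i. \<integral>\<^sup>+x. ennreal (norm (f x - s i x)) \<partial>M) \<longlonglongrightarrow> 0"
    "(\<lambda>i. Bochner_Integration.simple_bochner_integral M (s i)) \<longlonglongrightarrow> I"
    using f by (auto simp: has_strong_integral_def)
  obtain K where K: "\<And>x. norm (h x) \<le> norm x * K" "K \<ge> 0"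
    using h.nonneg_bounded by blast
  show ?thesis
  proof (rule has_bochner_integral.intros)
    show "(\<lambda>x. h (f x)) \<in> borel_measurable M"
      using f by (intro strongly_measurable_imp_borel) (auto simp: has_strong_integral_def h.isCont)
    show si: "Bochner_Integration.simple_bochner_integrable M (\<lambda>x. h (s i x))" for i
      using Bochner_Integration.simple_bochner_integrable_compose2[of "\<lambda>x _. h x" M "s i" "s i"] s(1)
      by (simp add: h.zero)
    have "(\<lambda>i. ennreal K * (\<integral>\<^sup>+x. ennreal (norm (f x - s i x)) \<partial>M)) \<longlonglongrightarrow> ennreal K * 0"
      by (intro ennreal_tendsto_cmult s) simp
    then have lim: "(\<lambda>i. ennreal K * (\<integral>\<^sup>+x. ennreal (norm (f x - s i x)) \<partial>M)) \<longlonglongrightarrow> 0" by simp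
    show "(\<lambda>i. \<integral>\<^sup>+x. ennreal (norm (h (f x) - h (s i x))) \<partial>M) \<longlonglongrightarrow> 0"
    proof (rule tendsto_sandwich[OF _ _ tendsto_const lim])
      have "strongly_measurable M f" using f by (simp add: has_strong_integral_def)
      moreover have "strongly_measurable M (s i)" for i
        using s(1)[of i] by (auto intro: strongly_measurable_simple
            elim: Bochner_Integration.simple_bochner_integrable.cases)
      ultimately have "(\<lambda>x. norm (f x - s i x)) \<in> borel_measurable M" for i
        by (intro strongly_measurable_imp_borel[where h = norm] strongly_measurable_diff)
          (auto intro!: continuous_intros)
      then have "(\<integral>\<^sup>+x. ennreal (norm (h (f x) - h (s i x))) \<partial>M)
        \<le> ennreal K * (\<integral>\<^sup>+x. ennreal (norm (f x - s i x)) \<partial>M)" for i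
        using K by (subst nn_integral_cmult[symmetric])
          (auto intro!: nn_integral_mono simp: mult.commute simp flip: ennreal_mult h.diff)
      then show "\<forall>\<^sub>F i in sequentially. (\<integral>\<^sup>+x. ennreal (norm (h (f x) - h (s i x))) \<partial>M)
        \<le> ennreal K * (\<integral>\<^sup>+x. ennreal (norm (f x - s i x)) \<partial>M)" by simp
    qed simp
    have "Bochner_Integration.simple_bochner_integral M (\<lambda>x. h (s i x))
      = h (Bochner_Integration.simple_bochner_integral M (s i))" for i
      by (rule Bochner_Integration.simple_bochner_integral_linear[OF h.linear s(1)])
    then show "(\<lambda>i. Bochner_Integration.simple_bochner_integral M (\<lambda>x. h (s i x))) \<longlonglongrightarrow> h I"
      using h.tendsto[OF s(3)] by simp
  qed
qed

text \<open>The integrals of two approximants differ by at most the sum of their errors in the mean,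
  hence form a Cauchy sequence.\<close>

lemma (in complete_measure) has_strong_integral_exists:
  fixes f :: "'a \<Rightarrow> 'b::banach"
  assumes f: "strongly_measurable M f" and int: "integrable M (\<lambda>x. norm (f x))"
  shows "\<exists>I. has_strong_integral M f I"
proof -
  obtain s where s: "\<And>i. Bochner_Integration.simple_bochner_integrable M (s i)"
    "(\<lambda>i. \<integral>\<^sup>+x. ennreal (norm (f x - s i x)) \<partial>M) \<longlonglongrightarrow> 0"
    using strongly_measurable_approx[OF assms] by blast
  let ?I = "\<lambda>i. Bochner_Integration.simple_bochner_integral M (s i)"
  have "strongly_measurable M (s i)" for i
    using s(1)[of i] by (auto intro: strongly_measurable_simple
        elim: Bochner_Integration.simple_bochner_integrable.cases)
  then have m [measurable]: "(\<lambda>x. norm (f x - s i x)) \<in> borel_measurable M" for i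
    by (intro strongly_measurable_imp_borel[where h = norm] strongly_measurable_diff f)
      (auto intro!: continuous_intros)
  have bound: "ennreal (norm (?I j - ?I k))
    \<le> (\<integral>\<^sup>+x. ennreal (norm (f x - s j x)) \<partial>M) + (\<integral>\<^sup>+x. ennreal (norm (f x - s k x)) \<partial>M)" for j k
  proof -
    have sf: "simple_function M (s i)" for i
      using s(1)[of i] by (auto elim: Bochner_Integration.simple_bochner_integrable.cases)
    have "?I j - ?I k = Bochner_Integration.simple_bochner_integral M (\<lambda>x. s j x - s k x)"
      by (rule Bochner_Integration.simple_bochner_integral_diff[OF s(1) s(1), symmetric])
    moreover have d: "Bochner_Integration.simple_bochner_integrable M (\<lambda>x. s j x - s k x)"
      by (rule Bochner_Integration.simple_bochner_integrable_compose2[OF _ s(1) s(1)]) simp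
    ultimately have "norm (?I j - ?I k)
      \<le> Bochner_Integration.simple_bochner_integral M (\<lambda>x. norm (s j x - s k x))"
      using Bochner_Integration.simple_bochner_integral_norm_bound by metis
    moreover have "Bochner_Integration.simple_bochner_integrable M (\<lambda>x. norm (s j x - s k x))"
      using Bochner_Integration.simple_bochner_integrable_compose2[of "\<lambda>x _. norm x", OF _ d d] by simp
    then have "Bochner_Integration.simple_bochner_integral M (\<lambda>x. norm (s j x - s k x))
      = (\<integral>\<^sup>+x. norm (s j x - s k x) \<partial>M)"
      by (rule Bochner_Integration.simple_bochner_integral_eq_nn_integral) simp
    ultimately have "ennreal (norm (?I j - ?I k)) \<le> (\<integral>\<^sup>+x. norm (s j x - s k x) \<partial>M)"
      by (metis ennreal_leI)
    also have "\<dots> \<le> (\<integral>\<^sup>+x. ennreal (norm (f x - s j x)) + ennreal (norm (f x - s k x)) \<partial>M)"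
    proof (intro nn_integral_mono)
      fix x
      have "norm (s j x - s k x) \<le> norm (f x - s j x) + norm (f x - s k x)"
        using norm_triangle_ineq4[of "f x - s k x" "f x - s j x"] by simp
      then show "ennreal (norm (s j x - s k x)) \<le> ennreal (norm (f x - s j x)) + ennreal (norm (f x - s k x))"
        by (simp flip: ennreal_plus)
    qed
    also have "\<dots> = (\<integral>\<^sup>+x. ennreal (norm (f x - s j x)) \<partial>M) + (\<integral>\<^sup>+x. ennreal (norm (f x - s k x)) \<partial>M)"
      by (rule nn_integral_add) auto
    finally show ?thesis .
  qed
  have "Cauchy ?I"
  proof (rule CauchyI)
    fix e :: real assume e: "0 < e"
    have "\<forall>\<^sub>F i in sequentially. (\<integral>\<^sup>+x. ennreal (norm (f x - s i x)) \<partial>M) < ennreal (e / 2)"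
      by (rule order_tendstoD[OF s(2)]) (use e in auto)
    then obtain N where N: "\<And>i. i \<ge> N \<Longrightarrow> (\<integral>\<^sup>+x. ennreal (norm (f x - s i x)) \<partial>M) < ennreal (e / 2)"
      by (auto simp: eventually_sequentially)
    have "norm (?I j - ?I k) < e" if "j \<ge> N" "k \<ge> N" for j k
    proof -
      have "ennreal (norm (?I j - ?I k)) < ennreal (e / 2) + ennreal (e / 2)"
        using bound[of j k] add_strict_mono[OF N[OF that(1)] N[OF that(2)]] by (rule order_le_less_trans)
      also have "\<dots> = ennreal e" using e by (simp flip: ennreal_plus)
      finally show ?thesis using e by (simp add: ennreal_less_iff)
    qed
    then show "\<exists>N. \<forall>j\<ge>N. \<forall>k\<ge>N. norm (?I j - ?I k) < e" by blast
  qed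
  then obtain I where "?I \<longlonglongrightarrow> I" by (auto simp: Cauchy_convergent_iff convergent_def)
  then show ?thesis using s f unfolding has_strong_integral_def by blast
qed

text \<open>The value is unique because the difference of two candidates, tested against itself,
  vanishes; this makes the definite description usable.\<close>

lemma (in complete_measure) strong_integral_bounded_linear:
  fixes f :: "'a \<Rightarrow> 'b::{real_inner,banach}" and h :: "'b \<Rightarrow> real"
  assumes f: "strongly_measurable M f" and int: "integrable M (\<lambda>x. norm (f x))" and h: "bounded_linear h"
  shows "integrable M (\<lambda>x. h (f x))" "h (strong_integral M f) = (\<integral>x. h (f x) \<partial>M)"
proof -
  obtain I where I: "has_strong_integral M f I" using has_strong_integral_exists[OF f int] by blast
  have "I' = I" if "has_strong_integral M f I'" for I'
  proof -
    have "bounded_linear (\<lambda>x. inner x (I' - I))" by (rule bounded_linear_inner_left)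
    from has_bochner_integral_eq[OF has_strong_integral_bounded_linear[OF that this]
        has_strong_integral_bounded_linear[OF I this]]
    have "inner (I' - I) (I' - I) = 0" by (simp add: inner_diff_left)
    then show ?thesis by simp
  qed
  then have "strong_integral M f = I" unfolding strong_integral_def using I by (intro the_equality)
  then show "integrable M (\<lambda>x. h (f x))" "h (strong_integral M f) = (\<integral>x. h (f x) \<partial>M)"
    using has_strong_integral_bounded_linear[OF I h] by (simp_all add: has_bochner_integral_iff)
qed

text \<open>Testing against the integral itself and dividing by its norm reduces the claim to
  Cauchy-Schwarz.\<close>

lemma (in complete_measure) norm_strong_integral_le:
  fixes f :: "'a \<Rightarrow> 'b::{real_inner,banach}"
  assumes f: "strongly_measurable M f" and int: "integrable M (\<lambda>x. norm (f x))"
  shows "norm (strong_integral M f) \<le> (\<integral>x. norm (f x) \<partial>M)"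
proof -
  let ?I = "strong_integral M f"
  note lin = strong_integral_bounded_linear[OF f int bounded_linear_inner_left[of ?I]]
  have "norm ?I * norm ?I = (\<integral>x. inner (f x) ?I \<partial>M)"
    using lin by (simp flip: power2_norm_eq_inner add: power2_eq_square)
  also have "\<dots> \<le> (\<integral>x. norm (f x) * norm ?I \<partial>M)"
    by (intro integral_mono lin norm_cauchy_schwarz) (use int in simp)
  also have "\<dots> = (\<integral>x. norm (f x) \<partial>M) * norm ?I" by simp
  finally show ?thesis by (cases "?I = 0") auto
qed

text \<open>A diagonal argument: simple functions within \<open>(1/2) ^ k\<close> of
  \<open>f k\<close> in the mean have summable errors, so the errors tend to 0 almost
  everywhere.\<close>

lemma (in complete_measure) strongly_measurable_limit:
  fixes f :: "nat \<Rightarrow> 'a \<Rightarrow> 'b::real_normed_vector"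
  assumes f: "\<And>k. strongly_measurable M (f k)" and int: "\<And>k. integrable M (\<lambda>x. norm (f k x))"
    and lim: "AE x in M. (\<lambda>k. f k x) \<longlonglongrightarrow> g x"
  shows "strongly_measurable M g"
proof -
  have "\<exists>s. simple_function M s \<and> (\<integral>\<^sup>+x. ennreal (norm (f k x - s x)) \<partial>M) < ennreal ((1/2) ^ k)" for k
  proof -
    obtain s where s: "\<And>i. Bochner_Integration.simple_bochner_integrable M (s i)"
      "(\<lambda>i. \<integral>\<^sup>+x. ennreal (norm (f k x - s i x)) \<partial>M) \<longlonglongrightarrow> 0"
      using strongly_measurable_approx[OF f int] by blast
    have "\<forall>\<^sub>F i in sequentially. (\<integral>\<^sup>+x. ennreal (norm (f k x - s i x)) \<partial>M) < ennreal ((1/2) ^ k)"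
      by (rule order_tendstoD[OF s(2)]) simp
    then show ?thesis using s(1)
      by (auto simp: eventually_sequentially elim!: Bochner_Integration.simple_bochner_integrable.cases)
  qed
  then obtain s where s: "\<And>k. simple_function M (s k)"
    "\<And>k. (\<integral>\<^sup>+x. ennreal (norm (f k x - s k x)) \<partial>M) < ennreal ((1/2) ^ k)" by metis
  have m [measurable]: "(\<lambda>x. norm (f k x - s k x)) \<in> borel_measurable M" for k
    by (intro strongly_measurable_imp_borel[where h = norm] strongly_measurable_diff f
        strongly_measurable_simple s) (auto intro!: continuous_intros)
  have "(\<integral>\<^sup>+x. (\<Sum>k. ennreal (norm (f k x - s k x))) \<partial>M)
    = (\<Sum>k. \<integral>\<^sup>+x. ennreal (norm (f k x - s k x)) \<partial>M)" by (rule nn_integral_suminf) simp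
  also have "\<dots> \<le> (\<Sum>k. ennreal ((1/2) ^ k))"
    using s(2) by (intro suminf_le less_imp_le) auto
  also have "\<dots> = ennreal (\<Sum>k. (1/2) ^ k)" by (rule suminf_ennreal2) (auto intro: summable_geometric)
  finally have "(\<integral>\<^sup>+x. (\<Sum>k. ennreal (norm (f k x - s k x))) \<partial>M) \<noteq> \<infinity>" by (auto simp: top_unique)
  then have "AE x in M. (\<Sum>k. ennreal (norm (f k x - s k x))) \<noteq> \<infinity>"
    by (intro nn_integral_PInf_AE) auto
  then have "AE x in M. (\<lambda>k. s k x) \<longlonglongrightarrow> g x" using lim
  proof eventually_elim
    case (elim x)
    have "summable (\<lambda>k. norm (f k x - s k x))"
      using elim(1) by (intro summable_suminf_not_top) auto
    then have "(\<lambda>k. f k x - s k x) \<longlonglongrightarrow> 0"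
      by (rule tendsto_norm_zero_cancel[OF summable_LIMSEQ_zero])
    from tendsto_diff[OF elim(2) this] show ?case by simp
  qed
  then show ?thesis using s(1) by (auto simp: strongly_measurable_def)
qed

lemma complete_measure_lebesgue_on:
  assumes "X \<in> sets lebesgue" shows "complete_measure (lebesgue_on X)"
proof
  fix A B assume "B \<subseteq> A" "A \<in> null_sets (lebesgue_on X)"
  then have "A \<subseteq> X" "A \<in> null_sets lebesgue" "B \<subseteq> X"
    using null_sets_restrict_space[OF assms] by auto
  then have "B \<in> sets lebesgue" using completion.complete[OF \<open>B \<subseteq> A\<close>] by simp
  then show "B \<in> sets (lebesgue_on X)" using \<open>B \<subseteq> X\<close> assms by (simp add: sets_restrict_space_iff)
qed

section \<open>Functions on subsets of the real line\<close>

lemma AE_lebesgue_on_iff: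
  assumes "X \<in> sets lebesgue"
  shows "(AE x in lebesgue_on X. P x) \<longleftrightarrow> (AE x in lebesgue. x \<in> X \<longrightarrow> P x)"
  using assms by (subst AE_restrict_space_iff) auto

lemma strongly_measurable_indicator:
  assumes "strongly_measurable M f" "X \<in> sets M"
  shows "strongly_measurable M (\<lambda>x. indicator X x *\<^sub>R f x)"
proof -
  have "strongly_measurable M (indicator X :: 'a \<Rightarrow> real)"
    using assms(2) by (intro strongly_measurable_simple) auto
  from strongly_measurable_compose2[OF this assms(1), of "(*\<^sub>R)"] show ?thesis
    by (auto intro!: continuous_intros)
qed

text \<open>Extension by zero moves questions to the whole line, where Lebesgue measure is
  translation invariant.\<close>

lemma strongly_measurable_lebesgue_on_iff:
  assumes X: "X \<in> sets lebesgue"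
  shows "strongly_measurable (lebesgue_on X) f \<longleftrightarrow> strongly_measurable lebesgue (\<lambda>x. indicator X x *\<^sub>R f x)"
    (is "?L \<longleftrightarrow> ?R")
proof
  assume ?L
  then obtain s where s: "\<And>i. simple_function (lebesgue_on X) (s i)"
    "AE x in lebesgue_on X. (\<lambda>i. s i x) \<longlonglongrightarrow> f x" by (auto simp: strongly_measurable_def)
  have "simple_function lebesgue (\<lambda>x. indicator X x *\<^sub>R s i x)" for i
    using s(1)[of i] X by (simp add: simple_function_restrict_space)
  moreover have "AE x in lebesgue. (\<lambda>i. indicator X x *\<^sub>R s i x) \<longlonglongrightarrow> indicator X x *\<^sub>R f x"
    using s(2) unfolding AE_lebesgue_on_iff[OF X]
    by eventually_elim (auto simp: indicator_def)
  ultimately show ?R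
    unfolding strongly_measurable_def by (intro exI[of _ "\<lambda>i x. indicator X x *\<^sub>R s i x"]) auto
next
  assume ?R
  then obtain s where s: "\<And>i. simple_function lebesgue (s i)"
    "AE x in lebesgue. (\<lambda>i. s i x) \<longlonglongrightarrow> indicator X x *\<^sub>R f x" by (auto simp: strongly_measurable_def)
  have "simple_function lebesgue (\<lambda>x. indicator X x *\<^sub>R s i x)" for i
    by (rule simple_function_compose2[where h = "(*\<^sub>R)"]) (use X s in auto)
  then have "simple_function (lebesgue_on X) (s i)" for i
    using X by (simp add: simple_function_restrict_space)
  moreover have "AE x in lebesgue_on X. (\<lambda>i. s i x) \<longlonglongrightarrow> f x"
    using s(2) unfolding AE_lebesgue_on_iff[OF X] by eventually_elim auto
  ultimately show ?L unfolding strongly_measurable_def by blast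
qed

lemma strongly_measurable_lebesgue_on_subset:
  assumes "strongly_measurable (lebesgue_on X) f" "Y \<subseteq> X" "X \<in> sets lebesgue" "Y \<in> sets lebesgue"
  shows "strongly_measurable (lebesgue_on Y) f"
proof -
  have "strongly_measurable lebesgue (\<lambda>x. indicator X x *\<^sub>R f x)"
    using assms(1) by (simp add: strongly_measurable_lebesgue_on_iff[OF assms(3)])
  then have "strongly_measurable lebesgue (\<lambda>x. indicator Y x *\<^sub>R indicator X x *\<^sub>R f x)"
    using assms(4) by (rule strongly_measurable_indicator)
  moreover have "(\<lambda>x. indicator Y x *\<^sub>R indicator X x *\<^sub>R f x) = (\<lambda>x. indicator Y x *\<^sub>R f x)"
    using assms(2) by (auto simp: indicator_def fun_eq_iff)
  ultimately show ?thesis by (simp only: strongly_measurable_lebesgue_on_iff[OF assms(4)])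
qed

lemma measurable_translation_lebesgue: "(\<lambda>x::real. c + x) \<in> lebesgue \<rightarrow>\<^sub>M lebesgue"
  using lebesgue_affine_measurable[where c = "\<lambda>x::real. 1" and t = c] by simp

lemma AE_lebesgue_translation:
  assumes "AE x in lebesgue. P x"
  shows "AE x in lebesgue. P (c + x::real)"
proof -
  have d: "distr lebesgue lebesgue (\<lambda>x. c + x) = (lebesgue :: real measure)"
    using lebesgue_real_affine[of 1 c] by (simp add: density_1)
  have "AE x in distr lebesgue lebesgue (\<lambda>x. c + x). P x" unfolding d by (rule assms)
  then show ?thesis using AE_distrD[OF measurable_translation_lebesgue] by blast
qed

lemma strongly_measurable_translation:
  assumes "strongly_measurable lebesgue f"
  shows "strongly_measurable lebesgue (\<lambda>x. f (c + x::real))"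
proof -
  obtain s where s: "\<And>i. simple_function lebesgue (s i)"
    "AE x in lebesgue. (\<lambda>i. s i x) \<longlonglongrightarrow> f x" using assms by (auto simp: strongly_measurable_def)
  have "simple_function lebesgue (\<lambda>x. s i (c + x))" for i
    using simple_function_comp[OF measurable_translation_lebesgue s(1)[of i], of c] by simp
  moreover have "AE x in lebesgue. (\<lambda>i. s i (c + x)) \<longlonglongrightarrow> f (c + x)"
    using AE_lebesgue_translation[OF s(2)] .
  ultimately show ?thesis
    unfolding strongly_measurable_def by (intro exI[of _ "\<lambda>i x. s i (c + x)"]) auto
qed

lemma lebesgue_integral_translation:
  fixes f :: "real \<Rightarrow> real"
  shows "(\<integral>x. f (c + x) \<partial>lebesgue) = (\<integral>x. f x \<partial>lebesgue)"
    and "integrable lebesgue (\<lambda>x. f (c + x)) \<longleftrightarrow> integrable lebesgue f"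
  using lebesgue_integral_real_affine[of 1 f c] lebesgue_integrable_real_affine_iff[of 1 f c] by simp_all

lemma lebesgue_on_indicator:
  fixes f :: "'a::euclidean_space \<Rightarrow> real"
  assumes "X \<in> sets lebesgue"
  shows "integrable (lebesgue_on X) f \<longleftrightarrow> integrable lebesgue (\<lambda>x. indicator X x *\<^sub>R f x)"
    and "(\<integral>x. f x \<partial>lebesgue_on X) = (\<integral>x. indicator X x *\<^sub>R f x \<partial>lebesgue)"
  using assms by (simp_all add: integrable_restrict_space integral_restrict_space)

lemma integrable_lebesgue_on_subset:
  fixes f :: "'a::euclidean_space \<Rightarrow> real"
  assumes f: "integrable (lebesgue_on X) f" and "Y \<subseteq> X" "X \<in> sets lebesgue" "Y \<in> sets lebesgue"
  shows "integrable (lebesgue_on Y) f"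
proof -
  have "integrable lebesgue (\<lambda>x. indicator X x *\<^sub>R f x)" using assms lebesgue_on_indicator(1) by blast
  from integrable_mult_indicator[OF assms(4) this]
  have "integrable lebesgue (\<lambda>x. indicator Y x *\<^sub>R indicator X x *\<^sub>R f x)" .
  moreover have "(\<lambda>x. indicator Y x *\<^sub>R indicator X x *\<^sub>R f x) = (\<lambda>x. indicator Y x *\<^sub>R f x)"
    using assms(2) by (auto simp: indicator_def fun_eq_iff)
  ultimately show ?thesis by (simp only: lebesgue_on_indicator(1)[OF assms(4)])
qed

lemma integral_lebesgue_on_mono_subset:
  fixes f :: "'a::euclidean_space \<Rightarrow> real"
  assumes f: "integrable (lebesgue_on X) f" and "\<And>x. f x \<ge> 0" "Y \<subseteq> X" "X \<in> sets lebesgue" "Y \<in> sets lebesgue"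
  shows "(\<integral>x. f x \<partial>lebesgue_on Y) \<le> (\<integral>x. f x \<partial>lebesgue_on X)"
proof -
  have "integrable (lebesgue_on Y) f" using integrable_lebesgue_on_subset assms by blast
  then show ?thesis using assms
    by (auto simp: integrable_restrict_space integral_restrict_space indicator_def intro!: integral_mono)
qed

lemma L2_on_subset:
  assumes "L2_on X f" "Y \<subseteq> X" "X \<in> sets lebesgue" "Y \<in> sets lebesgue"
  shows "L2_on Y f"
  using assms strongly_measurable_lebesgue_on_subset integrable_lebesgue_on_subset
  unfolding L2_on_def by blast

lemma L2_on_imp_integrable_norm:
  assumes f: "L2_on X f" and X: "X \<in> lmeasurable"
  shows "integrable (lebesgue_on X) (\<lambda>s. norm (f s))"
proof -
  interpret finite_measure "lebesgue_on X" using X by (rule finite_measure_lebesgue_on)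
  interpret complete_measure "lebesgue_on X"
    using X by (intro complete_measure_lebesgue_on) (rule fmeasurableD)
  show ?thesis
  proof (rule Bochner_Integration.integrable_bound)
    show "integrable (lebesgue_on X) (\<lambda>s. 1 + (norm (f s))\<^sup>2)" using f by (simp add: L2_on_def)
    show "(\<lambda>s. norm (f s)) \<in> borel_measurable (lebesgue_on X)"
      using f by (intro strongly_measurable_imp_borel) (auto simp: L2_on_def)
    have "norm x \<le> 1 + (norm x)\<^sup>2" for x :: 'a
    proof -
      have "0 \<le> (norm x)\<^sup>2 + 1 - 2 * norm x"
        using zero_le_power2[of "norm x - 1"] by (simp add: power2_diff)
      then show ?thesis using norm_ge_zero[of x] by linarith
    qed
    then show "AE s in lebesgue_on X. norm (norm (f s)) \<le> norm (1 + (norm (f s))\<^sup>2)"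
      by (simp add: add_nonneg_nonneg)
  qed
qed

lemma L2_on_scaleC:
  fixes f :: "real \<Rightarrow> 'a::complex_hilbert"
  assumes "L2_on X f" shows "L2_on X (\<lambda>s. c *\<^sub>C f s)"
  using assms strongly_measurable_bounded_linear[OF _ bounded_linear_scaleC]
  by (auto simp: L2_on_def norm_scaleC power_mult_distrib)

lemma norm_add_squared_le: "(norm (x + y))\<^sup>2 \<le> 2 * (norm x)\<^sup>2 + 2 * (norm (y::'a::real_normed_vector))\<^sup>2"
proof -
  have "(norm (x + y))\<^sup>2 \<le> (norm x + norm y)\<^sup>2" by (intro power_mono norm_triangle_ineq) simp
  also have "\<dots> \<le> 2 * (norm x)\<^sup>2 + 2 * (norm y)\<^sup>2"
    using zero_le_power2[of "norm x - norm y"] by (simp add: power2_diff power2_sum)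
  finally show ?thesis .
qed

lemma L2_on_add:
  assumes f: "L2_on X f" and g: "L2_on X g" and X: "X \<in> sets lebesgue"
  shows "L2_on X (\<lambda>s. f s + g s)"
proof -
  interpret complete_measure "lebesgue_on X" using X by (rule complete_measure_lebesgue_on)
  have m: "strongly_measurable (lebesgue_on X) (\<lambda>s. f s + g s)"
    using f g by (auto simp: L2_on_def intro: strongly_measurable_add)
  have "integrable (lebesgue_on X) (\<lambda>s. (norm (f s + g s))\<^sup>2)"
  proof (rule Bochner_Integration.integrable_bound)
    show "integrable (lebesgue_on X) (\<lambda>s. 2 * (norm (f s))\<^sup>2 + 2 * (norm (g s))\<^sup>2)"
      using f g by (auto simp: L2_on_def)
    show "(\<lambda>s. (norm (f s + g s))\<^sup>2) \<in> borel_measurable (lebesgue_on X)"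
      using strongly_measurable_imp_borel[OF m, of "\<lambda>x. (norm x)\<^sup>2"] by (auto intro!: continuous_intros)
    show "AE s in lebesgue_on X. norm ((norm (f s + g s))\<^sup>2) \<le> norm (2 * (norm (f s))\<^sup>2 + 2 * (norm (g s))\<^sup>2)"
      using norm_add_squared_le by (auto intro!: AE_I2 simp: add_nonneg_nonneg)
  qed
  then show ?thesis using m by (simp add: L2_on_def)
qed

section \<open>Energy, delay and advance of controls\<close>

definition energy :: "(real \<Rightarrow> 'b::real_normed_vector) \<Rightarrow> real" where
  "energy u = (\<integral>s. (norm (u s))\<^sup>2 \<partial>lebesgue_on {0..})"

lemma sets_lebesgue_intervals [simp]:
  "{0..} \<in> sets (lebesgue :: real measure)" "{a..b} \<in> sets (lebesgue :: real measure)"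
  "{a<..} \<in> sets (lebesgue :: real measure)" "{a<..b} \<in> sets (lebesgue :: real measure)"
  by auto

lemma energy_nonneg: "energy u \<ge> 0"
  by (simp add: energy_def)

lemma energy_scaleC: "energy (\<lambda>s. c *\<^sub>C u s) = (cmod c)\<^sup>2 * energy (u :: real \<Rightarrow> 'a::complex_hilbert)"
  by (simp add: energy_def norm_scaleC power_mult_distrib)

lemma energy_add_le:
  assumes "L2_on {0..} u" "L2_on {0..} v"
  shows "energy (\<lambda>s. u s + v s) \<le> 2 * energy u + 2 * energy v"
proof -
  have "energy (\<lambda>s. u s + v s) \<le> (\<integral>s. 2 * (norm (u s))\<^sup>2 + 2 * (norm (v s))\<^sup>2 \<partial>lebesgue_on {0..})"
    unfolding energy_def
    by (rule integral_mono)
      (use assms L2_on_add[OF assms] norm_add_squared_le in \<open>auto simp: L2_on_def\<close>)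
  also have "\<dots> = 2 * energy u + 2 * energy v"
    using assms by (simp add: energy_def L2_on_def)
  finally show ?thesis .
qed

definition delayed :: "real \<Rightarrow> (real \<Rightarrow> 'b::real_normed_vector) \<Rightarrow> real \<Rightarrow> 'b" where
  "delayed \<tau> u s = (if s < \<tau> then 0 else u (s - \<tau>))"

lemma L2_on_delayed:
  assumes u: "L2_on {0..} u" and \<tau>: "\<tau> \<ge> 0"
  shows "L2_on {0..} (delayed \<tau> u)" "energy (delayed \<tau> u) = energy u"
proof -
  have eq: "indicator {0..} s *\<^sub>R delayed \<tau> u s = indicator {0..} (- \<tau> + s) *\<^sub>R u (- \<tau> + s)" for s
    using \<tau> by (auto simp: delayed_def indicator_def)
  have eq2: "indicator {0..} s *\<^sub>R (norm (delayed \<tau> u s))\<^sup>2 = indicator {0..} (- \<tau> + s) *\<^sub>R (norm (u (- \<tau> + s)))\<^sup>2" for s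
    using \<tau> by (auto simp: delayed_def indicator_def)
  have "strongly_measurable lebesgue (\<lambda>s. indicator {0..} s *\<^sub>R u s)"
    using u by (simp add: L2_on_def flip: strongly_measurable_lebesgue_on_iff)
  from strongly_measurable_translation[OF this, of "- \<tau>"]
  have "strongly_measurable (lebesgue_on {0..}) (delayed \<tau> u)"
    by (simp add: strongly_measurable_lebesgue_on_iff eq)
  moreover have "integrable lebesgue (\<lambda>s. indicator {0..} s *\<^sub>R (norm (u s))\<^sup>2)"
    using u by (simp add: L2_on_def integrable_restrict_space)
  then have "integrable (lebesgue_on {0..}) (\<lambda>s. (norm (delayed \<tau> u s))\<^sup>2)"
    using lebesgue_integral_translation(2)[of "\<lambda>s. indicator {0..} s *\<^sub>R (norm (u s))\<^sup>2" "- \<tau>"]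
    by (simp only: lebesgue_on_indicator[OF sets_lebesgue_intervals(1)] eq2)
  ultimately show "L2_on {0..} (delayed \<tau> u)" by (simp add: L2_on_def)
  show "energy (delayed \<tau> u) = energy u"
    unfolding energy_def
    using lebesgue_integral_translation(1)[of "\<lambda>s. indicator {0..} s *\<^sub>R (norm (u s))\<^sup>2" "- \<tau>"]
    by (simp only: lebesgue_on_indicator[OF sets_lebesgue_intervals(1)] eq2)
qed

lemma L2_on_advanced:
  assumes u: "L2_on {0..} u" and \<tau>: "\<tau> \<ge> 0"
  shows "L2_on {0..} (\<lambda>s. u (\<tau> + s))" "energy (\<lambda>s. u (\<tau> + s)) \<le> energy u"
proof -
  have sub: "{\<tau>..} \<subseteq> {0..}" using \<tau> by simp
  have m: "{\<tau>..} \<in> sets lebesgue" by simp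
  have u\<tau>: "L2_on {\<tau>..} u" by (rule L2_on_subset[OF u sub]) auto
  have eq: "indicator {0..} s = (indicator {\<tau>..} (\<tau> + s) :: real)" for s
    by (auto simp: indicator_def)
  have "strongly_measurable lebesgue (\<lambda>s. indicator {\<tau>..} s *\<^sub>R u s)"
    using u\<tau> by (simp add: L2_on_def flip: strongly_measurable_lebesgue_on_iff)
  from strongly_measurable_translation[OF this, of \<tau>]
  have "strongly_measurable (lebesgue_on {0..}) (\<lambda>s. u (\<tau> + s))"
    by (simp add: strongly_measurable_lebesgue_on_iff eq)
  moreover have "integrable lebesgue (\<lambda>s. indicator {\<tau>..} s *\<^sub>R (norm (u s))\<^sup>2)"
    using u\<tau> by (simp add: L2_on_def integrable_restrict_space)
  then have "integrable (lebesgue_on {0..}) (\<lambda>s. (norm (u (\<tau> + s)))\<^sup>2)"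
    using lebesgue_integral_translation(2)[of "\<lambda>s. indicator {\<tau>..} s *\<^sub>R (norm (u s))\<^sup>2" \<tau>]
    by (simp only: lebesgue_on_indicator[OF sets_lebesgue_intervals(1)] eq)
  ultimately show "L2_on {0..} (\<lambda>s. u (\<tau> + s))" by (simp add: L2_on_def)
  have "energy (\<lambda>s. u (\<tau> + s)) = (\<integral>s. (norm (u s))\<^sup>2 \<partial>lebesgue_on {\<tau>..})"
    unfolding energy_def
    using lebesgue_integral_translation(1)[of "\<lambda>s. indicator {\<tau>..} s *\<^sub>R (norm (u s))\<^sup>2" \<tau>] m
    by (simp only: lebesgue_on_indicator[OF sets_lebesgue_intervals(1)] lebesgue_on_indicator[OF m] eq)
  also have "\<dots> \<le> energy u"
    unfolding energy_def by (rule integral_lebesgue_on_mono_subset[OF _ _ sub]) (use u in \<open>auto simp: L2_on_def\<close>)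
  finally show "energy (\<lambda>s. u (\<tau> + s)) \<le> energy u" .
qed

text \<open>Rounding \<open>t - s\<close> up to multiples of \<open>1 / Suc i\<close> leaves
  finitely many operators, which map simple functions to simple functions; joint continuity
  identifies the limit.\<close>

lemma (in c0_semigroup) strongly_measurable_convolution:
  assumes g: "strongly_measurable (lebesgue_on {0..t}) g"
  shows "strongly_measurable (lebesgue_on {0..t}) (\<lambda>s. S (t - s) (g s))"
proof -
  obtain r where r: "\<And>i. simple_function (lebesgue_on {0..t}) (r i)"
    "AE x in lebesgue_on {0..t}. (\<lambda>i. r i x) \<longlonglongrightarrow> g x" using g by (auto simp: strongly_measurable_def)
  define \<tau> where "\<tau> i s = of_int \<lceil>real (Suc i) * (t - s)\<rceil> / real (Suc i)" for i :: nat and s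
  have simple: "simple_function (lebesgue_on {0..t}) (\<tau> i)" for i
  proof (rule simple_function_borel_measurable)
    have "\<tau> i ` {0..t} \<subseteq> (\<lambda>k. of_int k / real (Suc i)) ` {0..\<lceil>real (Suc i) * t\<rceil>}"
    proof
      fix y assume "y \<in> \<tau> i ` {0..t}"
      then obtain s where s: "0 \<le> s" "s \<le> t" "y = \<tau> i s" by auto
      have "0 \<le> real (Suc i) * (t - s)" "real (Suc i) * (t - s) \<le> real (Suc i) * t"
        using s by (auto intro!: mult_nonneg_nonneg mult_left_mono)
      then have "\<lceil>real (Suc i) * (t - s)\<rceil> \<in> {0..\<lceil>real (Suc i) * t\<rceil>}"
        using ceiling_mono[of 0 "real (Suc i) * (t - s)"]
          ceiling_mono[of "real (Suc i) * (t - s)" "real (Suc i) * t"] by auto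
      then show "y \<in> (\<lambda>k. of_int k / real (Suc i)) ` {0..\<lceil>real (Suc i) * t\<rceil>}"
        using s unfolding \<tau>_def by blast
    qed
    then have "finite (\<tau> i ` {0..t})"
      by (rule finite_subset) (intro finite_imageI finite_atLeastAtMost_int)
    then show "finite (\<tau> i ` space (lebesgue_on {0..t}))" by simp
    have "(\<lambda>s. real (Suc i) * (t - s)) \<in> borel_measurable (lebesgue_on {0..t})"
      by (intro continuous_imp_measurable_on_sets_lebesgue continuous_intros) simp
    moreover have "(\<lambda>x::real. of_int \<lceil>x\<rceil> / real (Suc i)) \<in> borel_measurable borel" by measurable
    ultimately have "(\<lambda>s. of_int \<lceil>real (Suc i) * (t - s)\<rceil> / real (Suc i)) \<in> borel_measurable (lebesgue_on {0..t})"
      by (rule measurable_compose)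
    then show "\<tau> i \<in> borel_measurable (lebesgue_on {0..t})" by (simp only: \<tau>_def[abs_def])
  qed
  have lim: "(\<lambda>i. \<tau> i s) \<longlonglongrightarrow> t - s" for s
  proof (rule tendsto_sandwich)
    show "\<forall>\<^sub>F i in sequentially. t - s \<le> \<tau> i s"
    proof (intro always_eventually allI)
      fix i
      have "real (Suc i) * (t - s) / real (Suc i) \<le> \<tau> i s"
        unfolding \<tau>_def by (intro divide_right_mono le_of_int_ceiling) simp
      then show "t - s \<le> \<tau> i s" by simp
    qed
    show "\<forall>\<^sub>F i in sequentially. \<tau> i s \<le> t - s + 1 / Suc i"
    proof (intro always_eventually allI)
      fix i
      have "of_int \<lceil>real (Suc i) * (t - s)\<rceil> \<le> real (Suc i) * (t - s) + 1" by linarith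
      then have "\<tau> i s \<le> (real (Suc i) * (t - s) + 1) / real (Suc i)"
        unfolding \<tau>_def by (intro divide_right_mono) auto
      also have "\<dots> = t - s + 1 / Suc i" by (simp add: add_divide_distrib)
      finally show "\<tau> i s \<le> t - s + 1 / Suc i" .
    qed
    have "(\<lambda>i. t - s + 1 / Suc i) \<longlonglongrightarrow> t - s + 0"
      by (intro tendsto_intros LIMSEQ_Suc[OF lim_1_over_n])
    then show "(\<lambda>i. t - s + 1 / Suc i) \<longlonglongrightarrow> t - s" by simp
  qed simp
  have \<tau>0: "\<tau> i s \<ge> 0" if "s \<in> {0..t}" for i s
  proof -
    have "0 \<le> real (Suc i) * (t - s)" using that by (intro mult_nonneg_nonneg) auto
    then show ?thesis unfolding \<tau>_def by (intro divide_nonneg_nonneg) auto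
  qed
  have "AE s in lebesgue_on {0..t}. (\<lambda>i. S (\<tau> i s) (r i s)) \<longlonglongrightarrow> S (t - s) (g s)"
    using r(2) AE_space
    by eventually_elim (intro tendsto_S lim always_eventually allI, auto simp: \<tau>0)
  then show ?thesis unfolding strongly_measurable_def
    using simple_function_compose2[OF simple r(1), of S]
    by (intro exI[of _ "\<lambda>i s. S (\<tau> i s) (r i s)"]) auto
qed

section \<open>The control system\<close>

lemma inner_eqI: "(\<And>w. inner x w = inner y w) \<Longrightarrow> x = (y::'a::real_inner)"
  using vector_eq_rdot by blast

locale control_system = extended_semigroup D A S pair emb SV
  for D :: "'h::complex_hilbert set" and A S and pair :: "'v::complex_hilbert \<Rightarrow> 'h \<Rightarrow> complex" and emb SV +
  fixes B :: "'u::complex_hilbert \<Rightarrow> 'v"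
  assumes B: "bounded_clinear B"
    and input_bounded: "\<And>T. T > 0 \<Longrightarrow> L2_continuous_input_map emb SV B T"
begin

sublocale B: bounded_linear B
  using B by (rule bounded_clinear_bl)

sublocale emb: bounded_linear emb
  by (rule bounded_linear_emb)

abbreviation "integrand u t s \<equiv> SV (t - s) (B (u s))"

definition L1_on :: "real set \<Rightarrow> (real \<Rightarrow> 'u) \<Rightarrow> bool" where
  "L1_on X u \<longleftrightarrow> strongly_measurable (lebesgue_on X) u \<and> integrable (lebesgue_on X) (\<lambda>s. norm (u s))"

lemma L2_on_imp_L1_on: "L2_on {0..} u \<Longrightarrow> L1_on {0..t} u"
proof -
  assume "L2_on {0..} u"
  then have "L2_on {0..t} u" by (rule L2_on_subset) auto
  then show "L1_on {0..t} u"
    using L2_on_imp_integrable_norm[of "{0..t}" u] by (auto simp: L1_on_def L2_on_def)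
qed

lemma integrand_bounded:
  obtains k where "k \<ge> 0"
    "\<And>t s v. 0 \<le> s \<Longrightarrow> s \<le> t \<Longrightarrow> t \<le> T \<Longrightarrow> norm (SV (t - s) (B v)) \<le> k * norm v"
proof -
  obtain M where M: "M \<ge> 1" "\<And>s x. 0 \<le> s \<Longrightarrow> s \<le> T \<Longrightarrow> norm (SV s x) \<le> M * norm x"
    using V.S_locally_bounded[of T] by blast
  obtain b where b: "b \<ge> 0" "\<And>v. norm (B v) \<le> norm v * b" using B.nonneg_bounded by blast
  show thesis
  proof (rule that[of "M * b"])
    fix t s v assume "0 \<le> s" "s \<le> t" "t \<le> T"
    then have "norm (SV (t - s) (B v)) \<le> M * norm (B v)" by (intro M) auto
    also have "\<dots> \<le> M * (norm v * b)" using b(2)[of v] M(1) by (intro mult_left_mono) auto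
    finally show "norm (SV (t - s) (B v)) \<le> M * b * norm v" by (simp add: mult_ac)
  qed (use M b in auto)
qed

lemma integrand_integrable:
  assumes u: "L1_on {0..t} u"
  shows "strongly_measurable (lebesgue_on {0..t}) (integrand u t)"
    and "integrable (lebesgue_on {0..t}) (\<lambda>s. norm (integrand u t s))"
proof -
  interpret complete_measure "lebesgue_on {0..t}" by (rule complete_measure_lebesgue_on) simp
  show m: "strongly_measurable (lebesgue_on {0..t}) (integrand u t)"
    using u by (intro V.strongly_measurable_convolution strongly_measurable_bounded_linear[OF _ B.bounded_linear])
      (simp add: L1_on_def)
  obtain k where k: "k \<ge> 0"
    "\<And>t' s v. 0 \<le> s \<Longrightarrow> s \<le> t' \<Longrightarrow> t' \<le> t \<Longrightarrow> norm (SV (t' - s) (B v)) \<le> k * norm v"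
    using integrand_bounded[of t] by blast
  show "integrable (lebesgue_on {0..t}) (\<lambda>s. norm (integrand u t s))"
  proof (rule Bochner_Integration.integrable_bound)
    show "integrable (lebesgue_on {0..t}) (\<lambda>s. k * norm (u s))" using u by (simp add: L1_on_def)
    show "(\<lambda>s. norm (integrand u t s)) \<in> borel_measurable (lebesgue_on {0..t})"
      using strongly_measurable_imp_borel[OF m, of norm] by (auto intro!: continuous_intros)
    show "AE s in lebesgue_on {0..t}. norm (norm (integrand u t s)) \<le> norm (k * norm (u s))"
      using k by (intro AE_I2) auto
  qed
qed

lemma input_map_bounded_linear:
  fixes h :: "'v \<Rightarrow> real"
  assumes u: "L1_on {0..t} u" and h: "bounded_linear h"
  shows "integrable (lebesgue_on {0..t}) (\<lambda>s. h (integrand u t s))"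
    and "h (input_map SV B u t) = (\<integral>s. h (integrand u t s) \<partial>lebesgue_on {0..t})"
proof -
  interpret complete_measure "lebesgue_on {0..t}" by (rule complete_measure_lebesgue_on) simp
  show "integrable (lebesgue_on {0..t}) (\<lambda>s. h (integrand u t s))"
    "h (input_map SV B u t) = (\<integral>s. h (integrand u t s) \<partial>lebesgue_on {0..t})"
    unfolding input_map_def
    by (rule strong_integral_bounded_linear[OF integrand_integrable[OF u] h])+
qed

lemma norm_input_map_le:
  assumes u: "L1_on {0..t} u"
    and k: "\<And>s v. 0 \<le> s \<Longrightarrow> s \<le> t \<Longrightarrow> norm (SV (t - s) (B v)) \<le> k * norm v"
  shows "norm (input_map SV B u t) \<le> k * (\<integral>s. norm (u s) \<partial>lebesgue_on {0..t})"
proof -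
  interpret complete_measure "lebesgue_on {0..t}" by (rule complete_measure_lebesgue_on) simp
  have "norm (input_map SV B u t) \<le> (\<integral>s. norm (integrand u t s) \<partial>lebesgue_on {0..t})"
    unfolding input_map_def by (rule norm_strong_integral_le[OF integrand_integrable[OF u]])
  also have "\<dots> \<le> (\<integral>s. k * norm (u s) \<partial>lebesgue_on {0..t})"
    by (intro integral_mono integrand_integrable[OF u]) (use u k in \<open>auto simp: L1_on_def\<close>)
  finally show ?thesis by simp
qed

lemma L1_on_add: "L1_on X u \<Longrightarrow> L1_on X v \<Longrightarrow> X \<in> sets lebesgue \<Longrightarrow> L1_on X (\<lambda>s. u s + v s)"
proof -
  assume uv: "L1_on X u" "L1_on X v" and X: "X \<in> sets lebesgue"
  interpret complete_measure "lebesgue_on X" using X by (rule complete_measure_lebesgue_on)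
  have m: "strongly_measurable (lebesgue_on X) (\<lambda>s. u s + v s)"
    using uv by (auto simp: L1_on_def intro: strongly_measurable_add)
  have "integrable (lebesgue_on X) (\<lambda>s. norm (u s + v s))"
  proof (rule Bochner_Integration.integrable_bound)
    show "integrable (lebesgue_on X) (\<lambda>s. norm (u s) + norm (v s))" using uv by (auto simp: L1_on_def)
    show "(\<lambda>s. norm (u s + v s)) \<in> borel_measurable (lebesgue_on X)"
      using strongly_measurable_imp_borel[OF m, of norm] by (auto intro!: continuous_intros)
    show "AE s in lebesgue_on X. norm (norm (u s + v s)) \<le> norm (norm (u s) + norm (v s))"
      by (auto intro!: AE_I2 norm_triangle_ineq)
  qed
  then show ?thesis using m by (simp add: L1_on_def)
qed

lemma L1_on_scaleC: "L1_on X u \<Longrightarrow> L1_on X (\<lambda>s. c *\<^sub>C u s)"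
  using strongly_measurable_bounded_linear[OF _ bounded_linear_scaleC]
  by (auto simp: L1_on_def norm_scaleC)

lemma input_map_add:
  assumes u: "L1_on {0..t} u" and v: "L1_on {0..t} v"
  shows "input_map SV B (\<lambda>s. u s + v s) t = input_map SV B u t + input_map SV B v t"
proof (rule inner_eqI)
  fix w
  note lin = input_map_bounded_linear[OF _ bounded_linear_inner_left[of w]]
  have "inner (input_map SV B (\<lambda>s. u s + v s) t) w
    = (\<integral>s. inner (integrand u t s) w + inner (integrand v t s) w \<partial>lebesgue_on {0..t})"
    unfolding lin(2)[OF L1_on_add[OF u v sets_lebesgue_intervals(2)]]
    by (intro Bochner_Integration.integral_cong) (auto simp: B.add V.S_add inner_add_left)
  also have "\<dots> = inner (input_map SV B u t + input_map SV B v t) w"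
    using lin[OF u] lin[OF v] by (simp add: inner_add_left)
  finally show "inner (input_map SV B (\<lambda>s. u s + v s) t) w = inner (input_map SV B u t + input_map SV B v t) w" .
qed

lemma input_map_scaleC:
  assumes u: "L1_on {0..t} u"
  shows "input_map SV B (\<lambda>s. c *\<^sub>C u s) t = c *\<^sub>C input_map SV B u t"
proof (rule inner_eqI)
  fix w
  have "inner (input_map SV B (\<lambda>s. c *\<^sub>C u s) t) w
    = (\<integral>s. inner (c *\<^sub>C integrand u t s) w \<partial>lebesgue_on {0..t})"
    unfolding input_map_bounded_linear(2)[OF L1_on_scaleC[OF u] bounded_linear_inner_left[of w]]
    by (intro Bochner_Integration.integral_cong) (auto simp: bounded_clinear_scaleC[OF B] V.S_scaleC)
  also have "\<dots> = inner (c *\<^sub>C input_map SV B u t) w"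
    using input_map_bounded_linear(2)[OF u
        bounded_linear_compose[OF bounded_linear_inner_left[of w] bounded_linear_scaleC[of c]]] by simp
  finally show "inner (input_map SV B (\<lambda>s. c *\<^sub>C u s) t) w = inner (c *\<^sub>C input_map SV B u t) w" .
qed

lemma input_map_cong:
  assumes u: "L1_on {0..t} u" and v: "L1_on {0..t} v" and uv: "\<And>s. 0 \<le> s \<Longrightarrow> s \<le> t \<Longrightarrow> u s = v s"
  shows "input_map SV B u t = input_map SV B v t"
proof (rule inner_eqI)
  fix w
  note lin = input_map_bounded_linear(2)[OF _ bounded_linear_inner_left[of w]]
  show "inner (input_map SV B u t) w = inner (input_map SV B v t) w"
    unfolding lin[OF u] lin[OF v] using uv by (intro Bochner_Integration.integral_cong) auto
qed

lemma input_map_AE_zero: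
  assumes u: "L1_on {0..t} u" and z: "AE s in lebesgue_on {0..t}. u s = 0"
  shows "input_map SV B u t = 0"
proof -
  obtain k where k: "k \<ge> 0"
    "\<And>t' s v. 0 \<le> s \<Longrightarrow> s \<le> t' \<Longrightarrow> t' \<le> t \<Longrightarrow> norm (SV (t' - s) (B v)) \<le> k * norm v"
    using integrand_bounded[of t] by blast
  have "norm (input_map SV B u t) \<le> k * (\<integral>s. norm (u s) \<partial>lebesgue_on {0..t})"
    using k(2) by (intro norm_input_map_le u) auto
  also have "(\<integral>s. norm (u s) \<partial>lebesgue_on {0..t}) = 0"
    using z by (intro integral_eq_zero_AE) auto
  finally show ?thesis by simp
qed

text \<open>Variation of constants split at \<tau>. Tested against \<open>w\<close> this is
  additivity of a real integral over adjacent intervals, with a translation on the second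
  one.\<close>

lemma input_map_plus:
  assumes u: "L2_on {0..} u" and "\<tau> \<ge> 0" "t \<ge> 0"
  shows "input_map SV B u (\<tau> + t) = SV t (input_map SV B u \<tau>) + input_map SV B (\<lambda>s. u (\<tau> + s)) t"
proof (rule inner_eqI)
  fix w
  let ?u' = "\<lambda>s. u (\<tau> + s)"
  have u': "L2_on {0..} ?u'" by (rule L2_on_advanced[OF u \<open>\<tau> \<ge> 0\<close>])
  define G where "G s = inner (integrand u (\<tau> + t) s) w" for s
  note lin = input_map_bounded_linear[OF L2_on_imp_L1_on[OF u] bounded_linear_inner_left[of w], of "\<tau> + t"]
  have whole: "integrable (lebesgue_on {0..\<tau>+t}) G"
    "inner (input_map SV B u (\<tau> + t)) w = (\<integral>s. G s \<partial>lebesgue_on {0..\<tau>+t})"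
    using lin by (simp_all add: G_def[abs_def])
  have "inner (SV t (input_map SV B u \<tau>)) w
    = (\<integral>s. inner (SV t (integrand u \<tau> s)) w \<partial>lebesgue_on {0..\<tau>})"
    using input_map_bounded_linear(2)[OF L2_on_imp_L1_on[OF u]
        bounded_linear_compose[OF bounded_linear_inner_left[of w] V.bounded_linear_S[OF \<open>t \<ge> 0\<close>]]] .
  also have "\<dots> = (\<integral>s. G s \<partial>lebesgue_on {0..\<tau>})"
  proof (intro Bochner_Integration.integral_cong refl)
    fix s assume "s \<in> space (lebesgue_on {0..\<tau>})"
    then show "inner (SV t (integrand u \<tau> s)) w = G s"
      using V.S_plus[of t "\<tau> - s"] assms by (simp add: G_def algebra_simps)
  qed
  finally have first: "inner (SV t (input_map SV B u \<tau>)) w = (\<integral>s. G s \<partial>lebesgue_on {0..\<tau>})" .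
  have shift: "indicator {0..t} s *\<^sub>R inner (integrand ?u' t s) w = indicator {\<tau>..\<tau>+t} (\<tau> + s) *\<^sub>R G (\<tau> + s)" for s
    by (auto simp: indicator_def G_def algebra_simps)
  have "inner (input_map SV B ?u' t) w = (\<integral>s. inner (integrand ?u' t s) w \<partial>lebesgue_on {0..t})"
    by (rule input_map_bounded_linear(2)[OF L2_on_imp_L1_on[OF u'] bounded_linear_inner_left])
  also have "\<dots> = (\<integral>s. indicator {\<tau>..\<tau>+t} s *\<^sub>R G s \<partial>lebesgue)"
    unfolding lebesgue_on_indicator(2)[OF sets_lebesgue_intervals(2)] shift
    by (rule lebesgue_integral_translation(1))
  finally have second: "inner (input_map SV B ?u' t) w = (\<integral>s. G s \<partial>lebesgue_on {\<tau>..\<tau>+t})"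
    by (simp only: lebesgue_on_indicator(2)[OF sets_lebesgue_intervals(2)])
  have i1: "integrable (lebesgue_on {0..\<tau>}) G" and i2: "integrable (lebesgue_on {\<tau>..\<tau>+t}) G"
    using assms by (auto intro: integrable_lebesgue_on_subset[OF whole(1)])
  note ii = i1[unfolded lebesgue_on_indicator(1)[OF sets_lebesgue_intervals(2)]]
    i2[unfolded lebesgue_on_indicator(1)[OF sets_lebesgue_intervals(2)]]
    whole(1)[unfolded lebesgue_on_indicator(1)[OF sets_lebesgue_intervals(2)]]
  have "(\<integral>s. G s \<partial>lebesgue_on {0..\<tau>+t})
    = (\<integral>s. indicator {0..\<tau>} s *\<^sub>R G s + indicator {\<tau>..\<tau>+t} s *\<^sub>R G s \<partial>lebesgue)"
    unfolding lebesgue_on_indicator(2)[OF sets_lebesgue_intervals(2)]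
  proof (rule integral_cong_AE)
    \<comment> \<open>The two closed intervals share the endpoint \<tau>, where the indicators add
      up to 2.\<close>
    have "AE s in lebesgue. s \<noteq> \<tau>" by (intro AE_I[of _ _ "{\<tau>}"]) auto
    then show "AE s in lebesgue. indicator {0..\<tau>+t} s *\<^sub>R G s
      = indicator {0..\<tau>} s *\<^sub>R G s + indicator {\<tau>..\<tau>+t} s *\<^sub>R G s"
      by eventually_elim (use assms in \<open>auto simp: indicator_def\<close>)
  qed (use ii in \<open>auto dest: borel_measurable_integrable\<close>)
  also have "\<dots> = (\<integral>s. G s \<partial>lebesgue_on {0..\<tau>}) + (\<integral>s. G s \<partial>lebesgue_on {\<tau>..\<tau>+t})"
    unfolding lebesgue_on_indicator(2)[OF sets_lebesgue_intervals(2)]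
    by (rule Bochner_Integration.integral_add[OF ii(1,2)])
  finally show "inner (input_map SV B u (\<tau> + t)) w
    = inner (SV t (input_map SV B u \<tau>) + input_map SV B ?u' t) w"
    by (simp add: whole first second inner_add_left)
qed

section \<open>Solutions and steering controls\<close>

abbreviation "sol \<equiv> solution emb S SV B"
abbreviation "steers \<equiv> steers_to_rest emb S SV B"

text \<open>The hypothesis \<open>emb x = sol y u \<tau>\<close> says that the state at time \<tau>
  lies in \<open>H\<close>, so that the system can be restarted from it.\<close>

lemma sol_plus:
  assumes u: "L2_on {0..} u" and "\<tau> \<ge> 0" "t \<ge> 0" and x: "emb x = sol y u \<tau>"
  shows "sol y u (\<tau> + t) = sol x (\<lambda>s. u (\<tau> + s)) t"
proof -
  have "emb (S (\<tau> + t) y) = SV t (emb (S \<tau> y))"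
    using assms by (simp add: SV_emb add.commute[of \<tau>] S_plus)
  then have "sol y u (\<tau> + t) = SV t (sol y u \<tau>) + input_map SV B (\<lambda>s. u (\<tau> + s)) t"
    using input_map_plus[OF assms(1-3)] assms by (simp add: solution_def V.S_add)
  also have "SV t (sol y u \<tau>) = emb (S t x)" using assms(3) by (simp add: SV_emb flip: x)
  finally show ?thesis by (simp add: solution_def)
qed

lemma supported_upto_iff:
  "supported_upto T f \<longleftrightarrow> (AE t in lebesgue. 0 \<le> t \<longrightarrow> T < t \<longrightarrow> f t = 0)"
  unfolding supported_upto_def AE_lebesgue_on_iff[OF sets_lebesgue_intervals(1)] by simp

text \<open>Vanishing after \<open>T\<close> turns local into global square integrability, the form
  in which translations and energies are handled.\<close>

lemma steers_iff:
  "steers y u T \<longleftrightarrow> T \<ge> 0 \<and> L2_on {0..} u \<and> supported_upto T u \<and> supported_upto T (sol y u)"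
proof -
  have "L2_loc u \<longleftrightarrow> L2_on {0..} u" if T: "T \<ge> 0" and supp: "supported_upto T u"
  proof
    assume "L2_on {0..} u"
    then have "L2_on {0..r} u" for r by (rule L2_on_subset) auto
    then show "L2_loc u" by (simp add: L2_loc_def)
  next
    assume "L2_loc u"
    \<comment> \<open>\<open>T\<close> may be 0, whereas \<open>L2_loc\<close> speaks of positive
      lengths; hence \<open>T + 1\<close>.\<close>
    then have u: "L2_on {0..T+1} u" using T by (simp add: L2_loc_def)
    have z: "AE s in lebesgue. indicator {0..T+1} s *\<^sub>R u s = indicator {0..} s *\<^sub>R u s"
      using supp[unfolded supported_upto_iff] by eventually_elim (auto simp: indicator_def)
    have "strongly_measurable lebesgue (\<lambda>s. indicator {0..T+1} s *\<^sub>R u s)"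
      using u by (simp add: L2_on_def strongly_measurable_lebesgue_on_iff)
    from strongly_measurable_cong_AE[OF this z]
    have m: "strongly_measurable (lebesgue_on {0..}) u"
      by (simp add: strongly_measurable_lebesgue_on_iff)
    interpret complete_measure "lebesgue_on {0::real..}" by (rule complete_measure_lebesgue_on) simp
    have bm: "(\<lambda>s. (norm (u s))\<^sup>2) \<in> borel_measurable (lebesgue_on {0..})"
      using strongly_measurable_imp_borel[OF m, of "\<lambda>x. (norm x)\<^sup>2"] by (auto intro!: continuous_intros)
    have "integrable lebesgue (\<lambda>s. indicator {0..T+1} s *\<^sub>R (norm (u s))\<^sup>2)"
      using u by (simp only: L2_on_def lebesgue_on_indicator(1)[OF sets_lebesgue_intervals(2)])
    moreover have "(\<lambda>s. indicator {0..} s *\<^sub>R (norm (u s))\<^sup>2) \<in> borel_measurable lebesgue"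
      using bm by (subst (asm) borel_measurable_restrict_space_iff) (auto simp: mult.commute)
    moreover have "AE s in lebesgue. indicator {0..T+1} s *\<^sub>R (norm (u s))\<^sup>2 = indicator {0..} s *\<^sub>R (norm (u s))\<^sup>2"
      using supp[unfolded supported_upto_iff] by eventually_elim (auto simp: indicator_def)
    ultimately have "integrable (lebesgue_on {0..}) (\<lambda>s. (norm (u s))\<^sup>2)"
      unfolding lebesgue_on_indicator(1)[OF sets_lebesgue_intervals(1)] by (rule integrable_cong_AE_imp)
    then show "L2_on {0..} u" using m by (simp add: L2_on_def)
  qed
  then show ?thesis unfolding steers_to_rest_def by blast
qed

lemma supported_upto_mono: "supported_upto T f \<Longrightarrow> T \<le> T' \<Longrightarrow> supported_upto T' f"
  unfolding supported_upto_iff by (elim eventually_mono) auto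

lemma steers_mono: "steers y u T \<Longrightarrow> T \<le> T' \<Longrightarrow> steers y u T'"
  using supported_upto_mono unfolding steers_iff by (meson order_trans)

lemma sol_add:
  assumes "L2_on {0..} u" "L2_on {0..} u'" "t \<ge> 0"
  shows "sol (y + y') (\<lambda>s. u s + u' s) t = sol y u t + sol y' u' t"
  using assms input_map_add[OF L2_on_imp_L1_on L2_on_imp_L1_on]
  by (simp add: solution_def S_add emb.add)

lemma sol_scaleC:
  assumes "L2_on {0..} u" "t \<ge> 0"
  shows "sol (c *\<^sub>C y) (\<lambda>s. c *\<^sub>C u s) t = c *\<^sub>C sol y u t"
  using assms input_map_scaleC[OF L2_on_imp_L1_on]
  by (simp add: solution_def S_scaleC emb_scaleC scaleC_add_right)

lemma steers_add:
  assumes "steers y u T" "steers y' u' T"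
  shows "steers (y + y') (\<lambda>s. u s + u' s) T"
proof -
  have u: "L2_on {0..} u" "L2_on {0..} u'" using assms by (auto simp: steers_iff)
  have "AE t in lebesgue. 0 \<le> t \<longrightarrow> T < t \<longrightarrow> u t + u' t = 0"
    "AE t in lebesgue. 0 \<le> t \<longrightarrow> T < t \<longrightarrow> sol (y + y') (\<lambda>s. u s + u' s) t = 0"
  proof -
    have a: "AE t in lebesgue. 0 \<le> t \<longrightarrow> T < t \<longrightarrow> u t = 0" "AE t in lebesgue. 0 \<le> t \<longrightarrow> T < t \<longrightarrow> u' t = 0"
      "AE t in lebesgue. 0 \<le> t \<longrightarrow> T < t \<longrightarrow> sol y u t = 0" "AE t in lebesgue. 0 \<le> t \<longrightarrow> T < t \<longrightarrow> sol y' u' t = 0"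
      using assms by (simp_all add: steers_iff supported_upto_iff)
    show "AE t in lebesgue. 0 \<le> t \<longrightarrow> T < t \<longrightarrow> u t + u' t = 0"
      using a(1,2) by eventually_elim simp
    show "AE t in lebesgue. 0 \<le> t \<longrightarrow> T < t \<longrightarrow> sol (y + y') (\<lambda>s. u s + u' s) t = 0"
      using a(3,4) by eventually_elim (simp add: sol_add[OF u])
  qed
  then show ?thesis using assms L2_on_add[OF u] by (auto simp: steers_iff supported_upto_iff)
qed

lemma steers_scaleC:
  assumes "steers y u T"
  shows "steers (c *\<^sub>C y) (\<lambda>s. c *\<^sub>C u s) T"
proof -
  have u: "L2_on {0..} u" using assms by (simp add: steers_iff)
  have a: "AE t in lebesgue. 0 \<le> t \<longrightarrow> T < t \<longrightarrow> u t = 0" "AE t in lebesgue. 0 \<le> t \<longrightarrow> T < t \<longrightarrow> sol y u t = 0"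
    using assms by (simp_all add: steers_iff supported_upto_iff)
  have "AE t in lebesgue. 0 \<le> t \<longrightarrow> T < t \<longrightarrow> c *\<^sub>C u t = 0"
    using a(1) by eventually_elim simp
  moreover have "AE t in lebesgue. 0 \<le> t \<longrightarrow> T < t \<longrightarrow> sol (c *\<^sub>C y) (\<lambda>s. c *\<^sub>C u s) t = 0"
    using a(2) by eventually_elim (simp add: sol_scaleC[OF u])
  ultimately show ?thesis using assms L2_on_scaleC[OF u] by (auto simp: steers_iff supported_upto_iff)
qed

text \<open>The control that remains after \<tau> does the rest of the work. The time \<tau> may lie
  beyond \<open>T\<close>, hence the maximum with 0.\<close>

lemma steers_advanced:
  assumes "steers y u T" "\<tau> \<ge> 0" and x: "emb x = sol y u \<tau>"
  shows "steers x (\<lambda>s. u (\<tau> + s)) (max 0 (T - \<tau>))"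
proof -
  have u: "L2_on {0..} u" using assms by (simp add: steers_iff)
  have a: "AE t in lebesgue. 0 \<le> t \<longrightarrow> T < t \<longrightarrow> u t = 0" "AE t in lebesgue. 0 \<le> t \<longrightarrow> T < t \<longrightarrow> sol y u t = 0"
    using assms by (simp_all add: steers_iff supported_upto_iff)
  have "AE t in lebesgue. 0 \<le> t \<longrightarrow> max 0 (T - \<tau>) < t \<longrightarrow> u (\<tau> + t) = 0"
    using AE_lebesgue_translation[OF a(1), of \<tau>] by eventually_elim (use \<open>\<tau> \<ge> 0\<close> in auto)
  moreover have "AE t in lebesgue. 0 \<le> t \<longrightarrow> max 0 (T - \<tau>) < t \<longrightarrow> sol x (\<lambda>s. u (\<tau> + s)) t = 0"
    using AE_lebesgue_translation[OF a(2), of \<tau>]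
    by eventually_elim (use \<open>\<tau> \<ge> 0\<close> in \<open>auto simp: sol_plus[OF u \<open>\<tau> \<ge> 0\<close> _ x, symmetric]\<close>)
  ultimately show ?thesis using L2_on_advanced(1)[OF u \<open>\<tau> \<ge> 0\<close>] by (auto simp: steers_iff supported_upto_iff)
qed

text \<open>At \<tau> itself the delayed control already has the value \<open>u 0\<close>, so it
  vanishes on \<open>{0..\<tau>}\<close> only almost everywhere.\<close>

lemma input_map_delayed_zero:
  assumes "L2_on {0..} u" "\<tau> \<ge> 0"
  shows "input_map SV B (delayed \<tau> u) \<tau> = 0"
proof (rule input_map_AE_zero[OF L2_on_imp_L1_on[OF L2_on_delayed(1)[OF assms]]])
  have "AE s in lebesgue. s \<noteq> \<tau>" by (intro AE_I[of _ _ "{\<tau>}"]) auto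
  then show "AE s in lebesgue_on {0..\<tau>}. delayed \<tau> u s = 0"
    unfolding AE_lebesgue_on_iff[OF sets_lebesgue_intervals(2)]
    by eventually_elim (auto simp: delayed_def)
qed

text \<open>Before \<tau> the system evolves freely and arrives at \<open>S \<tau> y\<close>; from
  then on the delayed control acts as \<open>u\<close>.\<close>

lemma steers_delayed:
  assumes st: "steers (S \<tau> y) u T" and \<tau>: "\<tau> \<ge> 0"
  shows "steers y (delayed \<tau> u) (\<tau> + T)"
proof -
  have u: "L2_on {0..} u" and T: "T \<ge> 0" using st by (simp_all add: steers_iff)
  have du: "L2_on {0..} (delayed \<tau> u)" by (rule L2_on_delayed(1)[OF u \<tau>])
  have x: "emb (S \<tau> y) = sol y (delayed \<tau> u) \<tau>"
    by (simp add: solution_def input_map_delayed_zero[OF u \<tau>])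
  have shift: "sol y (delayed \<tau> u) t = sol (S \<tau> y) u (- \<tau> + t)" if "t \<ge> \<tau>" for t
  proof -
    have "sol y (delayed \<tau> u) (\<tau> + (- \<tau> + t)) = sol (S \<tau> y) (\<lambda>s. delayed \<tau> u (\<tau> + s)) (- \<tau> + t)"
      using that by (intro sol_plus[OF du \<tau> _ x]) simp
    also have "\<dots> = sol (S \<tau> y) u (- \<tau> + t)"
      using input_map_cong[OF L2_on_imp_L1_on[OF L2_on_advanced(1)[OF du \<tau>]] L2_on_imp_L1_on[OF u], of "- \<tau> + t"]
      by (simp add: solution_def delayed_def)
    finally show ?thesis by simp
  qed
  have a: "AE t in lebesgue. 0 \<le> t \<longrightarrow> T < t \<longrightarrow> u t = 0" "AE t in lebesgue. 0 \<le> t \<longrightarrow> T < t \<longrightarrow> sol (S \<tau> y) u t = 0"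
    using st by (simp_all add: steers_iff supported_upto_iff)
  have "AE t in lebesgue. 0 \<le> t \<longrightarrow> \<tau> + T < t \<longrightarrow> delayed \<tau> u t = 0"
    using AE_lebesgue_translation[OF a(1), of "- \<tau>"]
    by eventually_elim (use \<tau> T in \<open>auto simp: delayed_def\<close>)
  moreover have "AE t in lebesgue. 0 \<le> t \<longrightarrow> \<tau> + T < t \<longrightarrow> sol y (delayed \<tau> u) t = 0"
    using AE_lebesgue_translation[OF a(2), of "- \<tau>"]
    by eventually_elim (use \<tau> T in \<open>auto simp: shift\<close>)
  ultimately show ?thesis using du \<tau> T by (auto simp: steers_iff supported_upto_iff)
qed

end

section \<open>Good times, and the case of unstable spectrum\<close>

context control_system
begin

text \<open>The state is only known to lie in \<open>H\<close> for almost every time, with an \<open>L\<^sup>2\<close> bound in time; but at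
  some time in \<open>(r, 2r]\<close> it does, with a bound by the control energy.\<close>

lemma exists_good_time:
  assumes r: "r > 0"
  shows "\<exists>C\<ge>0. \<forall>y u T. steers y u T \<longrightarrow> (\<exists>t x. r < t \<and> t \<le> 2 * r \<and> emb x = sol y u t \<and>
    norm (x - S t y) \<le> C * sqrt (energy u) \<and> (T \<le> r \<longrightarrow> x = 0))"
proof -
  obtain K where K: "\<And>u. L2_on {0..2*r} u \<Longrightarrow> \<exists>z. L2_on {0..2*r} z \<and>
      (AE t in lebesgue_on {0..2*r}. emb (z t) = input_map SV B u t) \<and>
      L2_norm_on {0..2*r} z \<le> K * L2_norm_on {0..2*r} u"
    using input_bounded[of "2 * r"] r by (auto simp: L2_continuous_input_map_def)
  let ?X = "{r<..2*r}"
  have "\<exists>t x. r < t \<and> t \<le> 2 * r \<and> emb x = sol y u t \<and>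
    norm (x - S t y) \<le> \<bar>K\<bar> / sqrt r * sqrt (energy u) \<and> (T \<le> r \<longrightarrow> x = 0)" if st: "steers y u T" for y u T
  proof -
    have u: "L2_on {0..} u" using st by (simp add: steers_iff)
    have u2: "L2_on {0..2*r} u" by (rule L2_on_subset[OF u]) auto
    obtain z where z: "L2_on {0..2*r} z" "AE t in lebesgue_on {0..2*r}. emb (z t) = input_map SV B u t"
      "L2_norm_on {0..2*r} z \<le> K * L2_norm_on {0..2*r} u" using K[OF u2] by blast
    \<comment> \<open>A mean value bound: \<open>?X\<close> has length \<open>r\<close>, so the
      squared norm of the input part cannot exceed \<open>c\<close> almost everywhere on it.\<close>
    define c where "c = K\<^sup>2 * energy u / r"
    have "(\<integral>s. (norm (z s))\<^sup>2 \<partial>lebesgue_on {0..2*r}) = (L2_norm_on {0..2*r} z)\<^sup>2"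
      by (simp add: L2_norm_on_def)
    also have "\<dots> \<le> (K * L2_norm_on {0..2*r} u)\<^sup>2"
      by (rule power_mono[OF z(3)]) (simp add: L2_norm_on_def)
    also have "\<dots> = K\<^sup>2 * (\<integral>s. (norm (u s))\<^sup>2 \<partial>lebesgue_on {0..2*r})"
      by (simp add: L2_norm_on_def power_mult_distrib)
    also have "\<dots> \<le> K\<^sup>2 * energy u"
      unfolding energy_def
      by (intro mult_left_mono integral_lebesgue_on_mono_subset) (use u in \<open>auto simp: L2_on_def\<close>)
    finally have zK: "(\<integral>s. (norm (z s))\<^sup>2 \<partial>lebesgue_on {0..2*r}) \<le> K\<^sup>2 * energy u" .
    have zi: "integrable (lebesgue_on {0..2*r}) (\<lambda>s. (norm (z s))\<^sup>2)" using z by (simp add: L2_on_def)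
    have zX: "integrable (lebesgue_on ?X) (\<lambda>s. (norm (z s))\<^sup>2)"
      by (rule integrable_lebesgue_on_subset[OF zi]) (use r in auto)
    have "(\<integral>s. (norm (z s))\<^sup>2 \<partial>lebesgue_on ?X) \<le> (\<integral>s. (norm (z s))\<^sup>2 \<partial>lebesgue_on {0..2*r})"
      by (rule integral_lebesgue_on_mono_subset[OF zi]) (use r in auto)
    then have zc: "(\<integral>s. (norm (z s))\<^sup>2 \<partial>lebesgue_on ?X) \<le> c * r" using zK r by (simp add: c_def)
    interpret X: finite_measure "lebesgue_on ?X" by (intro finite_measure_lebesgue_on bounded_set_imp_lmeasurable) auto
    have mX: "measure (lebesgue_on ?X) ?X = r"
      using r by (subst measure_restrict_space) auto
    have "AE t in lebesgue. 0 \<le> t \<longrightarrow> T < t \<longrightarrow> sol y u t = 0"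
      using st by (simp add: steers_iff supported_upto_iff)
    then have good: "AE t in lebesgue_on ?X. emb (z t) = input_map SV B u t \<and> (T \<le> r \<longrightarrow> sol y u t = 0)"
      using z(2) unfolding AE_lebesgue_on_iff[OF sets_lebesgue_intervals(2)] AE_lebesgue_on_iff[OF sets_lebesgue_intervals(4)]
      by eventually_elim (use r in auto)
    have "\<exists>t\<in>?X. emb (z t) = input_map SV B u t \<and> (T \<le> r \<longrightarrow> sol y u t = 0) \<and> (norm (z t))\<^sup>2 \<le> c"
    proof (rule ccontr)
      assume neg: "\<not> ?thesis"
      have gt: "AE t in lebesgue_on ?X. (norm (z t))\<^sup>2 > c"
        using good AE_space by eventually_elim (use neg in \<open>auto simp: not_le\<close>)
      have int: "integrable (lebesgue_on ?X) (\<lambda>t. (norm (z t))\<^sup>2 - c)" using zX by simp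
      have ge: "AE t in lebesgue_on ?X. 0 \<le> (norm (z t))\<^sup>2 - c" using gt by eventually_elim simp
      have "(\<integral>t. (norm (z t))\<^sup>2 - c \<partial>lebesgue_on ?X) = (\<integral>t. (norm (z t))\<^sup>2 \<partial>lebesgue_on ?X) - c * r"
        using zX mX by simp
      then have "(\<integral>t. (norm (z t))\<^sup>2 - c \<partial>lebesgue_on ?X) = 0"
        using integral_nonneg_AE[OF ge] zc by linarith
      then have "AE t in lebesgue_on ?X. (norm (z t))\<^sup>2 - c = 0"
        using integral_nonneg_eq_0_iff_AE[OF int ge] by simp
      with gt have "AE t in lebesgue_on ?X. False" by eventually_elim simp
      then have "ae_filter (lebesgue_on ?X) = bot" by (simp add: trivial_limit_def)
      then have "emeasure (lebesgue_on ?X) (space (lebesgue_on ?X)) = 0"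
        by (simp only: ae_filter_eq_bot_iff)
      then show False using mX r by (simp add: measure_def)
    qed
    then obtain t where t: "r < t" "t \<le> 2 * r" "emb (z t) = input_map SV B u t"
      "T \<le> r \<longrightarrow> sol y u t = 0" "(norm (z t))\<^sup>2 \<le> c" by auto
    have x: "emb (S t y + z t) = sol y u t" using t by (simp add: solution_def emb.add)
    have "norm (z t) \<le> sqrt c" using t(5) by (simp add: real_le_rsqrt)
    also have "sqrt c = \<bar>K\<bar> / sqrt r * sqrt (energy u)"
      by (simp add: c_def real_sqrt_mult real_sqrt_divide)
    finally have "norm ((S t y + z t) - S t y) \<le> \<bar>K\<bar> / sqrt r * sqrt (energy u)" by simp
    moreover have "S t y + z t = 0" if "T \<le> r"
      using x t(4) that emb_inject[of "S t y + z t" 0] by (simp add: emb.zero)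
    ultimately show ?thesis using t x by blast
  qed
  moreover have "0 \<le> \<bar>K\<bar> / sqrt r" using r by simp
  ultimately show ?thesis by blast
qed

text \<open>A functional \<open>f\<close> with \<open>f \<circ> S r = m f\<close> and \<open>\<bar>m\<bar> > 1\<close> is expanded by the free evolution, so
  steering \<open>y\<close> to rest costs at least a fixed multiple of \<open>\<bar>f y\<bar>\<^sup>2\<close>.\<close>

lemma not_NCVE_if_positive_spectrum:
  assumes r: "r > 0" and K: "sequentially_compact_operator (S r)"
    and l: "l \<in> spectrum D A" "Re l > 0"
  shows "\<not> NCVE emb S SV B"
proof
  assume ncve: "NCVE emb S SV B"
  define m where "m = exp (l * of_real r)"
  have m0: "m \<noteq> 0" by (simp add: m_def)
  have m1: "cmod m > 1" using l r by (simp add: m_def norm_exp_eq_Re)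
  obtain v where v: "v \<noteq> 0" "S r v = m *\<^sub>C v"
    using spectrum_imp_eigenvalue[OF l(1) _ K] r by (auto simp: m_def)
  \<comment> \<open>As \<open>v\<close> is fixed by the compact operator
    \<open>(1/m) *\<^sub>C S r\<close>, some nonzero vector is orthogonal to the range of one minus
    this operator. It represents the functional \<open>f\<close>.\<close>
  obtain w where w: "w \<noteq> 0" "\<And>x. cinner (x - (1/m) *\<^sub>C S r x) w = 0"
    using fredholm_orthogonal[OF sequentially_compact_scaleC[OF K], of "1/m" v] v m0
    by (auto simp: scaleC_scaleC)
  define f where "f y = cinner y w" for y
  have fK: "f (S r x) = m * f x" for x
    using w(2)[of x] m0 by (simp add: f_def cinner_diff_left cinner_scaleC_left field_simps)
  obtain C where C: "C \<ge> 0" "\<And>y u T. steers y u T \<Longrightarrow> \<exists>t x. r < t \<and> t \<le> 2 * r \<and> emb x = sol y u t \<and>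
    norm (x - S t y) \<le> C * sqrt (energy u) \<and> (T \<le> r \<longrightarrow> x = 0)"
    using exists_good_time[OF r] by blast
  obtain M where M: "M \<ge> 1" "\<And>t x. 0 \<le> t \<Longrightarrow> t \<le> r \<Longrightarrow> norm (S t x) \<le> M * norm x"
    using S_locally_bounded[of r] by blast
  define C1 where "C1 = M * C * norm w"
  \<comment> \<open>The solution of \<open>d + C1 = cmod m * d\<close>, by which the bound
    reproduces itself in the induction; it is nonnegative because \<open>cmod m > 1\<close>.\<close>
  define d where "d = C1 / (cmod m - 1)"
  have C1: "C1 \<ge> 0" using C M by (simp add: C1_def)
  have d: "d \<ge> 0" "d + C1 = cmod m * d" using C1 m1 by (simp_all add: d_def field_simps)
  \<comment> \<open>The induction is on the number of blocks of length \<open>r\<close> before rest.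
    Good times need not be multiples of \<open>r\<close>, so the bound is proved for all shifts
    \<tau> in \<open>{0..r}\<close> at once.\<close>
  have main: "cmod (f (S \<tau> y)) \<le> d * sqrt (energy u)"
    if "steers y u T" "T \<le> n * r" "0 \<le> \<tau>" "\<tau> \<le> r" for n :: nat and T y u \<tau>
    using that
  proof (induction n arbitrary: T y u \<tau>)
    have step: "cmod (f (S \<tau> y)) \<le> d * sqrt (energy u)"
      if tx: "r < t" "t \<le> 2 * r" "norm (x - S t y) \<le> C * sqrt (energy u)"
        and x: "\<And>\<tau>'. 0 \<le> \<tau>' \<Longrightarrow> \<tau>' \<le> r \<Longrightarrow> cmod (f (S \<tau>' x)) \<le> d * sqrt (energy u)"
        and \<tau>: "0 \<le> \<tau>" "\<tau> \<le> r" for t x y u \<tau>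
    proof -
      \<comment> \<open>The witness makes \<open>\<tau>' + t\<close> equal to
        \<open>\<tau> + r\<close> or \<open>\<tau> + 2 * r\<close>; one or two periods multiply
        \<open>f\<close> by \<open>m\<close> or by its square.\<close>
      have "\<exists>\<tau>'. 0 \<le> \<tau>' \<and> \<tau>' \<le> r \<and> cmod m * cmod (f (S \<tau> y)) \<le> cmod (f (S \<tau>' (S t y)))"
      proof (cases "t - r \<le> \<tau>")
        case True
        have "S (\<tau> - (t - r)) (S t y) = S (r + \<tau>) y"
          using True tx r by (subst S_plus[symmetric]) (auto simp: add.commute)
        also have "\<dots> = S r (S \<tau> y)" using \<tau> r by (intro S_plus) auto
        finally have "f (S (\<tau> - (t - r)) (S t y)) = m * f (S \<tau> y)" by (simp add: fK)
        then show ?thesis using True tx \<tau> r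
          by (intro exI[of _ "\<tau> - (t - r)"]) (simp add: norm_mult)
      next
        case False
        have "S (\<tau> - (t - r) + r) (S t y) = S (r + (r + \<tau>)) y"
          using False tx r \<tau> by (subst S_plus[symmetric]) auto
        also have "\<dots> = S r (S (r + \<tau>) y)" using \<tau> r by (intro S_plus) auto
        also have "S (r + \<tau>) y = S r (S \<tau> y)" using \<tau> r by (intro S_plus) auto
        finally have "f (S (\<tau> - (t - r) + r) (S t y)) = m * (m * f (S \<tau> y))" by (simp add: fK)
        moreover have "cmod m * cmod (f (S \<tau> y)) \<le> cmod m * (cmod m * cmod (f (S \<tau> y)))"
          using m1 mult_right_mono[of 1 "cmod m" "cmod (f (S \<tau> y))"] by (intro mult_left_mono) auto
        ultimately show ?thesis using False tx \<tau> r
          by (intro exI[of _ "\<tau> - (t - r) + r"]) (simp add: norm_mult)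
      qed
      then obtain \<tau>' where \<tau>': "0 \<le> \<tau>'" "\<tau>' \<le> r"
        "cmod m * cmod (f (S \<tau> y)) \<le> cmod (f (S \<tau>' (S t y)))" by blast
      have "f (S \<tau>' (S t y)) = f (S \<tau>' x) - f (S \<tau>' (x - S t y))"
        using \<tau>' by (simp add: S_diff f_def cinner_diff_left)
      then have "cmod (f (S \<tau>' (S t y))) \<le> cmod (f (S \<tau>' x)) + cmod (f (S \<tau>' (x - S t y)))"
        using norm_triangle_ineq4 by metis
      moreover have "cmod (f (S \<tau>' (x - S t y))) \<le> C1 * sqrt (energy u)"
      proof -
        have "cmod (f (S \<tau>' (x - S t y))) \<le> norm (S \<tau>' (x - S t y)) * norm w"
          unfolding f_def by (rule norm_cinner_le)
        also have "\<dots> \<le> (M * (C * sqrt (energy u))) * norm w"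
          using M \<tau>' tx(3) by (intro mult_right_mono order_trans[OF M(2)] mult_left_mono) auto
        finally show ?thesis by (simp add: C1_def mult_ac)
      qed
      ultimately have "cmod m * cmod (f (S \<tau> y)) \<le> d * sqrt (energy u) + C1 * sqrt (energy u)"
        using \<tau>' x[OF \<tau>'(1,2)] by linarith
      also have "\<dots> = cmod m * (d * sqrt (energy u))" using d(2) by (simp flip: distrib_right)
      finally show ?thesis by (rule mult_left_le_imp_le) (use m1 in linarith)
    qed
    {
      case 0
      \<comment> \<open>For \<open>n = 0\<close> rest is reached at time 0, so the state at the good
        time is 0.\<close>
      obtain t x where tx: "r < t" "t \<le> 2 * r" "norm (x - S t y) \<le> C * sqrt (energy u)" "x = 0"
        using C(2)[OF 0(1)] 0 r by fastforce
      show ?case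
        by (rule step[OF tx(1-3) _ 0(3,4)]) (simp add: tx(4) S_zero f_def d energy_nonneg cinner_self
            cinner_scaleC_left[of 0 0, simplified])
    next
      case (Suc n)
      obtain t x where tx: "r < t" "t \<le> 2 * r" "norm (x - S t y) \<le> C * sqrt (energy u)" "emb x = sol y u t"
        using C(2)[OF Suc.prems(1)] by blast
      let ?u = "\<lambda>s. u (t + s)"
      have st: "steers x ?u (max 0 (T - t))"
        using tx r by (intro steers_advanced[OF Suc.prems(1) _ tx(4)]) auto
      \<comment> \<open>The good time exceeds \<open>r\<close>, so restarting there uses up at least
        one block.\<close>
      have "max 0 (T - t) \<le> n * r" using Suc.prems(2) tx r by (auto simp: algebra_simps)
      have "L2_on {0..} u" using Suc.prems(1) by (simp add: steers_iff)
      then have e: "sqrt (energy ?u) \<le> sqrt (energy u)" using tx r by (simp add: L2_on_advanced)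
      show ?case
      proof (rule step[OF tx(1-3) _ Suc.prems(3,4)])
        fix \<tau>' assume "0 \<le> \<tau>'" "\<tau>' \<le> r"
        then have "cmod (f (S \<tau>' x)) \<le> d * sqrt (energy ?u)"
          by (rule Suc.IH[OF st \<open>max 0 (T - t) \<le> n * r\<close>])
        also have "\<dots> \<le> d * sqrt (energy u)" using e d by (intro mult_left_mono) auto
        finally show "cmod (f (S \<tau>' x)) \<le> d * sqrt (energy u)" .
      qed
    }
  qed
  \<comment> \<open>The bound is applied to the initial state \<open>w\<close>, at which
    \<open>f\<close> takes the value \<open>(norm w)\<^sup>2\<close>.\<close>
  have "(norm w)\<^sup>2 \<le> 0"
  proof (rule field_le_epsilon)
    fix e :: real assume e: "0 < e"
    define \<epsilon> where "\<epsilon> = e / (d + 1)"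
    have \<epsilon>: "\<epsilon> > 0" using e d by (simp add: \<epsilon>_def)
    obtain T u where Tu: "steers w u T" "energy u \<le> \<epsilon>\<^sup>2"
      using ncve \<epsilon> unfolding NCVE_def NCVE_element_def energy_def by blast
    obtain n :: nat where "T / r \<le> n" using real_arch_simple by blast
    then have "T \<le> n * r" using r by (simp add: field_simps)
    from main[OF Tu(1) this, of 0] have "cmod (f w) \<le> d * sqrt (energy u)" using r by simp
    also have "\<dots> \<le> d * \<epsilon>"
      using Tu(2) \<epsilon> d real_sqrt_le_mono[OF Tu(2)] by (intro mult_left_mono) auto
    also have "\<dots> \<le> e" using d e by (simp add: \<epsilon>_def field_simps)
    finally show "(norm w)\<^sup>2 \<le> 0 + e" by (simp add: f_def cinner_self norm_power)
  qed
  then show False using w by simp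
qed

end

section \<open>Superposition of infinitely many controls\<close>

text \<open>Cauchy-Schwarz with the weights \<open>(1/2) ^ k\<close>; their total is at most 2,
  which makes the constant independent of \<open>m\<close>.\<close>

lemma norm_sum_squared_le:
  fixes x :: "nat \<Rightarrow> 'a::real_normed_vector"
  shows "(norm (\<Sum>k<m. x k))\<^sup>2 \<le> 2 * (\<Sum>k<m. 2 ^ k * (norm (x k))\<^sup>2)"
proof -
  have "norm (\<Sum>k<m. x k) \<le> (\<Sum>k<m. norm (x k))" by (rule norm_sum)
  also have "\<dots> = (\<Sum>k<m. sqrt ((1/2) ^ k) * (sqrt (2 ^ k) * norm (x k)))"
    by (intro sum.cong) (simp_all flip: real_sqrt_mult power_mult_distrib mult.assoc)
  finally have "(norm (\<Sum>k<m. x k))\<^sup>2 \<le> (\<Sum>k<m. sqrt ((1/2) ^ k) * (sqrt (2 ^ k) * norm (x k)))\<^sup>2"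
    by (rule power_mono) simp
  also have "\<dots> \<le> (\<Sum>k<m. (sqrt ((1/2) ^ k))\<^sup>2) * (\<Sum>k<m. (sqrt (2 ^ k) * norm (x k))\<^sup>2)"
    by (rule Cauchy_Schwarz_ineq_sum)
  also have "\<dots> = (\<Sum>k<m. (1/2) ^ k) * (\<Sum>k<m. 2 ^ k * (norm (x k))\<^sup>2)"
    by (simp add: power_mult_distrib)
  also have "\<dots> \<le> 2 * (\<Sum>k<m. 2 ^ k * (norm (x k))\<^sup>2)"
  proof (rule mult_right_mono)
    have "(\<Sum>k<m. (1/2::real) ^ k) \<le> (\<Sum>k. (1/2) ^ k)"
      by (intro sum_le_suminf summable_geometric) auto
    also have "\<dots> = 2" by (simp add: suminf_geometric)
    finally show "(\<Sum>k<m. (1/2::real) ^ k) \<le> 2" .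
  qed (intro sum_nonneg, simp)
  finally show ?thesis .
qed

text \<open>Monotone convergence. \<open>W\<close> will dominate the superposed control pointwise
  and carry both its energy bound and the dominated convergence.\<close>

lemma (in complete_measure) weighted_L2_series:
  fixes f :: "nat \<Rightarrow> 'a \<Rightarrow> 'b::banach"
  assumes int: "\<And>k. integrable M (\<lambda>s. (norm (f k s))\<^sup>2)"
    and sum: "summable (\<lambda>k. 2 ^ k * (\<integral>s. (norm (f k s))\<^sup>2 \<partial>M))"
  defines "W \<equiv> \<lambda>s. \<Sum>k. 2 ^ k * (norm (f k s))\<^sup>2"
  shows "integrable M W" "(\<integral>s. W s \<partial>M) = (\<Sum>k. 2 ^ k * (\<integral>s. (norm (f k s))\<^sup>2 \<partial>M))"
    and "AE s in M. summable (\<lambda>k. 2 ^ k * (norm (f k s))\<^sup>2)"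
proof -
  have i: "integrable M (\<lambda>s. 2 ^ k * (norm (f k s))\<^sup>2)" for k using int by simp
  have "(\<integral>\<^sup>+s. (\<Sum>k. ennreal (2 ^ k * (norm (f k s))\<^sup>2)) \<partial>M)
    = (\<Sum>k. \<integral>\<^sup>+s. ennreal (2 ^ k * (norm (f k s))\<^sup>2) \<partial>M)"
    by (rule nn_integral_suminf) (use i in simp)
  also have "\<dots> = (\<Sum>k. ennreal (2 ^ k * (\<integral>s. (norm (f k s))\<^sup>2 \<partial>M)))"
    using i by (intro suminf_cong) (simp add: nn_integral_eq_integral)
  also have "\<dots> = ennreal (\<Sum>k. 2 ^ k * (\<integral>s. (norm (f k s))\<^sup>2 \<partial>M))"
    by (rule suminf_ennreal2[OF _ sum]) simp
  finally have "(\<integral>\<^sup>+s. (\<Sum>k. ennreal (2 ^ k * (norm (f k s))\<^sup>2)) \<partial>M) \<noteq> \<infinity>" by simp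
  then have "AE s in M. (\<Sum>k. ennreal (2 ^ k * (norm (f k s))\<^sup>2)) \<noteq> \<infinity>"
    using i by (intro nn_integral_PInf_AE borel_measurable_suminf) auto
  then show ae: "AE s in M. summable (\<lambda>k. 2 ^ k * (norm (f k s))\<^sup>2)"
    by eventually_elim (rule summable_suminf_not_top, auto)
  have ae': "AE s in M. summable (\<lambda>k. norm (2 ^ k * (norm (f k s))\<^sup>2))"
    using ae by eventually_elim simp
  have s': "summable (\<lambda>k. \<integral>s. norm (2 ^ k * (norm (f k s))\<^sup>2) \<partial>M)" using sum by simp
  show "integrable M W" unfolding W_def by (rule integrable_suminf[OF i ae' s'])
  show "(\<integral>s. W s \<partial>M) = (\<Sum>k. 2 ^ k * (\<integral>s. (norm (f k s))\<^sup>2 \<partial>M))"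
    unfolding W_def using integral_suminf[OF i ae' s'] by simp
qed

text \<open>Completing a square gives
  \<open>norm (x k) \<le> (1/2) ^ k + 2 ^ k * (norm (x k))\<^sup>2\<close>. The last bound is
  independent of \<open>m\<close> and serves as a majorant for the tails.\<close>

lemma summable_weighted_squares:
  fixes x :: "nat \<Rightarrow> 'a::banach"
  assumes s: "summable (\<lambda>k. 2 ^ k * (norm (x k))\<^sup>2)"
  shows "summable x"
    and "(norm (\<Sum>k. x k))\<^sup>2 \<le> 2 * (\<Sum>k. 2 ^ k * (norm (x k))\<^sup>2)"
    and "norm ((\<Sum>k. x k) - (\<Sum>k<m. x k)) \<le> 2 + (\<Sum>k. 2 ^ k * (norm (x k))\<^sup>2)"
proof -
  have le: "norm (x k) \<le> (1/2) ^ k + 2 ^ k * (norm (x k))\<^sup>2" for k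
  proof -
    have "0 \<le> (1/2) ^ k * (2 ^ k * norm (x k) - 1)\<^sup>2" by simp
    also have "\<dots> = 2 ^ k * (norm (x k))\<^sup>2 - 2 * norm (x k) + (1/2) ^ k"
      by (simp add: power2_eq_square field_simps power_one_over)
    finally show ?thesis using norm_ge_zero[of "x k"] by linarith
  qed
  have sg: "summable (\<lambda>k. (1/2::real) ^ k)" by (rule summable_geometric) simp
  have ss: "summable (\<lambda>k. (1/2) ^ k + 2 ^ k * (norm (x k))\<^sup>2)" by (intro summable_add sg s)
  have sn: "summable (\<lambda>k. norm (x k))" by (rule summable_comparison_test'[OF ss]) (use le in simp)
  then show sx: "summable x" by (rule summable_norm_cancel)
  show "(norm (\<Sum>k. x k))\<^sup>2 \<le> 2 * (\<Sum>k. 2 ^ k * (norm (x k))\<^sup>2)"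
  proof (rule LIMSEQ_le_const2)
    show "(\<lambda>m. (norm (\<Sum>k<m. x k))\<^sup>2) \<longlonglongrightarrow> (norm (\<Sum>k. x k))\<^sup>2"
      by (intro tendsto_intros summable_LIMSEQ sx)
    have "(norm (\<Sum>k<m. x k))\<^sup>2 \<le> 2 * (\<Sum>k. 2 ^ k * (norm (x k))\<^sup>2)" for m
      using norm_sum_squared_le[of x m] sum_le_suminf[OF s, of "{..<m}"] by force
    then show "\<exists>N. \<forall>m\<ge>N. (norm (\<Sum>k<m. x k))\<^sup>2 \<le> 2 * (\<Sum>k. 2 ^ k * (norm (x k))\<^sup>2)" by blast
  qed
  have "(\<Sum>k. x k) - (\<Sum>k<m. x k) = (\<Sum>k. x (k + m))" using suminf_minus_initial_segment[OF sx] by simp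
  also have "norm \<dots> \<le> (\<Sum>k. norm (x (k + m)))" by (rule summable_norm[OF summable_ignore_initial_segment[OF sn]])
  also have "\<dots> = (\<Sum>k. norm (x k)) - (\<Sum>k<m. norm (x k))" by (rule suminf_minus_initial_segment[OF sn])
  also have "\<dots> \<le> (\<Sum>k. norm (x k))" by (simp add: sum_nonneg)
  also have "\<dots> \<le> (\<Sum>k. (1/2) ^ k + 2 ^ k * (norm (x k))\<^sup>2)" by (intro suminf_le sn ss le)
  also have "\<dots> = 2 + (\<Sum>k. 2 ^ k * (norm (x k))\<^sup>2)"
    by (subst suminf_add[OF sg s, symmetric]) (simp add: suminf_geometric)
  finally show "norm ((\<Sum>k. x k) - (\<Sum>k<m. x k)) \<le> 2 + (\<Sum>k. 2 ^ k * (norm (x k))\<^sup>2)" .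
qed

context control_system
begin

lemma steers_zero: "T \<ge> 0 \<Longrightarrow> steers 0 (\<lambda>_. 0) T"
proof -
  assume T: "T \<ge> 0"
  have u: "L2_on {0..} (\<lambda>_. 0 :: 'u)" by (simp add: L2_on_def strongly_measurable_simple)
  have "input_map SV B (\<lambda>_. 0) t = 0" for t
    by (rule input_map_AE_zero[OF L2_on_imp_L1_on[OF u]]) simp
  then have "sol 0 (\<lambda>_. 0) t = 0" if "t \<ge> 0" for t using that by (simp add: solution_def S_zero emb.zero)
  then show ?thesis using u T by (auto simp: steers_iff supported_upto_iff)
qed

lemma steers_sum:
  fixes y :: "nat \<Rightarrow> 'h"
  assumes "T \<ge> 0" "\<And>k. steers (y k) (u k) T"
  shows "steers (\<Sum>k<m. y k) (\<lambda>s. \<Sum>k<m. u k s) T"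
proof (induction m)
  case (Suc m)
  show ?case using steers_add[OF Suc assms(2)[of m]] by simp
qed (simp add: steers_zero assms)

text \<open>The decay \<open>(1/16) ^ k\<close> beats the weights \<open>2 ^ k\<close>, so the
  partial sums converge almost everywhere with an integrable majorant, and the common time
  \<open>T\<close> lets supports pass to the limit. The constant 4 combines the factor 2 of the
  weighted estimate with the crude bound 2 for the sum 8/7 of the powers of 1/8.\<close>

lemma steers_series:
  assumes st: "\<And>k. steers (y k) (u k) T" and e: "\<And>k. energy (u k) \<le> b * (1/16) ^ k"
    and y: "(\<lambda>m. \<Sum>k<m. y k) \<longlonglongrightarrow> x"
  shows "\<exists>v. steers x v T \<and> energy v \<le> 4 * b"
proof -
  have T: "T \<ge> 0" and u: "\<And>k. L2_on {0..} (u k)" using st by (auto simp: steers_iff)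
  have b: "b \<ge> 0" using e[of 0] energy_nonneg[of "u 0"] by simp
  define W where "W s = (\<Sum>k. 2 ^ k * (norm (u k s))\<^sup>2)" for s
  define v where "v s = (\<Sum>k. u k s)" for s
  define V where "V m s = (\<Sum>k<m. u k s)" for m s
  interpret L: complete_measure "lebesgue_on {0::real..}" by (rule complete_measure_lebesgue_on) simp
  have int: "integrable (lebesgue_on {0..}) (\<lambda>s. (norm (u k s))\<^sup>2)" for k using u by (simp add: L2_on_def)
  have le8: "2 ^ k * energy (u k) \<le> b * (1/8) ^ k" for k
  proof -
    have "2 ^ k * energy (u k) \<le> 2 ^ k * (b * (1/16) ^ k)" using e by (intro mult_left_mono) auto
    also have "\<dots> = b * (1/8) ^ k" by (simp flip: power_mult_distrib)
    finally show ?thesis .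
  qed
  have s8: "summable (\<lambda>k. b * (1/8) ^ k)" by (intro summable_mult summable_geometric) simp
  have sum: "summable (\<lambda>k. 2 ^ k * energy (u k))"
    by (rule summable_comparison_test'[OF s8]) (simp add: le8 energy_nonneg abs_of_nonneg[OF mult_nonneg_nonneg])
  note series = L.weighted_L2_series[OF int sum[unfolded energy_def]]
  have W: "integrable (lebesgue_on {0..}) W" "(\<integral>s. W s \<partial>lebesgue_on {0..}) = (\<Sum>k. 2 ^ k * energy (u k))"
    "AE s in lebesgue_on {0..}. summable (\<lambda>k. 2 ^ k * (norm (u k s))\<^sup>2)"
    using series unfolding energy_def W_def[abs_def] by blast+
  have "(\<integral>s. W s \<partial>lebesgue_on {0..}) \<le> (\<Sum>k. b * (1/8) ^ k)"
    unfolding W(2) by (intro suminf_le sum s8 le8)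
  also have "\<dots> = b * (8 / 7)" by (subst suminf_mult) (auto simp: suminf_geometric intro: summable_geometric)
  finally have W_le: "(\<integral>s. W s \<partial>lebesgue_on {0..}) \<le> 2 * b" using b by linarith
  have AEv: "AE s in lebesgue_on {0..}. (\<lambda>m. V m s) \<longlonglongrightarrow> v s"
    using W(3) unfolding V_def v_def
    by eventually_elim (rule summable_LIMSEQ[OF summable_weighted_squares(1)])
  have AEW: "AE s in lebesgue_on {0..}. (norm (v s))\<^sup>2 \<le> 2 * W s"
    using W(3) unfolding v_def W_def by eventually_elim (rule summable_weighted_squares(2))
  have AEd: "AE s in lebesgue_on {0..}. \<forall>m. norm (v s - V m s) \<le> 2 + W s"
    using W(3) unfolding v_def V_def W_def
    by eventually_elim (intro allI summable_weighted_squares(3))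
  have stV: "steers (\<Sum>k<m. y k) (V m) T" for m unfolding V_def by (rule steers_sum[OF T st])
  have VL2: "L2_on {0..} (V m)" for m using stV by (simp add: steers_iff)
  have restrict: "AE s in lebesgue_on {0..t}. P s" if "AE s in lebesgue_on {0..}. P s" for P and t :: real
    using that unfolding AE_lebesgue_on_iff[OF sets_lebesgue_intervals(1)] AE_lebesgue_on_iff[OF sets_lebesgue_intervals(2)]
    by eventually_elim auto
  have vm: "strongly_measurable (lebesgue_on {0..t}) v" for t :: real
  proof -
    interpret complete_measure "lebesgue_on {0..t}" by (rule complete_measure_lebesgue_on) simp
    show ?thesis
      by (rule strongly_measurable_limit[OF _ _ restrict[OF AEv]])
        (use L2_on_imp_L1_on[OF VL2] in \<open>auto simp: L1_on_def\<close>)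
  qed
  have Wt: "integrable (lebesgue_on {0..t}) W" for t :: real
    by (rule integrable_lebesgue_on_subset[OF W(1)]) auto
  have vL2: "L2_on {0..t} v" for t :: real
  proof -
    interpret complete_measure "lebesgue_on {0..t}" by (rule complete_measure_lebesgue_on) simp
    have "integrable (lebesgue_on {0..t}) (\<lambda>s. (norm (v s))\<^sup>2)"
    proof (rule Bochner_Integration.integrable_bound)
      show "integrable (lebesgue_on {0..t}) (\<lambda>s. 2 * W s)" using Wt by simp
      show "(\<lambda>s. (norm (v s))\<^sup>2) \<in> borel_measurable (lebesgue_on {0..t})"
        using strongly_measurable_imp_borel[OF vm, of "\<lambda>x. (norm x)\<^sup>2"] by (auto intro!: continuous_intros)
      show "AE s in lebesgue_on {0..t}. norm ((norm (v s))\<^sup>2) \<le> norm (2 * W s)"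
        using restrict[OF AEW] by eventually_elim simp
    qed
    then show ?thesis using vm by (simp add: L2_on_def)
  qed
  have suppv: "supported_upto T v"
  proof -
    have "AE s in lebesgue. \<forall>k. 0 \<le> s \<longrightarrow> T < s \<longrightarrow> u k s = 0"
      unfolding AE_all_countable using st by (simp add: steers_iff supported_upto_iff)
    then show ?thesis unfolding supported_upto_iff by eventually_elim (auto simp: v_def)
  qed
  \<comment> \<open>Countably many null sets are discarded at once. At each remaining time after
    \<open>T\<close> all partial solutions vanish, and they converge in \<open>'v\<close> because
    the input map is bounded there by the integral of the norm of the control.\<close>
  have "AE t in lebesgue. \<forall>m. 0 \<le> t \<longrightarrow> T < t \<longrightarrow> sol (\<Sum>k<m. y k) (V m) t = 0"
    unfolding AE_all_countable using stV by (simp add: steers_iff supported_upto_iff)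
  then have supps: "supported_upto T (sol x v)"
    unfolding supported_upto_iff
  proof eventually_elim
    case (elim t)
    show ?case
    proof (intro impI)
      assume t: "0 \<le> t" "T < t"
      have v1: "L1_on {0..t} v"
        using vL2[of t] L2_on_imp_integrable_norm[of "{0..t}" v] by (auto simp: L1_on_def L2_on_def)
      have V1: "L1_on {0..t} (\<lambda>s. (-1) *\<^sub>C V m s)" for m
        by (rule L1_on_scaleC[OF L2_on_imp_L1_on[OF VL2]])
      define \<delta> where "\<delta> m s = v s + (-1) *\<^sub>C V m s" for m s
      have \<delta>1: "L1_on {0..t} (\<delta> m)" for m unfolding \<delta>_def by (rule L1_on_add[OF v1 V1]) simp
      have \<delta>_norm: "norm (\<delta> m s) = norm (v s - V m s)" for m s by (simp add: \<delta>_def scaleC_minus1)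
      have \<delta>_input: "input_map SV B (\<delta> m) t = input_map SV B v t - input_map SV B (V m) t" for m
        unfolding \<delta>_def input_map_add[OF v1 V1] input_map_scaleC[OF L2_on_imp_L1_on[OF VL2]]
        by (simp add: scaleC_minus1)
      obtain k where k: "k \<ge> 0"
        "\<And>t' s w. 0 \<le> s \<Longrightarrow> s \<le> t' \<Longrightarrow> t' \<le> t \<Longrightarrow> norm (SV (t' - s) (B w)) \<le> k * norm w"
        using integrand_bounded[of t] by blast
      interpret F: finite_measure "lebesgue_on {0..t}" by (rule finite_measure_lebesgue_on) simp
      have "(\<lambda>m. \<integral>s. norm (\<delta> m s) \<partial>lebesgue_on {0..t}) \<longlonglongrightarrow> (\<integral>s. 0 \<partial>lebesgue_on {0..t})"
      proof (rule integral_dominated_convergence[where w = "\<lambda>s. 2 + W s"])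
        show "AE s in lebesgue_on {0..t}. (\<lambda>m. norm (\<delta> m s)) \<longlonglongrightarrow> 0"
          using restrict[OF AEv]
        proof eventually_elim
          case (elim s)
          have "(\<lambda>m. v s - V m s) \<longlonglongrightarrow> v s - v s" by (intro tendsto_intros elim)
          then show ?case unfolding \<delta>_norm by (intro tendsto_norm_zero) simp
        qed
        show "AE s in lebesgue_on {0..t}. norm (norm (\<delta> m s)) \<le> 2 + W s" for m
          using restrict[OF AEd] by eventually_elim (simp add: \<delta>_norm)
      qed (use \<delta>1 Wt in \<open>auto simp: L1_on_def\<close>)
      then have lim0: "(\<lambda>m. k * (\<integral>s. norm (\<delta> m s) \<partial>lebesgue_on {0..t})) \<longlonglongrightarrow> 0"
        by (intro tendsto_mult_right_zero) simp
      have "(\<lambda>m. input_map SV B v t - input_map SV B (V m) t) \<longlonglongrightarrow> 0"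
        unfolding \<delta>_input[symmetric]
        by (rule Lim_null_comparison[OF _ lim0]) (use norm_input_map_le[OF \<delta>1] k(2) in simp)
      moreover have "(\<lambda>m. emb (S t (x - (\<Sum>k<m. y k)))) \<longlonglongrightarrow> emb (S t (x - x))"
        by (intro emb.tendsto bounded_linear.tendsto[OF bounded_linear_S[OF t(1)]] tendsto_intros y)
      ultimately have "(\<lambda>m. emb (S t (x - (\<Sum>k<m. y k))) + (input_map SV B v t - input_map SV B (V m) t)) \<longlonglongrightarrow> 0"
        using t tendsto_add by (fastforce simp: S_zero emb.zero)
      moreover have "emb (S t (x - (\<Sum>k<m. y k))) + (input_map SV B v t - input_map SV B (V m) t)
        = sol x v t - sol (\<Sum>k<m. y k) (V m) t" for m
        using t by (simp add: solution_def S_diff emb.diff)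
      moreover have "sol (\<Sum>k<m. y k) (V m) t = 0" for m using elim t by blast
      ultimately have "(\<lambda>m::nat. sol x v t) \<longlonglongrightarrow> 0" by simp
      then show "sol x v t = 0" by (simp add: LIMSEQ_const_iff)
    qed
  qed
  have "steers x v T"
    unfolding steers_to_rest_def using T vL2 suppv supps by (simp add: L2_loc_def)
  moreover have "energy v \<le> (\<integral>s. 2 * W s \<partial>lebesgue_on {0..})"
    unfolding energy_def
    by (rule integral_mono_AE[OF _ _ AEW]) (use \<open>steers x v T\<close> W in \<open>auto simp: steers_iff L2_on_def\<close>)
  then have "energy v \<le> 4 * b" using W_le by simp
  ultimately show ?thesis by blast
qed

end

section \<open>The steering cost\<close>

context control_system
begin

text \<open>The steering time is left free, so that delayed controls compete.\<close>

definition steering_cost :: "'h \<Rightarrow> real" where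
  "steering_cost y = Inf {energy u |u. \<exists>T. steers y u T}"

lemma steering_cost_le: "steers y u T \<Longrightarrow> steering_cost y \<le> energy u"
  unfolding steering_cost_def
  by (rule cInf_lower) (auto intro!: bdd_belowI[of _ 0] energy_nonneg)

context
  assumes controllable: "\<And>y. \<exists>T u. steers y u T"
begin

lemma steers_near_cost:
  assumes "steering_cost y < c"
  shows "\<exists>u T. steers y u T \<and> energy u < c"
proof -
  have "{energy u |u. \<exists>T. steers y u T} \<noteq> {}" using controllable[of y] by blast
  moreover have "bdd_below {energy u |u. \<exists>T. steers y u T}"
    by (auto intro!: bdd_belowI[of _ 0] energy_nonneg)
  ultimately show ?thesis
    using cInf_less_iff[of "{energy u |u. \<exists>T. steers y u T}" c] assms unfolding steering_cost_def by blast
qed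

lemma steering_cost_nonneg: "steering_cost y \<ge> 0"
proof (rule ccontr)
  assume "\<not> steering_cost y \<ge> 0"
  then obtain u T where "steers y u T" "energy u < 0" using steers_near_cost[of y 0] by auto
  then show False using energy_nonneg[of u] by simp
qed

text \<open>The factor 2 from squaring a sum is harmless: below only zeros and boundedness of the
  cost matter.\<close>

lemma steering_cost_add: "steering_cost (x + y) \<le> 2 * steering_cost x + 2 * steering_cost y"
proof (rule field_le_epsilon)
  fix e :: real assume e: "0 < e"
  obtain u T where u: "steers x u T" "energy u < steering_cost x + e / 4"
    using steers_near_cost[of x "steering_cost x + e / 4"] e by auto
  obtain v T' where v: "steers y v T'" "energy v < steering_cost y + e / 4"
    using steers_near_cost[of y "steering_cost y + e / 4"] e by auto
  have "steers (x + y) (\<lambda>s. u s + v s) (max T T')"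
    by (intro steers_add steers_mono[OF u(1)] steers_mono[OF v(1)]) auto
  then have "steering_cost (x + y) \<le> energy (\<lambda>s. u s + v s)" by (rule steering_cost_le)
  also have "\<dots> \<le> 2 * energy u + 2 * energy v"
    using u v by (intro energy_add_le) (auto simp: steers_iff)
  finally show "steering_cost (x + y) \<le> 2 * steering_cost x + 2 * steering_cost y + e"
    using u v by simp
qed

lemma steering_cost_scaleC: "steering_cost (c *\<^sub>C y) \<le> (cmod c)\<^sup>2 * steering_cost y"
proof (rule field_le_epsilon)
  fix e :: real assume e: "0 < e"
  define d where "d = e / ((cmod c)\<^sup>2 + 1)"
  have p: "(cmod c)\<^sup>2 + 1 > 0" by (rule add_nonneg_pos) auto
  have d: "d > 0" "(cmod c)\<^sup>2 * d \<le> e"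
    using e p by (simp_all add: d_def field_simps)
  obtain u T where u: "steers y u T" "energy u < steering_cost y + d"
    using steers_near_cost[of y "steering_cost y + d"] d by auto
  have "steering_cost (c *\<^sub>C y) \<le> (cmod c)\<^sup>2 * energy u"
    using steering_cost_le[OF steers_scaleC[OF u(1)]] by (simp add: energy_scaleC)
  also have "\<dots> \<le> (cmod c)\<^sup>2 * (steering_cost y + d)" using u by (intro mult_left_mono) auto
  finally show "steering_cost (c *\<^sub>C y) \<le> (cmod c)\<^sup>2 * steering_cost y + e"
    using d by (simp add: algebra_simps)
qed

text \<open>Waiting is free: a control for \<open>S t y\<close>, delayed by \<open>t\<close>, steers
  \<open>y\<close> with the same energy.\<close>

lemma steering_cost_S:
  assumes "t \<ge> 0"
  shows "steering_cost y \<le> steering_cost (S t y)"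
proof (rule field_le_epsilon)
  fix e :: real assume e: "0 < e"
  obtain u T where u: "steers (S t y) u T" "energy u < steering_cost (S t y) + e"
    using steers_near_cost[of "S t y" "steering_cost (S t y) + e"] e by auto
  have "L2_on {0..} u" using u by (simp add: steers_iff)
  from steering_cost_le[OF steers_delayed[OF u(1) assms]] L2_on_delayed(2)[OF this assms] u(2)
  show "steering_cost y \<le> steering_cost (S t y) + e" by simp
qed

text \<open>Baire's theorem gives a uniform time and an approximate steering on a ball; the remainders are
  then steered iteratively, all within the same time.\<close>

lemma uniform_steering:
  "\<exists>c\<ge>0. \<forall>y. \<exists>u T. steers y u T \<and> energy u \<le> c * (norm y)\<^sup>2"
proof -
  define F where "F n = {y. \<exists>u. steers y u (real n) \<and> energy u \<le> real n}" for n
  have "y \<in> (\<Union>n. closure (F n))" for y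
  proof -
    obtain T u where Tu: "steers y u T" using controllable by blast
    obtain n :: nat where "max T (energy u) \<le> n" using real_arch_simple by blast
    then have "y \<in> F n" using steers_mono[OF Tu, of n] by (auto simp: F_def)
    then show ?thesis using closure_subset by blast
  qed
  then have "(\<Union>n. closure (F n)) = UNIV" by blast
  then obtain n where "interior (closure (F n)) \<noteq> {}"
    using baire_closed_union[of "\<lambda>n. closure (F n)"] by auto
  then obtain a e where e: "e > 0" "cball a e \<subseteq> closure (F n)"
    by (metis ex_in_conv mem_interior_cball)
  \<comment> \<open>Half the difference of approximations to \<open>a + y\<close> and
    \<open>a - y\<close> removes the centre \<open>a\<close>. Its energy is at most
    \<open>(1/4) * (2 * n + 2 * n) = n\<close>, so neither time nor energy grows.\<close>
  have unit: "\<exists>p u. steers p u n \<and> energy u \<le> n \<and> norm (y - p) < \<delta>" if y: "norm y \<le> e" and \<delta>: "\<delta> > 0" for y \<delta>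
  proof -
    have "a + y \<in> closure (F n)" "a - y \<in> closure (F n)" using e y by (auto simp: subset_eq dist_norm)
    then obtain p q where p: "p \<in> F n" "norm (p - (a + y)) < \<delta>" and q: "q \<in> F n" "norm (q - (a - y)) < \<delta>"
      using \<delta> unfolding closure_approachable dist_norm by blast
    obtain u v where u: "steers p u n" "energy u \<le> n" and v: "steers q v n" "energy v \<le> n"
      using p q by (auto simp: F_def)
    have L2: "L2_on {0..} u" "L2_on {0..} (\<lambda>s. (-1) *\<^sub>C v s)"
      using u v by (auto simp: steers_iff intro: L2_on_scaleC)
    let ?w = "\<lambda>s. (1/2) *\<^sub>C (u s + (-1) *\<^sub>C v s)" and ?p = "(1/2) *\<^sub>C (p + (-1) *\<^sub>C q)"
    have "steers ?p ?w n" by (intro steers_scaleC steers_add u v)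
    moreover have "energy ?w \<le> (1/4) * (2 * energy u + 2 * energy v)"
      using energy_add_le[OF L2] unfolding energy_scaleC by (simp add: energy_scaleC power2_eq_square)
    then have "energy ?w \<le> n" using u v by simp
    moreover have "y - ?p = (1/2) *\<^sub>R ((q - (a - y)) - (p - (a + y)))"
      using scaleC_of_real[of "1/2" "p - q"]
      by (simp add: scaleC_minus1 algebra_simps flip: scaleR_add_left)
    then have "norm (y - ?p) < \<delta>"
      using p q norm_triangle_ineq4[of "q - (a - y)" "p - (a + y)"] by simp
    ultimately show ?thesis by blast
  qed
  \<comment> \<open>\<open>unit\<close> rescaled by \<open>(1/4) ^ k\<close>, with energies scaled
    by the square of this factor. The implication stands under the quantifiers so that
    \<open>P\<close> and \<open>U\<close> can be chosen for every \<open>r\<close>.\<close>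
  have step: "\<exists>p u. norm r \<le> e * (1/4) ^ k \<longrightarrow>
    steers p u n \<and> energy u \<le> n * (1/16) ^ k \<and> norm (r - p) \<le> e * (1/4) ^ Suc k" for r k
  proof (cases "norm r \<le> e * (1/4) ^ k")
    case True
    define c :: complex where "c = (1/4) ^ k"
    have c: "cmod c = (1/4) ^ k" "c \<noteq> 0" by (simp_all add: c_def norm_power norm_divide)
    have c2: "(cmod c)\<^sup>2 = (1/16) ^ k" by (simp add: c power2_eq_square flip: power_mult_distrib)
    have "norm r / cmod c \<le> e" using True c by (subst pos_divide_le_eq) simp_all
    then have "norm ((1/c) *\<^sub>C r) \<le> e" by (simp add: norm_scaleC norm_divide)
    from unit[OF this, of "e / 4"] e obtain p u where pu: "steers p u n" "energy u \<le> n"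
      "norm ((1/c) *\<^sub>C r - p) < e / 4" by auto
    have "steers (c *\<^sub>C p) (\<lambda>s. c *\<^sub>C u s) n" by (rule steers_scaleC[OF pu(1)])
    moreover have "energy (\<lambda>s. c *\<^sub>C u s) \<le> n * (1/16) ^ k"
      unfolding energy_scaleC c2 using pu(2) by (simp add: mult.commute)
    moreover have "r - c *\<^sub>C p = c *\<^sub>C ((1/c) *\<^sub>C r - p)"
      using c by (simp add: scaleC_diff_right scaleC_scaleC)
    then have "norm (r - c *\<^sub>C p) = (1/4) ^ k * norm ((1/c) *\<^sub>C r - p)"
      by (simp only: norm_scaleC c(1))
    then have "norm (r - c *\<^sub>C p) \<le> (1/4) ^ k * (e / 4)" using pu(3) by simp
    then have "norm (r - c *\<^sub>C p) \<le> e * (1/4) ^ Suc k" by (simp add: mult.commute)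
    ultimately show ?thesis by blast
  qed blast
  then obtain P U where PU: "\<And>r k. norm r \<le> e * (1/4) ^ k \<Longrightarrow> steers (P r k) (U r k) n \<and>
    energy (U r k) \<le> n * (1/16) ^ k \<and> norm (r - P r k) \<le> e * (1/4) ^ Suc k" by metis
  have ball: "\<exists>u. steers y u n \<and> energy u \<le> 4 * n" if y: "norm y \<le> e" for y
  proof -
    \<comment> \<open>The remainders after \<open>k\<close> corrections; the corrections telescope
      to \<open>y - r m\<close>.\<close>
    define r where "r = rec_nat y (\<lambda>k z. z - P z k)"
    have r0: "r 0 = y" and rS: "r (Suc k) = r k - P (r k) k" for k by (simp_all add: r_def)
    have rb: "norm (r k) \<le> e * (1/4) ^ k" for k
      by (induction k) (use y PU in \<open>simp_all add: r0 rS\<close>)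
    have sum: "(\<Sum>k<m. P (r k) k) = y - r m" for m
      by (induction m) (simp_all add: r0 rS)
    have lim: "(\<lambda>k. e * (1/4) ^ k) \<longlonglongrightarrow> 0"
      by (intro tendsto_mult_right_zero LIMSEQ_realpow_zero) auto
    have "r \<longlonglongrightarrow> 0"
      by (rule Lim_null_comparison[OF _ lim]) (use rb in simp)
    then have "(\<lambda>m. y - r m) \<longlonglongrightarrow> y - 0" by (intro tendsto_intros)
    then show ?thesis
      using steers_series[of "\<lambda>k. P (r k) k" "\<lambda>k. U (r k) k" n n y] PU[OF rb] by (simp add: sum)
  qed
  have "\<exists>u T. steers y u T \<and> energy u \<le> (4 * n / e\<^sup>2) * (norm y)\<^sup>2" for y
  proof (cases "y = 0")
    case True
    then show ?thesis using steers_zero[of 0] by (intro exI[of _ "\<lambda>_. 0"] exI[of _ 0]) (simp add: energy_def)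
  next
    case False
    define c :: complex where "c = of_real (norm y / e)"
    have c: "cmod c = norm y / e" "c \<noteq> 0" using False e by (simp_all add: c_def norm_divide)
    have "norm ((1/c) *\<^sub>C y) \<le> e" using False e c by (simp add: norm_scaleC norm_divide)
    from ball[OF this] obtain u where u: "steers ((1/c) *\<^sub>C y) u n" "energy u \<le> 4 * n" by blast
    have "steers y (\<lambda>s. c *\<^sub>C u s) n"
      using steers_scaleC[OF u(1), of c] c by (simp add: scaleC_scaleC)
    moreover have "energy (\<lambda>s. c *\<^sub>C u s) \<le> (norm y / e)\<^sup>2 * (4 * n)"
      unfolding energy_scaleC c(1) using u(2) by (intro mult_left_mono) auto
    ultimately show ?thesis by (intro exI[of _ "\<lambda>s. c *\<^sub>C u s"] exI[of _ "real n"]) (simp add: power_divide field_simps)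
  qed
  then show ?thesis by (intro exI[of _ "4 * n / e\<^sup>2"]) auto
qed

lemma steering_cost_bounded: "\<exists>c\<ge>0. \<forall>y. steering_cost y \<le> c * (norm y)\<^sup>2"
  using uniform_steering steering_cost_le by (meson order_trans)

text \<open>If \<open>u\<close> steers \<open>y\<close> to rest before the time at which a delayed control \<open>d\<close> sets in, then so does
  \<open>\<epsilon>u + (1 - \<epsilon>)d\<close>, and the energies of the disjoint pieces add up: \<open>m \<le> \<epsilon>\<^sup>2m + (1 - \<epsilon>)\<^sup>2b\<close>
  for the cost \<open>m\<close> of \<open>y\<close>. Letting \<open>\<epsilon>\<close> tend to 1 gives \<open>m = 0\<close>.\<close>

lemma steering_cost_eq_0_if_bounded:
  assumes r: "r > 0" and b: "\<And>n. steering_cost (S (real n * r) y) \<le> b"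
  shows "steering_cost y = 0"
proof (rule ccontr)
  define m where "m = steering_cost y"
  assume "steering_cost y \<noteq> 0"
  then have m: "m > 0" using steering_cost_nonneg[of y] by (simp add: m_def)
  define c where "c = b + 1"
  have c: "c > 0" using b[of 0] steering_cost_nonneg[of "S (real 0 * r) y"] unfolding c_def by linarith
  have key: "m \<le> \<epsilon>\<^sup>2 * (m + \<eta>) + (1 - \<epsilon>)\<^sup>2 * c" if \<eta>: "\<eta> > 0" for \<epsilon> \<eta> :: real
  proof -
    obtain u T where u: "steers y u T" "energy u < m + \<eta>"
      using steers_near_cost[of y "m + \<eta>"] \<eta> by (auto simp: m_def)
    obtain n :: nat where "T / r \<le> n" using real_arch_simple by blast
    define \<tau> where "\<tau> = real n * r"
    have \<tau>: "T \<le> \<tau>" "\<tau> \<ge> 0" using \<open>T / r \<le> n\<close> r by (simp_all add: \<tau>_def field_simps)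
    have "steering_cost (S \<tau> y) < c" using b[of n] by (simp add: c_def \<tau>_def)
    then obtain v T' where v: "steers (S \<tau> y) v T'" "energy v < c"
      using steers_near_cost by blast
    let ?d = "delayed \<tau> v"
    have vL2: "L2_on {0..} v" using v by (simp add: steers_iff)
    have d: "steers y ?d (\<tau> + T')" "energy ?d < c"
      using steers_delayed[OF v(1) \<tau>(2)] L2_on_delayed(2)[OF vL2 \<tau>(2)] v(2) by auto
    have T': "T' \<ge> 0" using v by (simp add: steers_iff)
    let ?w = "\<lambda>s. of_real \<epsilon> *\<^sub>C u s + of_real (1 - \<epsilon>) *\<^sub>C ?d s"
    have "steers (of_real \<epsilon> *\<^sub>C y + of_real (1 - \<epsilon>) *\<^sub>C y) ?w (\<tau> + T')"
      using \<tau> T' by (intro steers_add steers_scaleC d steers_mono[OF u(1)]) auto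
    then have w: "steers y ?w (\<tau> + T')" by (simp flip: scaleC_add_left)
    have uL2: "L2_on {0..} u" and dL2: "L2_on {0..} ?d" and wL2: "L2_on {0..} ?w"
      using u d w by (auto simp: steers_iff)
    have "AE s in lebesgue. 0 \<le> s \<longrightarrow> T < s \<longrightarrow> u s = 0"
      using u by (simp add: steers_iff supported_upto_iff)
    moreover have "AE s in lebesgue. s \<noteq> T" by (intro AE_I[of _ _ "{T}"]) auto
    ultimately have "AE s in lebesgue. s \<in> {0..} \<longrightarrow> (norm (?w s))\<^sup>2 = \<epsilon>\<^sup>2 * (norm (u s))\<^sup>2 + (1 - \<epsilon>)\<^sup>2 * (norm (?d s))\<^sup>2"
    proof eventually_elim
      case (elim s)
      show ?case
      proof
        assume s: "s \<in> {0..}"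
        \<comment> \<open>Before \<tau> the delayed control vanishes; from \<tau> on,
          \<open>s \<noteq> T\<close> forces \<open>T < s\<close>, where \<open>u\<close> vanishes.
          The point \<open>T\<close> is excluded because \<tau> may equal \<open>T\<close>.\<close>
        consider "?d s = 0" | "u s = 0"
          using elim s \<tau> by (cases "s < \<tau>") (auto simp: delayed_def)
        then show "(norm (?w s))\<^sup>2 = \<epsilon>\<^sup>2 * (norm (u s))\<^sup>2 + (1 - \<epsilon>)\<^sup>2 * (norm (?d s))\<^sup>2"
          by cases (simp_all add: norm_scaleC power_mult_distrib del: of_real_diff)
      qed
    qed
    then have ae: "AE s in lebesgue_on {0..}. (norm (?w s))\<^sup>2 = \<epsilon>\<^sup>2 * (norm (u s))\<^sup>2 + (1 - \<epsilon>)\<^sup>2 * (norm (?d s))\<^sup>2"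
      by (simp only: AE_lebesgue_on_iff[OF sets_lebesgue_intervals(1)])
    have "energy ?w = (\<integral>s. \<epsilon>\<^sup>2 * (norm (u s))\<^sup>2 + (1 - \<epsilon>)\<^sup>2 * (norm (?d s))\<^sup>2 \<partial>lebesgue_on {0..})"
      unfolding energy_def using uL2 dL2 wL2
      by (intro integral_cong_AE ae) (auto simp: L2_on_def intro!: borel_measurable_integrable)
    also have "\<dots> = \<epsilon>\<^sup>2 * energy u + (1 - \<epsilon>)\<^sup>2 * energy ?d"
      using uL2 dL2 by (simp add: energy_def L2_on_def)
    also have "\<dots> \<le> \<epsilon>\<^sup>2 * (m + \<eta>) + (1 - \<epsilon>)\<^sup>2 * c"
      using u d by (intro add_mono mult_left_mono) auto
    finally show ?thesis using steering_cost_le[OF w] by (simp add: m_def)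
  qed
  have key': "m \<le> \<epsilon>\<^sup>2 * m + (1 - \<epsilon>)\<^sup>2 * c" if "0 < \<epsilon>" for \<epsilon> :: real
  proof (rule field_le_epsilon)
    fix \<eta> :: real assume "0 < \<eta>"
    then show "m \<le> \<epsilon>\<^sup>2 * m + (1 - \<epsilon>)\<^sup>2 * c + \<eta>"
      using key[of "\<eta> / \<epsilon>\<^sup>2" \<epsilon>] that by (simp add: algebra_simps)
  qed
  \<comment> \<open>With \<open>1 - \<delta>\<close> for \<epsilon>, division by \<delta> leaves
    \<open>m * (2 - \<delta>) \<le> \<delta> * c\<close>; this choice makes the right side at most
    \<open>m / 2\<close>.\<close>
  define \<delta> where "\<delta> = m / (2 * (c + m))"
  have \<delta>: "0 < \<delta>" "\<delta> < 1" "\<delta> * c \<le> m / 2" using m c by (simp_all add: \<delta>_def field_simps)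
  have "m \<le> (1 - \<delta>)\<^sup>2 * m + \<delta>\<^sup>2 * c" using key'[of "1 - \<delta>"] \<delta> by simp
  then have "\<delta> * (m * (2 - \<delta>)) \<le> \<delta> * (\<delta> * c)" by (simp add: power2_eq_square algebra_simps)
  then have "m * (2 - \<delta>) \<le> \<delta> * c" using \<delta> by simp
  moreover have "m * 1 \<le> m * (2 - \<delta>)" using \<delta> m by (intro mult_left_mono) auto
  ultimately show False using \<delta> m by linarith
qed

text \<open>At a good time \<open>t\<close> a cheap control leaves a state \<open>x\<close> that is
  cheap to steer and close to \<open>S t y\<close>. By the quadratic bound \<open>S t y\<close> is
  then cheap too, and waiting carries this back to \<open>S r y\<close> because
  \<open>r < t\<close>.\<close>

lemma steering_cost_eq_0_S:
  assumes r: "r > 0" and y: "steering_cost y = 0"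
  shows "steering_cost (S r y) = 0"
proof -
  obtain C where C: "C \<ge> 0" "\<And>y u T. steers y u T \<Longrightarrow> \<exists>t x. r < t \<and> t \<le> 2 * r \<and> emb x = sol y u t \<and>
    norm (x - S t y) \<le> C * sqrt (energy u) \<and> (T \<le> r \<longrightarrow> x = 0)"
    using exists_good_time[OF r] by blast
  obtain c where c: "c \<ge> 0" "\<And>y. steering_cost y \<le> c * (norm y)\<^sup>2" using steering_cost_bounded by blast
  have bound: "steering_cost (S r y) \<le> (2 + 2 * c * C\<^sup>2) * energy u" if st: "steers y u T" for u T
  proof -
    obtain t x where tx: "r < t" "t \<le> 2 * r" "emb x = sol y u t" "norm (x - S t y) \<le> C * sqrt (energy u)"
      using C(2)[OF st] by blast
    have t: "t \<ge> 0" using tx r by simp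
    have u: "L2_on {0..} u" using st by (simp add: steers_iff)
    have "steering_cost (S r y) \<le> steering_cost (S (t - r) (S r y))"
      using tx by (intro steering_cost_S) simp
    also have "S (t - r) (S r y) = x + (S t y - x)"
      using tx r S_plus[of "t - r" r y] by simp
    also have "steering_cost \<dots> \<le> 2 * steering_cost x + 2 * steering_cost (S t y - x)"
      by (rule steering_cost_add)
    also have "steering_cost x \<le> energy u"
      using steering_cost_le[OF steers_advanced[OF st t tx(3)]] L2_on_advanced(2)[OF u t] by linarith
    also have "steering_cost (S t y - x) \<le> c * (C\<^sup>2 * energy u)"
    proof -
      have "(norm (S t y - x))\<^sup>2 \<le> (C * sqrt (energy u))\<^sup>2"
        using tx(4) by (intro power_mono) (auto simp: norm_minus_commute)
      also have "\<dots> = C\<^sup>2 * energy u" by (simp add: power_mult_distrib energy_nonneg)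
      finally show ?thesis using c by (meson mult_left_mono order_trans)
    qed
    finally show ?thesis by (simp add: algebra_simps)
  qed
  define q where "q = 2 + 2 * c * C\<^sup>2"
  have q: "q > 0" unfolding q_def using c(1) by (intro add_pos_nonneg) auto
  have "steering_cost (S r y) \<le> 0"
  proof (rule field_le_epsilon)
    fix e :: real assume e: "0 < e"
    then obtain u T where u: "steers y u T" "energy u < e / q"
      using steers_near_cost[of y "e / q"] q y by auto
    have "steering_cost (S r y) \<le> q * energy u" using bound[OF u(1)] by (simp add: q_def)
    also have "\<dots> \<le> e" using u(2) q by (simp add: field_simps)
    finally show "steering_cost (S r y) \<le> 0 + e" by simp
  qed
  then show ?thesis using steering_cost_nonneg[of "S r y"] by simp
qed

text \<open>Closedness rests on the quadratic bound: the cost of a limit is at most twice the cost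
  of its difference from a null element.\<close>

lemma steering_cost_zero_set: "csubspace {y. steering_cost y = 0}" "closed {y. steering_cost y = 0}"
proof -
  let ?N = "{y. steering_cost y = 0}"
  have 0: "steering_cost 0 = 0"
    using steering_cost_le[OF steers_zero[of 0]] steering_cost_nonneg[of 0] by (simp add: energy_def)
  have sc: "steering_cost (c *\<^sub>C y) = 0" if "steering_cost y = 0" for c y
    using steering_cost_scaleC[of c y] steering_cost_nonneg[of "c *\<^sub>C y"] that by simp
  have add: "steering_cost (x + y) = 0" if "steering_cost x = 0" "steering_cost y = 0" for x y
    using steering_cost_add[of x y] steering_cost_nonneg[of "x + y"] that by simp
  show "csubspace ?N"
    unfolding csubspace_def subspace_def using 0 sc add by (auto simp: scaleR_scaleC)
  obtain c where c: "c \<ge> 0" "\<And>y. steering_cost y \<le> c * (norm y)\<^sup>2" using steering_cost_bounded by blast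
  show "closed ?N"
    unfolding closed_sequential_limits
  proof (intro allI impI, elim conjE)
    fix x l assume x: "\<forall>n. x n \<in> ?N" and l: "x \<longlonglongrightarrow> l"
    have "steering_cost l \<le> 2 * c * (norm (l - x n))\<^sup>2" for n
      using steering_cost_add[of "l - x n" "x n"] c(2)[of "l - x n"] x by simp
    moreover have "(\<lambda>n. 2 * c * (norm (l - x n))\<^sup>2) \<longlonglongrightarrow> 2 * c * (norm (l - l))\<^sup>2"
      by (intro tendsto_intros l)
    ultimately have "steering_cost l \<le> 2 * c * (norm (l - l))\<^sup>2"
      by (intro LIMSEQ_le_const) auto
    then show "l \<in> ?N" using steering_cost_nonneg[of l] by simp
  qed
qed

end

end

section \<open>Vanishing of the cost for spectrum in the closed left half plane\<close>

context control_system
begin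

text \<open>Let \<open>N\<close> be the null space of the cost and \<open>T\<close> the compression of \<open>S r\<close> to its orthogonal
  complement. An eigenvalue of \<open>T\<close> outside the closed unit disc would be an eigenvalue of \<open>S r\<close>,
  and an eigenvector for any other one has bounded orbits modulo \<open>N\<close>, hence lies in \<open>N\<close>. So \<open>T\<close> has
  no eigenvalues, all its orbits are bounded, and the cost vanishes.\<close>

lemma steering_cost_eq_0:
  assumes controllable: "\<And>y. \<exists>T u. steers y u T"
    and r: "r > 0" and K: "sequentially_compact_operator (S r)"
    and spec: "\<And>l. l \<in> spectrum D A \<Longrightarrow> Re l \<le> 0"
  shows "steering_cost y = 0"
proof -
  note cost_add = steering_cost_add[OF controllable]
  note cost_nonneg = steering_cost_nonneg[OF controllable]
  note cost_bounded_orbit = steering_cost_eq_0_if_bounded[OF controllable r]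
  define N where "N = {y. steering_cost y = 0}"
  note N = steering_cost_zero_set[OF controllable, folded N_def]
  have Ns: "subspace N" using N(1) by (simp add: csubspace_def)
  have Nsc: "x \<in> N \<Longrightarrow> c *\<^sub>C x \<in> N" for c x using N(1) by (simp add: csubspace_def)
  have NK: "S r x \<in> N" if "x \<in> N" for x
    using steering_cost_eq_0_S[OF controllable r] that by (simp add: N_def)
  have Kc: "bounded_clinear (S r)" using r by (simp add: bounded_clinear_S)
  interpret K: bounded_linear "S r" by (rule bounded_clinear_bl[OF Kc])
  note KC = bounded_clinear_scaleC[OF Kc]
  let ?P = "orth_proj N"
  have Pc: "bounded_clinear ?P" by (rule bounded_clinear_orth_proj[OF N(2,1)])
  interpret P: bounded_linear ?P by (rule bounded_clinear_bl[OF Pc])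
  note PC = bounded_clinear_scaleC[OF Pc]
  have PN: "?P x \<in> N" for x by (rule orth_proj_in[OF N(2) Ns])
  have Pid: "?P x = x" if "x \<in> N" for x by (rule orth_proj_id[OF N(2) Ns that])
  \<comment> \<open>Up to a factor 2 the cost depends only on the class modulo \<open>N\<close>,
    which is enough for bounds along orbits.\<close>
  have cost_mod: "steering_cost x \<le> 2 * steering_cost z" if "x - z \<in> N" for x z
    using cost_add[of z "x - z"] that by (simp add: N_def)
  have Kpow: "S (real n * r) x = (S r ^^ n) x" for n x
  proof (induction n)
    case (Suc n)
    have "S (r + real n * r) x = S r (S (real n * r) x)" using r by (intro S_plus) auto
    then show ?case using Suc by (simp add: algebra_simps)
  qed simp
  define T where "T x = S r x - ?P (S r x)" for x
  have "bounded_clinear (\<lambda>x. x - ?P x)"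
    using Pc by (auto simp: bounded_clinear_def scaleC_diff_right intro!: bounded_linear_sub bounded_linear_ident)
  then have Tcomp: "sequentially_compact_operator T"
    unfolding T_def by (rule sequentially_compact_compose_left[OF K])
  have noev: "x = 0" if "\<zeta> *\<^sub>C T x = x" for \<zeta> x
  proof (rule ccontr)
    assume "x \<noteq> 0"
    then have \<zeta>: "\<zeta> \<noteq> 0" using that by auto
    define m where "m = 1 / \<zeta>"
    have m0: "m \<noteq> 0" using \<zeta> by (simp add: m_def)
    have "T x = m *\<^sub>C \<zeta> *\<^sub>C T x" using \<zeta> by (simp add: m_def scaleC_scaleC)
    then have Tx: "T x = m *\<^sub>C x" using that by simp
    \<comment> \<open>The vector \<open>x\<close> is orthogonal to \<open>N\<close>, so placing it
      in \<open>N\<close> will force it to vanish.\<close>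
    have "?P (T x) = 0" unfolding T_def by (simp add: P.diff Pid[OF PN])
    then have Px: "?P x = 0" using Tx m0 by (simp add: PC scaleC_eq_0_iff)
    have "S r x - m *\<^sub>C x = ?P (S r x)" using Tx by (simp add: T_def algebra_simps)
    then have Kx: "S r x - m *\<^sub>C x \<in> N" using PN by simp
    have "x \<in> N"
    proof (cases "cmod m \<le> 1")
      case True
      \<comment> \<open>Modulo the invariant \<open>N\<close> the orbit is \<open>m ^ n\<close>
        times \<open>x\<close>, so its cost stays bounded even if the orbit itself does not.\<close>
      have orbit: "(S r ^^ n) x - (m ^ n) *\<^sub>C x \<in> N" for n
      proof (induction n)
        case (Suc n)
        have "(S r ^^ Suc n) x - (m ^ Suc n) *\<^sub>C x
          = S r ((S r ^^ n) x - (m ^ n) *\<^sub>C x) + (m ^ n) *\<^sub>C (S r x - m *\<^sub>C x)"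
          by (simp add: K.diff KC scaleC_diff_right scaleC_scaleC mult.commute)
        then show ?case using NK[OF Suc] Nsc[OF Kx] Ns by (simp add: subspace_add)
      qed (simp add: subspace_0[OF Ns])
      have "steering_cost (S (real n * r) x) \<le> 2 * steering_cost x" for n
      proof -
        have "steering_cost (S (real n * r) x) \<le> 2 * steering_cost ((m ^ n) *\<^sub>C x)"
          unfolding Kpow by (rule cost_mod[OF orbit])
        also have "steering_cost ((m ^ n) *\<^sub>C x) \<le> (cmod (m ^ n))\<^sup>2 * steering_cost x"
          by (rule steering_cost_scaleC[OF controllable])
        also have "\<dots> \<le> 1 * steering_cost x"
          using True cost_nonneg by (intro mult_right_mono) (auto simp: norm_power power_le_one)
        finally show ?thesis by simp
      qed
      then have "steering_cost x = 0" by (rule cost_bounded_orbit)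
      then show ?thesis by (simp add: N_def)
    next
      case False
      \<comment> \<open>A point of the open right half plane supplies the resolvent that links
        eigenvalues of \<open>S r\<close> to the spectrum.\<close>
      have "1 \<in> resolvent_set D A" using spec[of 1] by (auto simp: spectrum_def)
      have inj: "z = 0" if eig: "S r z = m *\<^sub>C z" for z
      proof (rule ccontr)
        assume "z \<noteq> 0"
        then obtain l where l: "l \<in> spectrum D A" "exp (l * of_real r) = m"
          using eigenvalue_imp_spectrum[OF r K eig _ m0 \<open>1 \<in> resolvent_set D A\<close>] by blast
        have "cmod m = exp (Re l * r)" using l(2) by (auto simp: norm_exp_eq_Re)
        moreover have "Re l * r \<le> 0" using spec[OF l(1)] r by (simp add: mult_nonpos_nonneg)
        ultimately show False using False by simp
      qed
      \<comment> \<open>The compression lets the equation satisfied by \<open>x\<close> be solved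
        inside \<open>N\<close>: its solution \<open>z\<close> lies in \<open>N\<close>, and
        \<open>z - x\<close> would be an eigenvector of \<open>S r\<close> for \<open>m\<close>
        unless it is 0.\<close>
      let ?T = "\<lambda>z. (1/m) *\<^sub>C S r (?P z)"
      have comp: "sequentially_compact_operator ?T"
        by (intro sequentially_compact_scaleC sequentially_compact_compose_right[OF K Pc])
      have "z = 0" if "?T z = z" for z
      proof -
        have "?T z \<in> N" using Nsc[OF NK[OF PN]] .
        then have "z \<in> N" using that by simp
        then have "m *\<^sub>C z = m *\<^sub>C (1/m) *\<^sub>C S r z" using that Pid by simp
        then show ?thesis using inj m0 by (simp add: scaleC_scaleC)
      qed
      then have "surj (\<lambda>z. z - ?T z)" by (rule fredholm_injective_imp_surjective[OF comp])
      from surjD[OF this, of "x - (1/m) *\<^sub>C S r x"]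
      obtain z where z: "x - (1/m) *\<^sub>C S r x = z - ?T z" by blast
      have "x - (1/m) *\<^sub>C S r x = (- 1/m) *\<^sub>C (S r x - m *\<^sub>C x)"
        using m0 by (simp add: scaleC_diff_right scaleC_scaleC scaleC_minus_left)
      then have "x - (1/m) *\<^sub>C S r x \<in> N" using Nsc[OF Kx] by simp
      then have "(z - ?T z) + ?T z \<in> N"
        unfolding z by (intro subspace_add[OF Ns] Nsc NK PN)
      then have zN: "z \<in> N" by simp
      have "z - x = (1/m) *\<^sub>C S r (z - x)"
        using z Pid[OF zN] by (simp add: K.diff scaleC_diff_right algebra_simps)
      then have "m *\<^sub>C (z - x) = m *\<^sub>C (1/m) *\<^sub>C S r (z - x)" by (rule arg_cong)
      then have "S r (z - x) = m *\<^sub>C (z - x)" using m0 by (simp add: scaleC_scaleC)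
      then have "z - x = 0" by (rule inj)
      then show ?thesis using zN by simp
    qed
    then show False using Px Pid \<open>x \<noteq> 0\<close> by simp
  qed
  obtain b where b: "\<And>n. norm ((T ^^ n) y) \<le> b"
    using power_bounded_if_no_eigenvalue[OF Tcomp, of y] noev by blast
  obtain c where c: "c \<ge> 0" "\<And>y. steering_cost y \<le> c * (norm y)\<^sup>2"
    using steering_cost_bounded[OF controllable] by blast
  \<comment> \<open>Modulo \<open>N\<close> the powers of \<open>S r\<close> and of \<open>T\<close>
    agree, so the bound on the latter bounds the cost along the free orbit.\<close>
  have TK: "(S r ^^ n) y - (T ^^ n) y \<in> N" for n
  proof (induction n)
    case (Suc n)
    have "(S r ^^ Suc n) y - (T ^^ Suc n) y
      = S r ((S r ^^ n) y - (T ^^ n) y) + ?P (S r ((T ^^ n) y))"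
      by (simp add: T_def K.diff)
    then show ?case using NK[OF Suc] PN Ns by (simp add: subspace_add)
  qed (simp add: subspace_0[OF Ns])
  show ?thesis
  proof (rule cost_bounded_orbit)
    fix n
    have "steering_cost (S (real n * r) y) \<le> 2 * steering_cost ((T ^^ n) y)"
      unfolding Kpow by (rule cost_mod[OF TK])
    also have "steering_cost ((T ^^ n) y) \<le> c * b\<^sup>2"
      using c b[of n] by (meson mult_left_mono norm_ge_zero order_trans power_mono)
    finally show "steering_cost (S (real n * r) y) \<le> 2 * (c * b\<^sup>2)" by simp
  qed
qed

lemma NCVE_if_nonpositive_spectrum:
  assumes nc: "null_controllable emb S SV B"
    and r: "r > 0" and K: "sequentially_compact_operator (S r)"
    and spec: "\<And>l. l \<in> spectrum D A \<Longrightarrow> Re l \<le> 0"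
  shows "NCVE emb S SV B"
  unfolding NCVE_def NCVE_element_def
proof (intro allI impI conjI)
  fix y and \<epsilon> :: real
  show "can_be_steered emb S SV B y" using nc by (simp add: null_controllable_def)
  assume "\<epsilon> > 0"
  have controllable: "\<exists>T u. steers y u T" for y
    using nc by (simp add: null_controllable_def can_be_steered_def)
  have "steering_cost y < \<epsilon>\<^sup>2" using steering_cost_eq_0[OF controllable r K spec] \<open>\<epsilon> > 0\<close> by simp
  then obtain u T where "steers y u T" "energy u < \<epsilon>\<^sup>2" using steers_near_cost[OF controllable] by blast
  then show "\<exists>T u. steers y u T \<and> (\<integral>s. (norm (u s))\<^sup>2 \<partial>lebesgue_on {0..}) \<le> \<epsilon>\<^sup>2"
    unfolding energy_def by (intro exI conjI less_imp_le)
qed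

end

theorem corollary1p8:
  fixes domA :: "'h::complex_hilbert set"
    and A :: "'h \<Rightarrow> 'h"
    and S :: "real \<Rightarrow> 'h \<Rightarrow> 'h"
    and pair :: "'v::complex_hilbert \<Rightarrow> 'h \<Rightarrow> complex"
    and emb :: "'h \<Rightarrow> 'v"
    and SV :: "real \<Rightarrow> 'v \<Rightarrow> 'v"
    and B :: "'u::complex_hilbert \<Rightarrow> 'v"
  assumes "generates_C0_semigroup domA A S"
    and "is_dual_of pair (adjoint_dom domA A) (adjoint_graph_norm domA A)"
    and "emb = dual_embedding (adjoint_dom domA A) pair"
    and "generates_C0_semigroup (range emb) (extended_op domA A pair) SV"
    and "bounded_clinear B"
    and "\<And>T. T > 0 \<Longrightarrow> L2_continuous_input_map emb SV B T"
    and "eventually_compact S"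
  shows "(spectral_bound domA A \<le> 0 \<longrightarrow> (null_controllable emb S SV B \<longleftrightarrow> NCVE emb S SV B))
       \<and> (spectral_bound domA A > 0 \<longrightarrow> \<not> NCVE emb S SV B)"
proof -
  interpret control_system domA A S pair emb SV B
    using assms(1-6) by unfold_locales
  obtain r where r: "r > 0" and "compact_operator (S r)"
    using assms(7) unfolding eventually_compact_def by blast
  then have K: "sequentially_compact_operator (S r)" by (intro compact_operator_imp_sequentially_compact)
  have "NCVE emb S SV B" if "spectral_bound domA A \<le> 0" "null_controllable emb S SV B"
  proof (rule NCVE_if_nonpositive_spectrum[OF that(2) r K])
    fix l assume "l \<in> spectrum domA A"
    then have "ereal (Re l) \<le> spectral_bound domA A"
      unfolding spectral_bound_def by (rule SUP_upper)
    then have "ereal (Re l) \<le> 0" using that(1) by (rule order_trans)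
    then show "Re l \<le> 0" by simp
  qed
  moreover have "null_controllable emb S SV B" if "NCVE emb S SV B"
    using that by (simp add: NCVE_def NCVE_element_def null_controllable_def)
  moreover have "\<not> NCVE emb S SV B" if pos: "spectral_bound domA A > 0"
  proof -
    obtain l where "l \<in> spectrum domA A" "0 < ereal (Re l)"
      using pos unfolding spectral_bound_def less_SUP_iff by blast
    then show ?thesis using not_NCVE_if_positive_spectrum[OF r K] by simp
  qed
  ultimately show ?thesis by blast
qed

end
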